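(* Let $K$ be a finite extension of the differential field $(\mathbb{C}(z),\frac{d}{dz})$. For every differential operator $L\in K[\partial]$, $L\neq 0$, and every differential module $M$ over $K$, the $\mathbb{C}$-vector spaces $lgl(L)$ and $lgl(M)$ have finite dimension.
   Context: The derivation $\partial$ on $K$ is the unique one extending $\frac{d}{dz}$. For every place $v$ of $K$ (point of the smooth projective curve over $\mathbb{C}$ with function field $K$), $K_v\cong \mathbb{C}((t))$ is the completion of $K$ at $v$ with the extended derivation. A differential operator $L=a_n\partial^n+\cdots+a_1\partial+a_0$ with $a_i\in K$ acts on $K$ and on each $K_v$. A differential module over $K$ is a finite dimensional $K$-vector space $M$ with an additive map $\partial:M\to M$ satisfying $\partial(fm)=f'm+f\partial m$. $lgl(L)$ is the kernel of the natural $\mathbb{C}$-linear map $K/L(K)\to\prod_v K_v/L(K_v)$, and $lgl(M)$ is the kernel of the natural map $M/\partial M\to\prod_v (K_v\otimes_K M)/\partial(K_v\otimes_K M)$, where $v$ runs over all places of $K$. *)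

theory Defs
  imports
    "Jordan_Normal_Form.VS_Connect"
    "HOL-Computational_Algebra.Fraction_Field"
    "HOL-Computational_Algebra.Formal_Laurent_Series"
    "HOL-Library.Poly_Mapping"
    "HOL-Algebra.AbelCoset"
    "HOL-Analysis.Elementary_Topology"
begin

section \<open>Differential function fields and differential modules\<close>

definition derivation :: "('a::comm_ring \<Rightarrow> 'a) \<Rightarrow> bool" where
  "derivation d \<longleftrightarrow>
     (\<forall>x y. d (x + y) = d x + d y) \<and> (\<forall>x y. d (x * y) = d x * y + x * d y)"

text \<open>The field \<open>\<complex>(z)\<close> is the type \<^typ>\<open>complex poly fract\<close>. A finite extension \<open>K\<close> of it is
  a field type together with an embedding \<open>emb\<close> of \<open>\<complex>(z)\<close>; the last clause says that \<open>d\<close>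
  restricts to \<open>d/dz\<close>, by the quotient rule.\<close>

locale differential_function_field =
  fixes emb :: "complex poly fract \<Rightarrow> 'k::field"
    and d :: "'k \<Rightarrow> 'k"
  assumes emb_hom: "field_hom emb"
    and finite_extension: "\<exists>B. finite_dimensional_vector_space (\<lambda>a x. emb a * x) B"
    and derivation: "derivation d"
    and extends_ddz: "\<And>p q. q \<noteq> 0 \<Longrightarrow>
      d (emb (Fract p q)) = emb (Fract (pderiv p * q - p * pderiv q) (q ^ 2))"

definition const_emb :: "(complex poly fract \<Rightarrow> 'k::field) \<Rightarrow> complex \<Rightarrow> 'k" where
  "const_emb emb c = emb (Fract [:c:] 1)"

locale differential_module =
  fixes d :: "'k::field \<Rightarrow> 'k"
    and smul :: "'k \<Rightarrow> 'm::ab_group_add \<Rightarrow> 'm"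
    and dM :: "'m \<Rightarrow> 'm"
  assumes finite_dimensional: "\<exists>B. finite_dimensional_vector_space smul B"
    and dM_add: "dM (m + m') = dM m + dM m'"
    and dM_scale: "dM (smul f m) = smul (d f) m + smul f (dM m)"

text \<open>An operator \<open>a\<^sub>n\<partial>\<^sup>n + \<dots> + a\<^sub>1\<partial> + a\<^sub>0\<close> is encoded by its coefficients, as the polynomial
  with these coefficients (only the additive structure of polynomials is relevant). It acts on
  every differential extension \<open>\<iota>\<close> of the coefficient field.\<close>

definition diffop :: "('k::field \<Rightarrow> 'f::field) \<Rightarrow> ('f \<Rightarrow> 'f) \<Rightarrow> 'k poly \<Rightarrow> 'f \<Rightarrow> 'f" where
  "diffop \<iota> D L g = (\<Sum>i\<le>Polynomial.degree L. \<iota> (Polynomial.coeff L i) * (D ^^ i) g)"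


section \<open>Places and completions\<close>

text \<open>The points of the smooth projective curve with function field \<open>K\<close> are the normalised
  discrete valuations of \<open>K\<close> that are trivial on \<open>\<complex>\<close>. The value at \<open>0\<close> carries no information;
  it is fixed to be \<open>0\<close>, as for \<^const>\<open>fls_subdegree\<close>, so that distinct functions are
  distinct places.\<close>

definition places :: "(complex poly fract \<Rightarrow> 'k::field) \<Rightarrow> ('k \<Rightarrow> int) set" where
  "places emb = {v. v 0 = 0
     \<and> (\<forall>x y. x \<noteq> 0 \<longrightarrow> y \<noteq> 0 \<longrightarrow> v (x * y) = v x + v y)
     \<and> (\<forall>x y. x \<noteq> 0 \<longrightarrow> y \<noteq> 0 \<longrightarrow> x + y \<noteq> 0 \<longrightarrow> min (v x) (v y) \<le> v (x + y))
     \<and> (\<forall>c. c \<noteq> 0 \<longrightarrow> v (const_emb emb c) = 0)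
     \<and> (\<exists>x. x \<noteq> 0 \<and> v x = 1)}"

text \<open>A completion of \<open>K\<close> at \<open>v\<close>, identified with the complete valued field \<open>\<complex>((t))\<close>, is a
  valuation preserving \<open>\<complex>\<close>-embedding with dense image. It is unique up to an automorphism of
  the valued field \<open>\<complex>((t))\<close>, so the kernels below do not depend on the choice.\<close>

definition is_completion ::
  "(complex poly fract \<Rightarrow> 'k::field) \<Rightarrow> ('k \<Rightarrow> int) \<Rightarrow> ('k \<Rightarrow> complex fls) \<Rightarrow> bool" where
  "is_completion emb v \<phi> \<longleftrightarrow> field_hom \<phi>
     \<and> (\<forall>c. \<phi> (const_emb emb c) = fls_const c)
     \<and> (\<forall>x. fls_subdegree (\<phi> x) = v x)
     \<and> closure (range \<phi>) = UNIV"

definition completion ::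
  "(complex poly fract \<Rightarrow> 'k::field) \<Rightarrow> ('k \<Rightarrow> int) \<Rightarrow> 'k \<Rightarrow> complex fls" where
  "completion emb v = (SOME \<phi>. is_completion emb v \<phi>)"

text \<open>The derivation of \<open>K\<^sub>v\<close> is the unique continuous one extending the derivation of \<open>K\<close>; it is
  in general not \<^const>\<open>fls_deriv\<close>.\<close>

definition completion_deriv ::
  "(complex poly fract \<Rightarrow> 'k::field) \<Rightarrow> ('k \<Rightarrow> 'k) \<Rightarrow> ('k \<Rightarrow> int) \<Rightarrow> complex fls \<Rightarrow> complex fls"
  where
  "completion_deriv emb d v = (THE D. derivation D \<and> continuous_on UNIV D
     \<and> (\<forall>x. D (completion emb v x) = completion emb v (d x)))"


section \<open>Complex vector spaces\<close>

text \<open>Vector spaces are module records. Their multiplicative components play no role and are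
  set to trivial values.\<close>

definition univ_space :: "(complex \<Rightarrow> 'v \<Rightarrow> 'v::ab_group_add) \<Rightarrow> (complex, 'v) module" where
  "univ_space sc = \<lparr>carrier = UNIV, monoid.mult = (\<lambda>_ _. 0), one = 0, zero = 0, add = (+),
     module.smult = sc\<rparr>"

definition quotient_space :: "('c, 'v) module \<Rightarrow> 'v set \<Rightarrow> ('c, 'v set) module" where
  "quotient_space V U =
     \<lparr>carrier = a_rcosets\<^bsub>V\<^esub> U, monoid.mult = (\<lambda>_ _. U), one = U, zero = U, add = set_add V,
      module.smult = (\<lambda>c X. \<Union>x\<in>X. U +>\<^bsub>V\<^esub> (c \<odot>\<^bsub>V\<^esub> x))\<rparr>"

text \<open>The map of quotients induced by \<open>h\<close>, with \<open>W\<close> the subspace of the target \<open>N\<close>.\<close>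

definition induced_map :: "('c, 'w) module \<Rightarrow> 'w set \<Rightarrow> ('v \<Rightarrow> 'w) \<Rightarrow> 'v set \<Rightarrow> 'w set" where
  "induced_map N W h X = (\<Union>x\<in>X. W +>\<^bsub>N\<^esub> h x)"

definition product_space :: "'i set \<Rightarrow> ('i \<Rightarrow> ('c, 'w) module) \<Rightarrow> ('c, 'i \<Rightarrow> 'w) module" where
  "product_space I N =
     \<lparr>carrier = (\<Pi>\<^sub>E i\<in>I. carrier (N i)),
      monoid.mult = (\<lambda>_ _. \<lambda>i\<in>I. \<zero>\<^bsub>N i\<^esub>), one = (\<lambda>i\<in>I. \<zero>\<^bsub>N i\<^esub>),
      zero = (\<lambda>i\<in>I. \<zero>\<^bsub>N i\<^esub>), add = (\<lambda>f g. \<lambda>i\<in>I. f i \<oplus>\<^bsub>N i\<^esub> g i),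
      module.smult = (\<lambda>c f. \<lambda>i\<in>I. c \<odot>\<^bsub>N i\<^esub> f i)\<rparr>"

text \<open>The kernel of \<open>V/U \<rightarrow> \<Prod>\<^sub>i N\<^sub>i/W\<^sub>i\<close> induced by the maps \<open>h\<^sub>i\<close>.\<close>

definition local_global_kernel ::
  "(complex, 'v) module \<Rightarrow> 'v set \<Rightarrow> 'i set \<Rightarrow> ('i \<Rightarrow> (complex, 'w) module) \<Rightarrow> ('i \<Rightarrow> 'w set) \<Rightarrow>
   ('i \<Rightarrow> 'v \<Rightarrow> 'w) \<Rightarrow> (complex, 'v set) module" where
  "local_global_kernel V U I N W h = (quotient_space V U)
     \<lparr>carrier := a_kernel (quotient_space V U) (product_space I (\<lambda>i. quotient_space (N i) (W i)))
                  (\<lambda>X. \<lambda>i\<in>I. induced_map (N i) (W i) (h i) X)\<rparr>"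

definition finite_dimensional_complex :: "(complex, 'v) module \<Rightarrow> bool" where
  "finite_dimensional_complex V \<longleftrightarrow>
     vectorspace class_ring V \<and> vectorspace.fin_dim class_ring V"


section \<open>The tensor product of a completion with a module\<close>

text \<open>\<open>K\<^sub>v \<otimes>\<^sub>K M\<close>, for \<open>K\<^sub>v\<close> a \<open>K\<close>-algebra through \<open>\<phi>\<close>, is the free abelian group on \<open>K\<^sub>v \<times> M\<close> modulo
  the following subgroup.\<close>

inductive_set tensor_rel ::
  "('k \<Rightarrow> complex fls) \<Rightarrow> ('k \<Rightarrow> 'm::ab_group_add \<Rightarrow> 'm) \<Rightarrow> ((complex fls \<times> 'm) \<Rightarrow>\<^sub>0 int) set"
  for \<phi> :: "'k \<Rightarrow> complex fls" and smul :: "'k \<Rightarrow> 'm::ab_group_add \<Rightarrow> 'm" where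
  add_left: "frag_of (g + h, m) - frag_of (g, m) - frag_of (h, m) \<in> tensor_rel \<phi> smul"
| add_right: "frag_of (g, m + n) - frag_of (g, m) - frag_of (g, n) \<in> tensor_rel \<phi> smul"
| balanced: "frag_of (\<phi> a * g, m) - frag_of (g, smul a m) \<in> tensor_rel \<phi> smul"
| diff: "x \<in> tensor_rel \<phi> smul \<Longrightarrow> y \<in> tensor_rel \<phi> smul \<Longrightarrow> x - y \<in> tensor_rel \<phi> smul"

text \<open>The scalar multiplication \<open>c (g \<otimes> m) = cg \<otimes> m\<close> makes only the quotient, not the free
  abelian group, a complex vector space.\<close>

abbreviation free_tensor :: "(complex, (complex fls \<times> 'm) \<Rightarrow>\<^sub>0 int) module" where
  "free_tensor \<equiv> univ_space (\<lambda>c. frag_extend (\<lambda>(g, m). frag_of (fls_const c * g, m)))"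

definition tensor ::
  "('k \<Rightarrow> complex fls) \<Rightarrow> ('k \<Rightarrow> 'm::ab_group_add \<Rightarrow> 'm) \<Rightarrow>
   (complex, ((complex fls \<times> 'm) \<Rightarrow>\<^sub>0 int) set) module" where
  "tensor \<phi> smul = quotient_space free_tensor (tensor_rel \<phi> smul)"

text \<open>The map \<open>m \<mapsto> 1 \<otimes> m\<close>.\<close>

definition tensor_unit ::
  "('k \<Rightarrow> complex fls) \<Rightarrow> ('k \<Rightarrow> 'm::ab_group_add \<Rightarrow> 'm) \<Rightarrow> 'm \<Rightarrow>
   ((complex fls \<times> 'm) \<Rightarrow>\<^sub>0 int) set" where
  "tensor_unit \<phi> smul m = tensor_rel \<phi> smul +>\<^bsub>free_tensor\<^esub> frag_of (1, m)"

text \<open>The derivation \<open>\<partial>(g \<otimes> m) = D g \<otimes> m + g \<otimes> \<partial>m\<close>.\<close>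

definition tensor_deriv ::
  "('k \<Rightarrow> complex fls) \<Rightarrow> (complex fls \<Rightarrow> complex fls) \<Rightarrow>
   ('k \<Rightarrow> 'm::ab_group_add \<Rightarrow> 'm) \<Rightarrow> ('m \<Rightarrow> 'm) \<Rightarrow>
   ((complex fls \<times> 'm) \<Rightarrow>\<^sub>0 int) set \<Rightarrow> ((complex fls \<times> 'm) \<Rightarrow>\<^sub>0 int) set" where
  "tensor_deriv \<phi> D smul dM =
     induced_map free_tensor (tensor_rel \<phi> smul)
       (frag_extend (\<lambda>(g, m). frag_of (D g, m) + frag_of (g, dM m)))"


section \<open>The local-global spaces\<close>

definition lgl_operator ::
  "(complex poly fract \<Rightarrow> 'k::field) \<Rightarrow> ('k \<Rightarrow> 'k) \<Rightarrow> 'k poly \<Rightarrow> (complex, 'k set) module" where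
  "lgl_operator emb d L =
     local_global_kernel
       (univ_space (\<lambda>c f. const_emb emb c * f)) (range (diffop id d L))
       (places emb)
       (\<lambda>v. univ_space (\<lambda>c g. fls_const c * g))
       (\<lambda>v. range (diffop (completion emb v) (completion_deriv emb d v) L))
       (completion emb)"

definition lgl_module ::
  "(complex poly fract \<Rightarrow> 'k::field) \<Rightarrow> ('k \<Rightarrow> 'k) \<Rightarrow> ('k \<Rightarrow> 'm::ab_group_add \<Rightarrow> 'm) \<Rightarrow> ('m \<Rightarrow> 'm) \<Rightarrow>
   (complex, 'm set) module" where
  "lgl_module emb d smul dM =
     local_global_kernel
       (univ_space (\<lambda>c. smul (const_emb emb c))) (range dM)
       (places emb)
       (\<lambda>v. tensor (completion emb v) smul)
       (\<lambda>v. tensor_deriv (completion emb v) (completion_deriv emb d v) smul dM `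
              carrier (tensor (completion emb v) smul))
       (\<lambda>v. tensor_unit (completion emb v) smul)"

end

theory Submission
  imports
    Defs
    "Jordan_Normal_Form.Char_Poly"
    "HOL-Computational_Algebra.Fundamental_Theorem_Algebra"
    "HOL-Analysis.Elementary_Metric_Spaces"
begin

text \<open>
Restricting scalars to \<open>\<complex>(z)\<close> along a primitive element \<open>y\<close>, integral over \<open>\<complex>[z]\<close>, a differential
system over \<open>K\<close> has its coefficients in the ring of fractions with denominators powers of some
polynomial \<open>f\<close>. Let \<open>a\<close> be a point with \<open>f(a) \<noteq> 0\<close>. Above it the minimal polynomial of \<open>y\<close> splits
into distinct linear factors, each giving by Hensel's lemma an unramified place at which the system
is regular. If a vector lies locally in the image of the connection at all these places, then
subtracting from it the image of a vector with the principal parts of the local solutions removes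
its pole at \<open>a\<close>. So modulo the image every element of the local-global space has a power of \<open>f\<close>
as denominator, and it remains to see that the connection has a finite dimensional cokernel on such
vectors. This is a count: the vectors \<open>p/f\<^sup>k\<close> with \<open>deg p \<le> ke\<close> form a filtration of linearly growing
dimension which the connection raises by one step, and the connection is injective on the vectors
vanishing at a point. Scalar operators are reduced to systems by their companion matrices.
\<close>

section \<open>Linear systems\<close>

text \<open>Finite dimension is obtained from a uniform bound: for a fixed connection matrix there
  is N such that any N + 1 locally solvable vectors are linearly dependent modulo the image.
  Clearing the poles away from f does not suffice for this, since it leaves unbounded powers of f,
  hence an infinite dimensional space. With r the rank over C(z), numerators of degree at most ke
  vanishing at a have dimension ker, and those of degree at most (k+1)e have dimension ((k+1)e +
  1)r; the difference (e + 1)r is independent of k, and it is the bound.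

  A second obstacle is that \<open>completion\<close> is a choice and
  \<open>completion_deriv\<close> a definite description. Nothing is known about them until a
  completion has been constructed at every place, which requires that all residue fields are C, and
  until d is shown to have exactly one continuous extension, namely d/dt divided by dz/dt. The
  tensor products are likewise bare quotients of free abelian groups; they are compared with systems
  through coordinate maps that vanish on the defining relations.\<close>

lemma homogeneous_system_solution:
  fixes a :: "'i \<Rightarrow> 'j \<Rightarrow> 'a::idom"
  assumes "finite I" "finite J" "card I < card J"
  shows "\<exists>c. (\<exists>j\<in>J. c j \<noteq> 0) \<and> (\<forall>i\<in>I. (\<Sum>j\<in>J. a i j * c j) = 0)"
  using assms
proof (induction I arbitrary: J a rule: finite_induct)
  case empty
  then have "J \<noteq> {}" by auto
  then show ?case by (intro exI[of _ "\<lambda>_. 1"]) auto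
next
  case (insert i0 I)
  show ?case
  proof (cases "\<forall>j\<in>J. a i0 j = 0")
    case True
    with insert.IH[of J a] insert.prems insert.hyps show ?thesis
      by (auto simp: card_insert_if)
  next
    case False
    then obtain j0 where j0: "j0 \<in> J" "a i0 j0 \<noteq> 0" by auto
    define J' where "J' = J - {j0}"
    have J: "J = insert j0 J'" "j0 \<notin> J'" "finite J'" using j0 insert.prems by (auto simp: J'_def)
    obtain c where c: "\<exists>j\<in>J'. c j \<noteq> 0"
      "\<And>i. i \<in> I \<Longrightarrow> (\<Sum>j\<in>J'. (a i0 j0 * a i j - a i j0 * a i0 j) * c j) = 0"
      using insert.IH[of J' "\<lambda>i j. a i0 j0 * a i j - a i j0 * a i0 j"] insert.prems insert.hyps J
      by (auto simp: card_insert_if)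
    \<comment> \<open>Back substitution without division: the solution of the reduced system is
      scaled by the pivot, and the eliminated unknown takes minus the rest of the pivot row. The
      pivot is nonzero in a domain, so the solution stays nontrivial.\<close>
    define c' where "c' = (\<lambda>j. if j = j0 then - (\<Sum>j\<in>J'. a i0 j * c j) else a i0 j0 * c j)"
    have s: "(\<Sum>j\<in>J. a i j * c' j)
        = (\<Sum>j\<in>J'. (a i0 j0 * a i j - a i j0 * a i0 j) * c j)" for i
    proof -
      have "(\<Sum>j\<in>J'. a i j * c' j) = (\<Sum>j\<in>J'. a i j * (a i0 j0 * c j))"
        using J by (intro sum.cong) (auto simp: c'_def)
      then show ?thesis using J
        by (simp add: c'_def algebra_simps sum_subtractf sum_distrib_left)
    qed
    show ?thesis
    proof (intro exI[of _ c'] conjI ballI)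
      show "\<exists>j\<in>J. c' j \<noteq> 0" using c(1) J j0 by (auto simp: c'_def)
      show "(\<Sum>j\<in>J. a i j * c' j) = 0" if "i \<in> insert i0 I" for i
        using that c(2) unfolding s by (cases "i = i0") simp_all
    qed
  qed
qed


section \<open>Connections over polynomials\<close>

text \<open>With \<open>A = B/f\<close>, the connection \<open>d/dz + A\<close> maps \<open>p/f\<^sup>k\<close> to
  \<open>polynomial_connection f k I B p / f\<^sup>(\<^sup>k\<^sup>+\<^sup>1\<^sup>)\<close>.\<close>

definition polynomial_connection ::
  "complex poly \<Rightarrow> nat \<Rightarrow> 'i set \<Rightarrow> ('i \<Rightarrow> 'i \<Rightarrow> complex poly) \<Rightarrow> ('i \<Rightarrow> complex poly) \<Rightarrow> 'i \<Rightarrow> complex poly"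
  where "polynomial_connection f k I B p i =
    pderiv (p i) * f - of_nat k * (pderiv f * p i) + (\<Sum>j\<in>I. B i j * p j)"

lemma polynomial_connection_sum:
  "polynomial_connection f k I B (\<lambda>i. \<Sum>s\<in>S. smult (x s) (p s i)) i
     = (\<Sum>s\<in>S. smult (x s) (polynomial_connection f k I B (p s) i))"
proof -
  have "(\<Sum>j\<in>I. B i j * (\<Sum>s\<in>S. smult (x s) (p s j)))
      = (\<Sum>s\<in>S. smult (x s) (\<Sum>j\<in>I. B i j * p s j))"
    unfolding sum_distrib_left smult_sum2 by (subst sum.swap) simp
  moreover have "pderiv (\<Sum>s\<in>S. smult (x s) (p s i)) = (\<Sum>s\<in>S. smult (x s) (pderiv (p s i)))"
    by (simp add: pderiv_sum pderiv_smult)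
  ultimately show ?thesis
    unfolding polynomial_connection_def
    by (simp add: sum_distrib_left sum_distrib_right smult_add_right smult_diff_right
        sum.distrib sum_subtractf)
qed

lemma degree_polynomial_connection:
  assumes "degree f < e" "\<And>j. j \<in> I \<Longrightarrow> degree (B i j) \<le> e"
    and p: "\<And>j. j \<in> insert i I \<Longrightarrow> degree (p j) \<le> n"
  shows "degree (polynomial_connection f k I B p i) \<le> n + e"
  unfolding polynomial_connection_def
proof (intro degree_add_le degree_diff_le )
  show "degree (pderiv (p i) * f) \<le> n + e"
    using degree_mult_le[of "pderiv (p i)" f] p[of i] assms(1) degree_pderiv_le[of "p i"] by simp
  have "degree (of_nat k * (pderiv f * p i)) \<le> degree (pderiv f * p i)"
    using degree_mult_le[of "of_nat k" "pderiv f * p i"] by simp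
  also have "\<dots> \<le> n + e"
    using degree_mult_le[of "pderiv f" "p i"] p[of i] assms(1) degree_pderiv_le[of f] by simp
  finally show "degree (of_nat k * (pderiv f * p i)) \<le> n + e" .
  show "degree (\<Sum>j\<in>I. B i j * p j) \<le> n + e"
  proof (cases "finite I")
    case True
    show ?thesis
    proof (rule degree_sum_le[OF True])
      show "degree (B i j * p j) \<le> n + e" if "j \<in> I" for j
        using degree_mult_le[of "B i j" "p j"] assms(2)[of j] p[of j] that by simp
    qed
  qed auto
qed

text \<open>Uniqueness at an ordinary point: p/f^k is horizontal. If p = t^(m+1) s with t = z - a,
  the lowest term of the equation at \<open>a\<close> is (m+1) s(a) f(a), so s(a) = 0 and the order
  of vanishing grows. A polynomial vanishing to every order is 0.\<close>

lemma polynomial_connection_inj: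
  assumes fa: "poly f a \<noteq> 0" and T: "\<And>i. i \<in> I \<Longrightarrow> polynomial_connection f k I B p i = 0"
    and pa: "\<And>i. i \<in> I \<Longrightarrow> poly (p i) a = 0" and i: "i \<in> I"
  shows "p i = 0"
proof -
  define t where "t = [:-a, 1:]"
  have t: "pderiv t = 1" "poly t a = 0" "t \<noteq> 0" "degree (t ^ n) = n"
    and t_dvd: "t dvd q \<longleftrightarrow> poly q a = 0" for n q
    by (simp_all add: t_def pderiv_pCons poly_eq_0_iff_dvd degree_linear_power)
  have "\<forall>i\<in>I. t ^ Suc m dvd p i" for m
  proof (induction m)
    case 0
    then show ?case using pa by (simp add: t_dvd)
  next
    case (Suc m)
    then have "\<forall>i\<in>I. \<exists>s. p i = t ^ Suc m * s" by (simp add: dvd_def)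
    then obtain s where s: "\<And>i. i \<in> I \<Longrightarrow> p i = t ^ Suc m * s i"
      using bchoice[of I "\<lambda>i s. p i = t ^ Suc m * s"] by blast
    have "poly (s i) a = 0" if i: "i \<in> I" for i
    proof -
      have d: "pderiv (p i) = t ^ m * (smult (of_nat (Suc m)) (s i) + t * pderiv (s i))"
        unfolding s[OF i] pderiv_mult pderiv_power_Suc
        by (simp add: algebra_simps t smult_add_left)
      have "(\<Sum>j\<in>I. B i j * p j) = t ^ Suc m * (\<Sum>j\<in>I. B i j * s j)"
        unfolding sum_distrib_left by (intro sum.cong) (simp_all add: s)
      then have "t ^ m * ((smult (of_nat (Suc m)) (s i) + t * pderiv (s i)) * f
          - of_nat k * (pderiv f * (t * s i)) + t * (\<Sum>j\<in>I. B i j * s j)) = 0"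
        using T[OF i] unfolding polynomial_connection_def d \<open>(\<Sum>j\<in>I. B i j * p j) = _\<close>
        unfolding s[OF i] by (simp add: algebra_simps)
      then have "(smult (of_nat (Suc m)) (s i) + t * pderiv (s i)) * f
          - of_nat k * (pderiv f * (t * s i)) + t * (\<Sum>j\<in>I. B i j * s j) = 0"
        using t by simp
      then have "poly ((smult (of_nat (Suc m)) (s i) + t * pderiv (s i)) * f
          - of_nat k * (pderiv f * (t * s i)) + t * (\<Sum>j\<in>I. B i j * s j)) a = 0"
        by simp
      then have "of_nat (Suc m) * poly (s i) a * poly f a = 0"
        by (simp add: t)
      then show ?thesis using fa by (simp del: of_nat_Suc)
    qed
    then show ?case
      by (auto simp: s power_Suc2[of _ "Suc m"] t_dvd simp del: power_Suc intro!: mult_dvd_mono)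
  qed
  then have "t ^ Suc m dvd p i" for m using i by auto
  then have "t ^ Suc (degree (p i)) dvd p i" by blast
  then show ?thesis
    using t(4) dvd_imp_degree_le by (metis Suc_n_not_le_n)
qed

text \<open>The vectors \<open>p/f\<^sup>k\<close> with \<open>deg p \<le> ke\<close> form an exhaustive filtration which the connection
  raises by one and whose dimension grows linearly, with increments \<open>e \<cdot> card I\<close>; since the
  connection is injective on vectors vanishing at a point \<open>a\<close> with \<open>f(a) \<noteq> 0\<close>, this bounds the
  dimension of its cokernel.\<close>

lemma polynomial_connection_dependence:
  fixes w :: "'l \<Rightarrow> 'i \<Rightarrow> complex poly"
  assumes I: "finite I" and J: "finite J" "card J > card I * (e + 1)"
    and f: "f \<noteq> 0" "degree f < e" and B: "\<And>i j. i \<in> I \<Longrightarrow> j \<in> I \<Longrightarrow> degree (B i j) \<le> e"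
    and w: "\<And>l i. l \<in> J \<Longrightarrow> i \<in> I \<Longrightarrow> degree (w l i) \<le> k * e + e"
  shows "\<exists>c p. (\<exists>l\<in>J. c l \<noteq> 0) \<and>
    (\<forall>i\<in>I. (\<Sum>l\<in>J. smult (c l) (w l i)) = polynomial_connection f k I B p i)"
proof -
  let ?T = "polynomial_connection f k I B"
  obtain a where a: "poly f a \<noteq> 0" using f(1) poly_all_0_iff_0 by blast
  define t where "t = [:-a, 1:]"
  have t: "t \<noteq> 0" "degree t = 1" "poly t a = 0" by (simp_all add: t_def)
  \<comment> \<open>The vectors t z^s in coordinate j, with s < ke, form a basis of the numerators
    of degree at most ke that are divisible by t = z - a. There is one unknown for each
    \<open>w l\<close> and each basis vector, and one equation for each coefficient of degree at
    most ke + e in each coordinate.\<close>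
  define u :: "'i \<times> nat \<Rightarrow> 'i \<Rightarrow> complex poly" where "u = (\<lambda>(j, s) i. if i = j then t * monom 1 s else 0)"
  let ?P = "I \<times> {..<k * e}"
  define M where "M = (\<lambda>(i, r) x. case x of Inl l \<Rightarrow> coeff (w l i) r
      | Inr js \<Rightarrow> - coeff (?T (u js) i) r)"
  have less: "card (I \<times> {..k * e + e}) < card (Sum_Type.Plus J ?P)"
    using I J by (simp add: card_Plus card_cartesian_product algebra_simps)
  have fin: "finite (I \<times> {..k * e + e})" "finite (Sum_Type.Plus J ?P)"
    using I J by auto
  obtain c where c0: "\<exists>x\<in>Sum_Type.Plus J ?P. c x \<noteq> 0"
    and c': "\<forall>it\<in>I \<times> {..k * e + e}. (\<Sum>x\<in>Sum_Type.Plus J ?P. M it x * c x) = 0"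
    using homogeneous_system_solution[OF fin less, of M] by blast
  have c: "(\<Sum>x\<in>Sum_Type.Plus J ?P. M (i, r) x * c x) = 0" if "i \<in> I" "r \<le> k * e + e" for i r
    using bspec[OF c', of "(i, r)"] that by simp
  define p where "p = (\<lambda>i. \<Sum>js\<in>?P. smult (c (Inr js)) (u js i))"
  have p_eq: "p i = t * (\<Sum>s<k * e. monom (c (Inr (i, s))) s)" if "i \<in> I" for i
  proof -
    have sm: "smult x (t * monom 1 s) = t * monom x s" for x s
      using mult_smult_right[of t x "monom 1 s"] by (simp add: smult_monom)
    have "p i = (\<Sum>j\<in>I. \<Sum>s<k * e. smult (c (Inr (j, s))) (u (j, s) i))"
      unfolding p_def by (simp add: sum.cartesian_product)
    also have "\<dots> = (\<Sum>j\<in>I. if j = i then \<Sum>s<k * e. t * monom (c (Inr (i, s))) s else 0)"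
      by (intro sum.cong) (auto simp: u_def sm)
    finally show ?thesis using that I by (simp add: sum_distrib_left)
  qed
  have degp: "degree (p i) \<le> k * e" if "i \<in> I" for i
  proof (cases "k * e = 0")
    case True
    then show ?thesis using p_eq[OF that] by auto
  next
    case False
    then have "degree (\<Sum>s<k * e. monom (c (Inr (i, s))) s) \<le> k * e - 1"
      by (intro degree_sum_le) (auto intro: order_trans[OF degree_monom_le])
    moreover have "degree (t * (\<Sum>s<k * e. monom (c (Inr (i, s))) s))
        \<le> 1 + degree (\<Sum>s<k * e. monom (c (Inr (i, s))) s)"
      using degree_mult_le[of t "\<Sum>s<k * e. monom (c (Inr (i, s))) s"] unfolding t(2) .
    ultimately show ?thesis unfolding p_eq[OF that] using False by linarith
  qed
  have eq: "(\<Sum>l\<in>J. smult (c (Inl l)) (w l i)) = ?T p i" if i: "i \<in> I" for i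
  proof (rule poly_eqI)
    fix r
    show "coeff (\<Sum>l\<in>J. smult (c (Inl l)) (w l i)) r = coeff (?T p i) r"
    proof (cases "r \<le> k * e + e")
      case True
      have "0 = (\<Sum>l\<in>J. coeff (w l i) r * c (Inl l)) - (\<Sum>js\<in>?P. coeff (?T (u js) i) r * c (Inr js))"
        using c[OF i True] I J(1) by (simp add: M_def sum.Plus sum_negf)
      then show ?thesis
        unfolding p_def polynomial_connection_sum by (simp add: coeff_sum mult.commute)
    next
      case False
      have "degree (?T p i) \<le> k * e + e"
        using degp i f(2) B[OF i] by (intro degree_polynomial_connection) auto
      moreover have "degree (\<Sum>l\<in>J. smult (c (Inl l)) (w l i)) \<le> k * e + e"
        using w i J(1) by (intro degree_sum_le) (auto intro: order_trans[OF degree_smult_le])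
      ultimately show ?thesis using False by (simp add: coeff_eq_0)
    qed
  qed
  have "\<exists>l\<in>J. c (Inl l) \<noteq> 0"
  proof (rule ccontr)
    assume z: "\<not> (\<exists>l\<in>J. c (Inl l) \<noteq> 0)"
    have T0: "?T p i = 0" if "i \<in> I" for i
      unfolding eq[OF that, symmetric] using z by (intro sum.neutral) auto
    have pa: "poly (p i) a = 0" if "i \<in> I" for i
      unfolding p_eq[OF that] using t(3) by simp
    have p0: "p i = 0" if "i \<in> I" for i
      by (rule polynomial_connection_inj[OF a T0 pa that])
    have "c (Inr (i, s)) = 0" if "i \<in> I" "s < k * e" for i s
    proof -
      have "(\<Sum>s<k * e. monom (c (Inr (i, s))) s) = 0"
        using p0[OF that(1)] t(1) unfolding p_eq[OF that(1)] by simp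
      then have "coeff (\<Sum>s<k * e. monom (c (Inr (i, s))) s) s = 0" by simp
      then show ?thesis using that by (simp add: coeff_sum)
    qed
    then show False using c0 z by (auto elim!: PlusE)
  qed
  then show ?thesis using eq by (intro exI[of _ "\<lambda>l. c (Inl l)"] exI[of _ p] conjI ballI)
qed

section \<open>The function field\<close>

lemma common_denominator:
  fixes c :: "'j \<Rightarrow> 'a::idom fract"
  assumes "finite J"
  shows "\<exists>q p. q \<noteq> 0 \<and> (\<forall>j\<in>J. c j = Fract (p j) q)"
  using assms
proof (induction J rule: finite_induct)
  case empty
  show ?case by (intro exI[of _ 1]) auto
next
  case (insert j J)
  then obtain q p where qp: "q \<noteq> 0" "\<And>j. j \<in> J \<Longrightarrow> c j = Fract (p j) q" by blast
  obtain a b where ab: "b \<noteq> 0" "c j = Fract a b" by (metis Fract_cases)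
  show ?case
  proof (intro exI conjI ballI)
    show "q * b \<noteq> 0" using qp ab by simp
    show "c i = Fract ((\<lambda>i. if i = j then a * q else p i * b) i) (q * b)" if "i \<in> insert j J" for i
      using that qp ab insert.hyps by (auto simp: eq_fract)
  qed
qed

context differential_function_field
begin

sublocale emb: field_hom emb by (rule emb_hom)

definition pe :: "complex poly \<Rightarrow> 'k" where "pe p = emb (Fract p 1)"

sublocale pe: inj_idom_hom pe
proof unfold_locales
  fix p assume "pe p = 0"
  then show "p = 0" unfolding pe_def by (simp add: Zero_fract_def eq_fract)
qed (simp_all add: pe_def fract_collapse emb.hom_add[symmetric] emb.hom_mult[symmetric])

sublocale mpe: map_poly_inj_idom_hom pe ..

text \<open>\<open>pe p\<close> is \<open>p(z)\<close> and \<open>ev G y\<close> is \<open>G(z, y)\<close>, the coefficients of \<open>G\<close> being polynomials in \<open>z\<close>.\<close>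

definition ev :: "complex poly poly \<Rightarrow> 'k \<Rightarrow> 'k" where "ev G y = poly (map_poly pe G) y"

sublocale ev: idom_hom "\<lambda>G. ev G y" for y
  by unfold_locales (simp_all add: ev_def hom_distribs)

lemma ev_pCons [simp]: "ev (pCons p G) y = pe p + y * ev G y"
  by (simp add: ev_def hom_distribs)

lemma ev_0 [simp]: "ev 0 y = 0"
  by (simp add: ev_def)

lemma ev_smult: "ev (smult p G) y = pe p * ev G y"
  by (simp add: ev_def hom_distribs)

lemma ev_monom: "ev (monom p i) y = pe p * y ^ i"
  by (simp add: ev_def poly_monom)

lemma ev_sum: "ev (\<Sum>i\<in>I. G i) y = (\<Sum>i\<in>I. ev (G i) y)"
  by (rule ev.hom_sum)

lemma const_emb_eq: "const_emb emb c = pe [:c:]"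
  by (simp add: const_emb_def pe_def)

lemma const_emb_hom [simp]:
  "const_emb emb 0 = 0" "const_emb emb 1 = 1" "const_emb emb c = 0 \<longleftrightarrow> c = 0"
  "const_emb emb (a + b) = const_emb emb a + const_emb emb b"
  "const_emb emb (a * b) = const_emb emb a * const_emb emb b"
  "const_emb emb (a - b) = const_emb emb a - const_emb emb b"
  "const_emb emb (- a) = - const_emb emb a"
proof -
  show "const_emb emb 1 = 1" unfolding const_emb_eq one_pCons[symmetric] by simp
  show "const_emb emb (a * b) = const_emb emb a * const_emb emb b"
    unfolding const_emb_eq pe.hom_mult[symmetric] by simp
  show "const_emb emb (a + b) = const_emb emb a + const_emb emb b"
    unfolding const_emb_eq pe.hom_add[symmetric] by simp
  show "const_emb emb (a - b) = const_emb emb a - const_emb emb b"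
    unfolding const_emb_eq pe.hom_minus[symmetric] by simp
  show "const_emb emb (- a) = - const_emb emb a"
    unfolding const_emb_eq pe.hom_uminus[symmetric] by simp
qed (simp_all add: const_emb_eq)

lemma pe_eq_poly: "pe p = poly (map_poly (const_emb emb) p) (pe [:0, 1:])"
proof (induction p)
  case (pCons a p)
  have "pe (pCons a p) = pe [:a:] + pe [:0, 1:] * pe p"
    unfolding pe.hom_add[symmetric] pe.hom_mult[symmetric] by simp
  then show ?case using pCons by (simp add: map_poly_pCons const_emb_eq)
qed (simp add: const_emb_eq)

lemma emb_Fract: "emb (Fract p q) = pe p / pe q" if "q \<noteq> 0"
proof -
  have "Fract p q * Fract q 1 = Fract p 1" using that by (simp add: eq_fract)
  then have "emb (Fract p q) * pe q = pe p" unfolding pe_def emb.hom_mult[symmetric] by simp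
  then show ?thesis using that by (simp add: eq_divide_eq)
qed

lemma infinite_const: "infinite (range (const_emb emb))"
proof
  assume "finite (range (const_emb emb))"
  moreover have "inj (const_emb emb)" by (auto simp: inj_def const_emb_eq)
  ultimately have "finite (UNIV :: complex set)" by (rule finite_imageD)
  then show False by (simp add: infinite_UNIV_char_0)
qed

definition field_degree :: nat where
  "field_degree = card (SOME B. finite_dimensional_vector_space (\<lambda>a x. emb a * x) B)"

lemma finite_basis:
  obtains B where "finite B" "card B = field_degree" "\<And>x. \<exists>r. x = (\<Sum>b\<in>B. emb (r b) * b)"
proof -
  define B where "B = (SOME B. finite_dimensional_vector_space (\<lambda>a x. emb a * x) B)"
  interpret finite_dimensional_vector_space "\<lambda>a x. emb a * x" B
    using someI_ex[OF finite_extension] by (simp add: B_def)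
  have "\<exists>r. x = (\<Sum>b\<in>B. emb (r b) * b)" for x
    using span_Basis unfolding span_finite[OF finite_Basis] by blast
  then show ?thesis using that finite_Basis by (auto simp: field_degree_def B_def)
qed

text \<open>Expanding every \<open>w j l\<close> in a basis turns one equation over K into
  \<open>field_degree\<close> equations over C(z). A common denominator then makes the solution
  polynomial.\<close>

lemma linear_dependence:
  fixes w :: "'j \<Rightarrow> 'l \<Rightarrow> 'k"
  assumes J: "finite J" and L: "finite L" and less: "field_degree * card L < card J"
  shows "\<exists>p. (\<exists>j\<in>J. p j \<noteq> 0) \<and> (\<forall>l\<in>L. (\<Sum>j\<in>J. pe (p j) * w j l) = 0)"
proof -
  obtain B where B: "finite B" "card B = field_degree" "\<And>x. \<exists>r. x = (\<Sum>b\<in>B. emb (r b) * b)"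
    using finite_basis by blast
  from B(3) have "\<forall>x. \<exists>r. x = (\<Sum>b\<in>B. emb (r b) * b)" by blast
  from choice[OF this] obtain r where r: "\<And>x. x = (\<Sum>b\<in>B. emb (r x b) * b)" by blast
  have fin: "finite (B \<times> L)" using B L by simp
  have card: "card (B \<times> L) < card J" using B less by (simp add: card_cartesian_product)
  obtain c where c: "\<exists>j\<in>J. c j \<noteq> 0"
    "\<forall>i\<in>B \<times> L. (\<Sum>j\<in>J. (case i of (b, l) \<Rightarrow> r (w j l) b) * c j) = 0"
    using homogeneous_system_solution[OF fin J card, of "\<lambda>i j. case i of (b, l) \<Rightarrow> r (w j l) b"]
    by blast
  obtain q p where qp: "q \<noteq> 0" "\<And>j. j \<in> J \<Longrightarrow> c j = Fract (p j) q"
    using common_denominator[OF J] by metis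
  have "(\<Sum>j\<in>J. pe (p j) * w j l) = 0" if l: "l \<in> L" for l
  proof -
    have "(\<Sum>j\<in>J. emb (c j) * w j l) = (\<Sum>j\<in>J. emb (c j) * (\<Sum>b\<in>B. emb (r (w j l) b) * b))"
      by (intro sum.cong refl arg_cong2[where f = "(*)"] r)
    also have "\<dots> = (\<Sum>b\<in>B. emb (\<Sum>j\<in>J. r (w j l) b * c j) * b)"
      unfolding sum_distrib_left emb.hom_sum sum_distrib_right
      by (subst sum.swap) (simp add: hom_distribs algebra_simps)
    also have "\<dots> = 0" using c(2) l by (intro sum.neutral) auto
    finally have "(\<Sum>j\<in>J. pe q * (emb (c j) * w j l)) = 0" by (simp flip: sum_distrib_left)
    moreover have "pe q * (emb (c j) * w j l) = pe (p j) * w j l" if "j \<in> J" for j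
      using qp that by (simp add: emb_Fract)
    ultimately show ?thesis by simp
  qed
  moreover have "\<exists>j\<in>J. p j \<noteq> 0"
  proof -
    obtain j where "j \<in> J" "c j \<noteq> 0" using c(1) by blast
    then have "p j \<noteq> 0" using qp(2)[of j] by (auto simp: fract_collapse)
    then show ?thesis using \<open>j \<in> J\<close> by blast
  qed
  ultimately show ?thesis by blast
qed

lemma algebraic: "\<exists>G. G \<noteq> 0 \<and> ev G x = 0"
proof -
  have fin: "finite {..field_degree}" "finite {()}" by auto
  have less: "field_degree * card {()} < card {..field_degree}" by simp
  obtain p where p: "\<exists>j\<in>{..field_degree}. p j \<noteq> 0"
      "(\<Sum>j\<le>field_degree. pe (p j) * x ^ j) = 0"
    using linear_dependence[OF fin less, of "\<lambda>j _. x ^ j"] by auto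
  let ?G = "\<Sum>j\<le>field_degree. monom (p j) j"
  obtain j where j: "j \<le> field_degree" "p j \<noteq> 0" using p(1) by auto
  have "coeff ?G j = p j" using j(1) by (simp add: coeff_sum)
  then have "?G \<noteq> 0" using j(2) by auto
  moreover have "ev ?G x = 0" using p(2) by (simp add: ev_sum ev_monom)
  ultimately show ?thesis by blast
qed

lemma minimal_relation:
  "\<exists>G. G \<noteq> 0 \<and> ev G x = 0 \<and> degree G > 0 \<and> (\<forall>H. H \<noteq> 0 \<longrightarrow> ev H x = 0 \<longrightarrow> degree G \<le> degree H)"
proof -
  define S where "S = {G. G \<noteq> 0 \<and> ev G x = 0}"
  define G where "G = arg_min degree (\<lambda>G. G \<in> S)"
  have "\<exists>G. G \<in> S" using algebraic by (auto simp: S_def)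
  then have G: "G \<in> S" and G_le: "\<And>H. H \<in> S \<Longrightarrow> degree G \<le> degree H"
    unfolding G_def by (metis arg_min_natI, metis arg_min_nat_le)
  have "degree G > 0"
  proof (rule ccontr)
    assume "\<not> degree G > 0"
    then obtain g where "G = [:g:]" using degree_eq_zeroE by auto
    then show False using G by (simp add: S_def)
  qed
  then show ?thesis using G G_le by (intro exI[of _ G]) (simp add: S_def)
qed

text \<open>Powers of x are cancelled until the constant term is nonzero. This term p(z) expresses
  1/x as -G(x)/p, and at a place it is forced to have positive order when x has positive order and z
  is integral.\<close>

lemma algebraic_constant_coeff:
  assumes "x \<noteq> 0"
  shows "\<exists>p G. p \<noteq> 0 \<and> ev (pCons p G) x = 0"
proof -
  have "\<exists>p H. p \<noteq> 0 \<and> ev (pCons p H) x = 0" if "G \<noteq> 0" "ev G x = 0" for G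
    using that
  proof (induction G)
    case (pCons p G)
    show ?case
    proof (cases "p = 0")
      case True
      then show ?thesis using pCons assms by auto
    qed (use pCons.prems in blast)
  qed auto
  then show ?thesis using algebraic by blast
qed


subsection \<open>A primitive element\<close>

text \<open>This is C(z)[y], with denominators cleared to polynomials in z. By
  \<open>gen_inverse\<close> it is the field C(z)(y).\<close>

definition gen :: "'k \<Rightarrow> 'k set" where
  "gen y = {x. \<exists>q G. q \<noteq> 0 \<and> pe q * x = ev G y}"

lemma genI: "q \<noteq> 0 \<Longrightarrow> pe q * x = ev G y \<Longrightarrow> x \<in> gen y"
  by (auto simp: gen_def)

lemma genE:
  assumes "x \<in> gen y" obtains q G where "q \<noteq> 0" "pe q * x = ev G y"
  using assms by (auto simp: gen_def)

lemma gen_ev: "ev G y \<in> gen y"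
  by (rule genI[of 1 _ G]) simp_all

lemma gen_pe: "pe p \<in> gen y"
  using gen_ev[of "[:p:]" y] by simp

lemma gen_self: "y \<in> gen y"
  using gen_ev[of "[:0, 1:]" y] by simp

lemma gen_add: assumes "a \<in> gen y" "b \<in> gen y" shows "a + b \<in> gen y"
proof -
  obtain q G where 1: "q \<noteq> 0" "pe q * a = ev G y" using assms(1) by (rule genE)
  obtain r H where 2: "r \<noteq> 0" "pe r * b = ev H y" using assms(2) by (rule genE)
  have "pe (q * r) * (a + b) = pe r * (pe q * a) + pe q * (pe r * b)"
    by (simp add: hom_distribs distrib_left)
  also have "\<dots> = ev (smult r G + smult q H) y" by (simp add: 1 2 ev_smult hom_distribs)
  finally show ?thesis using 1 2 by (intro genI[of "q * r"]) simp_all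
qed

lemma gen_mult: assumes "a \<in> gen y" "b \<in> gen y" shows "a * b \<in> gen y"
proof -
  obtain q G where 1: "q \<noteq> 0" "pe q * a = ev G y" using assms(1) by (rule genE)
  obtain r H where 2: "r \<noteq> 0" "pe r * b = ev H y" using assms(2) by (rule genE)
  have "pe (q * r) * (a * b) = (pe q * a) * (pe r * b)" by (simp add: hom_distribs)
  also have "\<dots> = ev (G * H) y" by (simp add: 1 2 hom_distribs)
  finally show ?thesis using 1 2 by (intro genI[of "q * r" _ "G * H"]) simp_all
qed

lemma gen_sum: "(\<And>i. i \<in> I \<Longrightarrow> f i \<in> gen y) \<Longrightarrow> (\<Sum>i\<in>I. f i) \<in> gen y"
  using gen_pe[of 0 y] by (induction I rule: infinite_finite_induct) (auto intro: gen_add)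

lemma gen_minus: "a \<in> gen y \<Longrightarrow> - a \<in> gen y"
  using gen_mult[OF gen_pe[of "-1"], of a y] by (simp add: hom_distribs)

lemma gen_ev_mem: "x \<in> gen y \<Longrightarrow> ev G x \<in> gen y"
  by (induction G) (use gen_pe[of 0 y] in \<open>auto intro: gen_add gen_mult gen_pe\<close>)

lemma gen_inverse: assumes "x \<in> gen y" shows "inverse x \<in> gen y"
proof (cases "x = 0")
  case False
  then obtain p G where p: "p \<noteq> 0" "ev (pCons p G) x = 0" using algebraic_constant_coeff by blast
  then have "pe p * inverse x = - ev G x"
    using False by (simp add: field_simps add_eq_0_iff)
  moreover obtain q H where "q \<noteq> 0" "pe q * - ev G x = ev H y"
    using gen_minus[OF gen_ev_mem[OF assms]] by (blast elim: genE)
  ultimately show ?thesis using p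
    by (intro genI[of "q * p" _ H]) (simp_all add: hom_distribs mult.assoc)
qed (use assms in simp)

lemma gen_divide: "a \<in> gen y \<Longrightarrow> b \<in> gen y \<Longrightarrow> a / b \<in> gen y"
  by (simp add: divide_inverse gen_mult gen_inverse)

lemma gen_trans: assumes "y \<in> gen x" shows "gen y \<subseteq> gen x"
proof
  fix a assume "a \<in> gen y"
  then obtain q G where "q \<noteq> 0" "pe q * a = ev G y" by (rule genE)
  then have "a = ev G y / pe q" by (simp add: field_simps)
  then show "a \<in> gen x" using gen_divide[OF gen_ev_mem[OF assms] gen_pe] by simp
qed

text \<open>For \<theta> in K[t] this is G(z, t, \<theta>): the outer variable of \<open>G\<close>
  is replaced by \<theta>, the middle one remains the variable t of K[t], and the inner one becomes
  z.\<close>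

definition ev2 :: "complex poly poly poly \<Rightarrow> 'k poly \<Rightarrow> 'k poly" where
  "ev2 G \<theta> = poly (map_poly (map_poly pe) G) \<theta>"

lemma ev2_pCons [simp]: "ev2 (pCons g G) \<theta> = map_poly pe g + \<theta> * ev2 G \<theta>"
  by (simp add: ev2_def mpe.map_poly_pCons_hom)

lemma ev2_0 [simp]: "ev2 0 \<theta> = 0"
  by (simp add: ev2_def)

lemma pderiv_ev2:
  "pderiv (ev2 G \<theta>) = ev2 (map_poly pderiv G) \<theta> + ev2 (pderiv G) \<theta> * pderiv \<theta>"
proof (induction G)
  case (pCons g G)
  have "ev2 (pderiv (pCons g G)) \<theta> = ev2 G \<theta> + \<theta> * ev2 (pderiv G) \<theta>"
    by (simp add: pderiv_pCons ev2_def mpe.map_poly_hom_add mpe.map_poly_pCons_hom)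
  with pCons show ?case
    by (simp add: map_poly_pCons pderiv_add pderiv_mult pe.map_poly_pderiv algebra_simps)
qed (simp add: ev2_def)

lemma poly_ev2:
  "poly (ev2 G [:a, b:]) (const_emb emb c)
    = ev (map_poly (\<lambda>g. poly g [:c:]) G) (a + const_emb emb c * b)"
  by (induction G) (simp_all add: map_poly_pCons const_emb_eq algebra_simps)

text \<open>With N = \<open>field_degree\<close> there are (2N+1)^2 monomials \<theta>^i t^j with i,
  j \<le> 2N. Each has degree at most 4N in t, so a vanishing combination costs N(4N+1) equations
  over C(z), which is fewer than the number of monomials.\<close>

lemma ev2_relation: "\<exists>G. G \<noteq> 0 \<and> ev2 G [:a, b:] = 0"
proof -
  define \<theta> where "\<theta> = [:a, b:]"
  define N where "N = field_degree"
  let ?J = "{..2 * N} \<times> {..2 * N}" and ?L = "{..4 * N}"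
  have fin: "finite ?J" "finite ?L" by auto
  have less: "field_degree * card ?L < card ?J"
    by (simp add: card_cartesian_product N_def algebra_simps)
  obtain p where p: "\<exists>x\<in>?J. p x \<noteq> 0"
    "\<forall>l\<in>?L. (\<Sum>x\<in>?J. pe (p x) * coeff (\<theta> ^ fst x * monom 1 (snd x)) l) = 0"
    using linear_dependence[OF fin less, of "\<lambda>x l. coeff (\<theta> ^ fst x * monom 1 (snd x)) l"] by blast
  define G where "G = (\<Sum>i\<le>2 * N. monom (\<Sum>j\<le>2 * N. monom (p (i, j)) j) i)"
  have cG: "coeff (coeff G i) j = p (i, j)" if "i \<le> 2 * N" "j \<le> 2 * N" for i j
    using that by (simp add: G_def coeff_sum)
  obtain i j where ij: "i \<le> 2 * N" "j \<le> 2 * N" "p (i, j) \<noteq> 0" using p(1) by auto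
  then have "coeff (coeff G i) j \<noteq> 0" using cG by simp
  then have "G \<noteq> 0" by auto
  moreover have "ev2 G \<theta> = 0"
  proof -
    have hs: "map_poly (map_poly pe) (\<Sum>x\<in>A. F x) = (\<Sum>x\<in>A. map_poly (map_poly pe) (F x))"
      for A :: "nat set" and F
      by (rule poly_eqI) (simp add: coeff_sum mpe.hom_sum)
    have "ev2 G \<theta> = (\<Sum>i\<le>2 * N. (\<Sum>j\<le>2 * N. monom (pe (p (i, j))) j) * \<theta> ^ i)"
      unfolding ev2_def G_def hs poly_sum
      by (simp add: map_poly_monom poly_monom mpe.hom_sum)
    also have "\<dots> = (\<Sum>x\<in>?J. monom (pe (p x)) (snd x) * \<theta> ^ fst x)"
      by (simp add: sum_distrib_right sum.cartesian_product case_prod_unfold)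
    also have "\<dots> = (\<Sum>x\<in>?J. smult (pe (p x)) (\<theta> ^ fst x * monom 1 (snd x)))"
    proof (intro sum.cong refl)
      fix x
      show "monom (pe (p x)) (snd x) * \<theta> ^ fst x = smult (pe (p x)) (\<theta> ^ fst x * monom 1 (snd x))"
        using mult_smult_right[of "\<theta> ^ fst x" "pe (p x)" "monom 1 (snd x)"]
        by (simp add: smult_monom mult.commute)
    qed
    finally have eq: "ev2 G \<theta> = (\<Sum>x\<in>?J. smult (pe (p x)) (\<theta> ^ fst x * monom 1 (snd x)))" .
    show ?thesis
    proof (rule poly_eqI)
      fix l
      show "coeff (ev2 G \<theta>) l = coeff 0 l"
      proof (cases "l \<le> 4 * N")
        case True
        then show ?thesis using p(2) by (simp add: eq coeff_sum)
      next
        case False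
        have "degree (\<theta> ^ i * monom 1 j) \<le> 4 * N" if "i \<le> 2 * N" "j \<le> 2 * N" for i j
        proof -
          have "degree (\<theta> ^ i) \<le> degree \<theta> * i" by (rule degree_power_le)
          also have "\<dots> \<le> i" by (simp add: \<theta>_def)
          finally have "degree (\<theta> ^ i) \<le> i" .
          moreover have "degree (monom (1::'k) j) \<le> j" by (rule degree_monom_le)
          ultimately show ?thesis using that degree_mult_le[of "\<theta> ^ i" "monom 1 j"] by linarith
        qed
        then have "degree (ev2 G \<theta>) \<le> 4 * N"
          unfolding eq by (intro degree_sum_le) (auto intro: order_trans[OF degree_smult_le])
        then show ?thesis using False by (simp add: coeff_eq_0)
      qed
    qed
  qed
  ultimately show ?thesis by (auto simp: \<theta>_def)
qed

text \<open>Let \<open>G(\<theta>, t) = 0\<close> be a relation of minimal degree in \<open>\<theta> = a + tb\<close> over \<open>\<complex>(z)(t)\<close>.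
  Differentiating it with respect to \<open>t\<close> gives \<open>b G\<^sub>\<theta> + G\<^sub>t = 0\<close> with \<open>G\<^sub>\<theta> \<noteq> 0\<close>; specialising \<open>t\<close> to a
  constant with \<open>G\<^sub>\<theta> \<noteq> 0\<close> expresses \<open>b\<close> by \<open>a + tb\<close>.\<close>

lemma gen_pair: "\<exists>c. a \<in> gen c \<and> b \<in> gen c"
proof -
  define \<theta> where "\<theta> = [:a, b:]"
  define S where "S = {G. G \<noteq> 0 \<and> ev2 G \<theta> = 0}"
  define G where "G = arg_min degree (\<lambda>G. G \<in> S)"
  have "\<exists>G. G \<in> S" using ev2_relation by (auto simp: S_def \<theta>_def)
  then have G: "G \<in> S" "\<And>H. H \<in> S \<Longrightarrow> degree G \<le> degree H"
    unfolding G_def by (metis arg_min_natI, metis arg_min_nat_le)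
  have deg: "degree G > 0"
  proof (rule ccontr)
    assume "\<not> degree G > 0"
    then obtain g where "G = [:g:]" using degree_eq_zeroE by auto
    then show False using G(1) by (simp add: S_def)
  qed
  then have "pderiv G \<noteq> 0" "degree (pderiv G) < degree G"
    by (simp_all add: pderiv_eq_0_iff degree_pderiv)
  \<comment> \<open>\<open>pderiv G\<close> is nonzero of smaller degree, so minimality of
    \<open>G\<close> prevents it from being a relation.\<close>
  then have nz: "ev2 (pderiv G) \<theta> \<noteq> 0"
    using G(2)[of "pderiv G"] by (auto simp: S_def)
  have rel: "ev2 (map_poly pderiv G) \<theta> + ev2 (pderiv G) \<theta> * [:b:] = 0"
    using pderiv_ev2[of G \<theta>] G(1) by (simp add: S_def \<theta>_def pderiv_pCons)
  have "\<exists>k\<in>range (const_emb emb). poly (ev2 (pderiv G) \<theta>) k \<noteq> 0"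
  proof (rule ccontr)
    assume "\<not> ?thesis"
    then have "range (const_emb emb) \<subseteq> {k. poly (ev2 (pderiv G) \<theta>) k = 0}" by auto
    then show False using infinite_const poly_roots_finite[OF nz] finite_subset by blast
  qed
  then obtain c where c: "poly (ev2 (pderiv G) \<theta>) (const_emb emb c) \<noteq> 0" by auto
  define \<gamma> where "\<gamma> = a + const_emb emb c * b"
  let ?s = "map_poly (\<lambda>g. poly g [:c:])"
  have "ev (?s (map_poly pderiv G)) \<gamma> + ev (?s (pderiv G)) \<gamma> * b = 0"
    using arg_cong[OF rel, of "\<lambda>p. poly p (const_emb emb c)"] by (simp add: poly_ev2 \<theta>_def \<gamma>_def mult.commute)
  moreover have "ev (?s (pderiv G)) \<gamma> \<noteq> 0" using c by (simp add: poly_ev2 \<theta>_def \<gamma>_def)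
  ultimately have "b = - ev (?s (map_poly pderiv G)) \<gamma> / ev (?s (pderiv G)) \<gamma>"
    by (simp add: field_simps eq_neg_iff_add_eq_0 add.commute)
  then have b: "b \<in> gen \<gamma>" using gen_divide[OF gen_minus[OF gen_ev] gen_ev] by metis
  have "a = \<gamma> + - (pe [:c:] * b)" by (simp add: \<gamma>_def const_emb_eq)
  then have "a \<in> gen \<gamma>" using b by (metis gen_add gen_minus gen_mult gen_pe gen_self)
  with b show ?thesis by blast
qed

lemma primitive_element: "\<exists>y. gen y = UNIV"
proof -
  obtain B where B: "finite B" "\<And>x. \<exists>r. x = (\<Sum>b\<in>B. emb (r b) * b)" using finite_basis by blast
  have "\<exists>y. S \<subseteq> gen y" if "finite S" for S
    using that
  proof (induction S rule: finite_induct)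
    case (insert s S)
    then obtain y where y: "S \<subseteq> gen y" by blast
    obtain c where "y \<in> gen c" "s \<in> gen c" using gen_pair by blast
    then show ?case using y gen_trans by blast
  qed simp
  then obtain y where y: "B \<subseteq> gen y" using B by blast
  have "emb g \<in> gen y" for g
  proof -
    obtain p q where "q \<noteq> 0" "g = Fract p q" by (metis Fract_cases)
    then show ?thesis using gen_divide[OF gen_pe gen_pe] by (simp add: emb_Fract)
  qed
  then have "x \<in> gen y" for x
    using B(2)[of x] y by (auto intro!: gen_sum gen_mult)
  then show ?thesis by blast
qed

lemma monic_division:
  fixes P :: "'a::idom poly"
  assumes "lead_coeff P = 1"
  shows "\<exists>Q R. G = P * Q + R \<and> (R = 0 \<or> degree R < degree P)"
proof -
  have "P \<noteq> 0" using assms by auto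
  moreover obtain Q R where "pseudo_divmod G P = (Q, R)" by fastforce
  ultimately show ?thesis using pseudo_divmod[of P G Q R] assms by auto
qed

text \<open>If l is the leading coefficient of a relation G of minimal degree n for a primitive
  element x, then y = l x is a root of the monic polynomial l^(n-1) G(Y/l), whose coefficients are
  again in C[z]. Division by a monic polynomial needs no denominators, so by minimality every
  relation of y is a multiple of P; that is, C[z][y] is C[z][Y]/(P).\<close>

lemma integral_generator:
  "\<exists>y P. lead_coeff P = 1 \<and> ev P y = 0 \<and> (\<forall>G. ev G y = 0 \<longrightarrow> P dvd G) \<and> gen y = UNIV"
proof -
  obtain x where x: "gen x = UNIV" using primitive_element by blast
  obtain G where G_nz: "G \<noteq> 0" and G0: "ev G x = 0" and G_deg: "degree G > 0"
    and G_le: "\<And>H. H \<noteq> 0 \<Longrightarrow> ev H x = 0 \<Longrightarrow> degree G \<le> degree H"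
    using minimal_relation[of x] by blast
  define n where "n = degree G"
  define l where "l = lead_coeff G"
  have l: "l \<noteq> 0" and n: "n > 0" using G_nz G_deg by (simp_all add: l_def n_def)
  define y where "y = pe l * x"
  define P where "P = (\<Sum>i<n. monom (coeff G i * l ^ (n - 1 - i)) i) + monom 1 n"
  have degP: "degree P = n" and lcP: "lead_coeff P = 1"
  proof -
    have "degree (\<Sum>i<n. monom (coeff G i * l ^ (n - 1 - i)) i) \<le> n - 1"
      by (intro degree_sum_le) (auto intro: order_trans[OF degree_monom_le])
    then have less: "degree (\<Sum>i<n. monom (coeff G i * l ^ (n - 1 - i)) i) < degree (monom (1 :: complex poly) n)"
      using n by (simp add: degree_monom_eq)
    then show d: "degree P = n" unfolding P_def by (simp add: degree_add_eq_right degree_monom_eq)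
    show "lead_coeff P = 1" unfolding d by (simp add: P_def coeff_sum)
  qed
  have "ev P y = pe l ^ (n - 1) * ev G x"
  proof -
    have "ev G x = (\<Sum>i\<le>n. pe (coeff G i) * x ^ i)"
      by (simp add: ev_def poly_altdef n_def)
    also have "\<dots> = (\<Sum>i<n. pe (coeff G i) * x ^ i) + pe l * x ^ n"
      by (simp add: n_def l_def flip: lessThan_Suc_atMost)
    finally have "pe l ^ (n - 1) * ev G x
        = (\<Sum>i<n. pe l ^ (n - 1) * (pe (coeff G i) * x ^ i)) + pe l ^ (n - 1) * (pe l * x ^ n)"
      by (simp add: distrib_left sum_distrib_left)
    moreover have "pe l ^ (n - 1) * (pe (coeff G i) * x ^ i)
        = pe (coeff G i * l ^ (n - 1 - i)) * y ^ i" if "i < n" for i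
    proof -
      have "pe l ^ (n - 1) = pe l ^ (n - 1 - i) * pe l ^ i" using that by (simp flip: power_add)
      then show ?thesis by (simp add: y_def power_mult_distrib hom_distribs algebra_simps)
    qed
    moreover have "pe l ^ (n - 1) * (pe l * x ^ n) = y ^ n"
    proof -
      have "pe l ^ n = pe l ^ (n - 1) * pe l" using n by (simp flip: power_Suc2)
      then show ?thesis by (simp add: y_def power_mult_distrib)
    qed
    ultimately show ?thesis by (simp add: P_def ev.hom_add ev_sum ev_monom)
  qed
  then have P0: "ev P y = 0" using G0 by simp
  \<comment> \<open>A relation H(Y) of y becomes the relation H(l Y) of x, of the same
    degree.\<close>
  have min: "n \<le> degree H" if "H \<noteq> 0" "ev H y = 0" for H
  proof -
    have "ev (pcompose H [:0, l:]) x = ev H y"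
      unfolding y_def by (induction H) (simp_all add: pcompose_pCons hom_distribs ev_smult algebra_simps)
    moreover have "pcompose H [:0, l:] \<noteq> 0"
      using that(1) l pcompose_eq_0[of H "[:0, l:]"] by auto
    ultimately show ?thesis
      using G_le[of "pcompose H [:0, l:]"] that l by (simp add: n_def)
  qed
  have dvd: "P dvd H" if "ev H y = 0" for H
  proof -
    obtain Q R where QR: "H = P * Q + R" "R = 0 \<or> degree R < degree P"
      using monic_division[OF lcP] by blast
    then have "ev R y = 0" using that P0 by (simp add: hom_distribs)
    then have "R = 0" using QR(2) min[of R] degP by (metis not_less)
    then show ?thesis using QR by simp
  qed
  have "x = y / pe l" using l by (simp add: y_def)
  then have "x \<in> gen y" using gen_divide[OF gen_self gen_pe] by metis
  then have "gen y = UNIV" using gen_trans x by blast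
  then show ?thesis using lcP P0 dvd by blast
qed

end

section \<open>Laurent series\<close>

text \<open>Order at least k, where 0 has infinite order. Since \<open>fls_subdegree 0 = 0\<close>,
  inequalities between subdegrees would not be stable under sums and products; \<open>vge\<close>
  plays the same role for a place.\<close>

definition fls_ge :: "int \<Rightarrow> 'a::zero fls \<Rightarrow> bool" where
  "fls_ge k g \<longleftrightarrow> (\<forall>i<k. fls_nth g i = 0)"

lemma fls_ge_iff: "fls_ge k g \<longleftrightarrow> g = 0 \<or> k \<le> fls_subdegree g"
proof (cases "g = 0")
  case False
  then have "k \<le> fls_subdegree g" if "fls_ge k g"
    using that by (intro fls_subdegree_geI) (auto simp: fls_ge_def)
  moreover have "fls_ge k g" if "k \<le> fls_subdegree g"
    using that by (auto simp: fls_ge_def)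
  ultimately show ?thesis using False by auto
qed (simp add: fls_ge_def)

lemma fls_ge_0 [simp]: "fls_ge k 0"
  by (simp add: fls_ge_def)

lemma fls_ge_mono: "fls_ge k g \<Longrightarrow> l \<le> k \<Longrightarrow> fls_ge l g"
  by (simp add: fls_ge_def)

lemma fls_ge_add: "fls_ge k f \<Longrightarrow> fls_ge k g \<Longrightarrow> fls_ge k (f + g)"
  for f g :: "'a::ab_group_add fls"
  by (simp add: fls_ge_def)

lemma fls_ge_diff: "fls_ge k f \<Longrightarrow> fls_ge k g \<Longrightarrow> fls_ge k (f - g)"
  for f g :: "'a::ab_group_add fls"
  by (simp add: fls_ge_def)

lemma fls_ge_sum: "(\<And>i. i \<in> I \<Longrightarrow> fls_ge k (f i)) \<Longrightarrow> fls_ge k (\<Sum>i\<in>I. f i)"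
  for f :: "'i \<Rightarrow> 'a::ab_group_add fls"
  by (induction I rule: infinite_finite_induct) (auto intro: fls_ge_add)

lemma fls_ge_mult: "fls_ge k f \<Longrightarrow> fls_ge l g \<Longrightarrow> fls_ge (k + l) (f * g)"
  for f g :: "'a::idom fls"
  by (cases "f = 0"; cases "g = 0") (auto simp: fls_ge_iff)

lemma fls_ge_const: "fls_ge 0 (fls_const c)"
  by (simp add: fls_ge_iff)

lemma fls_ge_divide:
  fixes g h :: "'a::field fls"
  assumes "fls_ge k g" "h \<noteq> 0"
  shows "fls_ge (k - fls_subdegree h) (g / h)"
  using assms by (cases "g = 0") (auto simp: fls_ge_iff fls_divide_subdegree)

text \<open>The coefficient of a derivative at -1 is always 0, so integral series stay integral,
  whereas \<open>fls_ge_deriv_pred\<close> gives up one order.\<close>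

lemma fls_ge_deriv: "fls_ge 0 g \<Longrightarrow> fls_ge 0 (fls_deriv g)"
  for g :: "complex fls"
  unfolding fls_ge_def
proof (intro allI impI)
  fix i :: int assume g: "\<forall>i<0. fls_nth g i = 0" and i: "i < 0"
  show "fls_nth (fls_deriv g) i = 0"
    using g i by (cases "i = - 1") (auto simp: fls_deriv_nth)
qed

lemma fls_ge_deriv_pred: "fls_ge k g \<Longrightarrow> fls_ge (k - 1) (fls_deriv g)"
  for g :: "complex fls"
  by (auto simp: fls_ge_def fls_deriv_nth)

lemma fls_eq_0_if_ge: "(\<And>k. fls_ge k g) \<Longrightarrow> g = 0"
proof (rule fls_eqI)
  fix n
  assume "\<And>k. fls_ge k g"
  then have "fls_ge (n + 1) g" .
  then show "fls_nth g n = fls_nth 0 n" by (simp add: fls_ge_def)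
qed

lemma fls_dist_le:
  fixes a b :: "'a::ab_group_add fls"
  assumes "fls_ge (int n) (a - b)" shows "dist a b \<le> inverse (2 ^ n)"
proof (cases "a = b")
  case False
  then have "int n \<le> fls_subdegree (a - b)" using assms by (simp add: fls_ge_iff)
  moreover from this have "(2::real) ^ n \<le> 2 ^ nat (fls_subdegree (a - b))"
    by (intro power_increasing) auto
  ultimately show ?thesis using False by (simp add: dist_fls_def le_imp_inverse_le)
qed simp

lemma fls_ge_if_dist_less:
  fixes a b :: "'a::ab_group_add fls"
  assumes "dist a b < inverse (2 ^ n)" shows "fls_ge (int n) (a - b)"
proof (cases "a = b")
  case False
  have "fls_subdegree (a - b) \<ge> int n"
  proof (rule ccontr)
    assume n: "\<not> fls_subdegree (a - b) \<ge> int n"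
    have "inverse (2 ^ n) \<le> dist a b"
    proof (cases "fls_subdegree (a - b) \<ge> 0")
      case True
      then have "nat (fls_subdegree (a - b)) \<le> n" using n by simp
      then have "(2::real) ^ nat (fls_subdegree (a - b)) \<le> 2 ^ n" by (intro power_increasing) auto
      then show ?thesis using True False by (simp add: dist_fls_def le_imp_inverse_le)
    next
      case neg: False
      have "inverse (2 ^ n) \<le> (1::real)" by (simp add: inverse_le_1_iff)
      also have "\<dots> \<le> 2 ^ nat (- fls_subdegree (a - b))" by simp
      finally show ?thesis using neg False by (simp add: dist_fls_def)
    qed
    then show False using assms by simp
  qed
  then show ?thesis by (simp add: fls_ge_iff)
qed simp

lemma fls_continuous_onI:
  fixes D :: "'a::ab_group_add fls \<Rightarrow> 'a fls"
  assumes diff: "\<And>f g. D f - D g = D (f - g)" and ge: "\<And>k f. fls_ge k f \<Longrightarrow> fls_ge (k - m) (D f)"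
  shows "continuous_on UNIV D"
  unfolding continuous_on_iff
proof (intro ballI allI impI)
  fix x :: "'a fls" and e :: real assume e: "e > 0"
  obtain n where n: "inverse (2 ^ n) < e"
    using real_arch_pow_inv[OF e, of "1/2"] by (auto simp: power_one_over inverse_eq_divide)
  show "\<exists>\<delta>>0. \<forall>x'\<in>UNIV. dist x' x < \<delta> \<longrightarrow> dist (D x') (D x) < e"
  proof (intro exI conjI ballI impI)
    show "inverse (2 ^ nat (int n + m)) > (0::real)" by simp
    fix x' assume "dist x' x < inverse (2 ^ nat (int n + m))"
    then have near: "fls_ge (int (nat (int n + m))) (x' - x)" by (rule fls_ge_if_dist_less)
    have "fls_ge (int n) (D x' - D x)"
      unfolding diff by (rule fls_ge_mono[OF ge[OF near]]) linarith
    then show "dist (D x') (D x) < e" using fls_dist_le n by (meson le_less_trans)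
  qed
qed

lemma fls_deriv_eq_0:
  fixes g :: "complex fls"
  assumes "fls_deriv g = 0" shows "g = fls_const (fls_nth g 0)"
proof (rule fls_eqI)
  fix n
  have "fls_nth (fls_deriv g) (n - 1) = 0" using assms by simp
  then have "of_int n * fls_nth g n = 0" by (simp add: fls_deriv_nth)
  then show "fls_nth g n = fls_nth (fls_const (fls_nth g 0)) n" by auto
qed


text \<open>A folded copy of the variable: the simplifier turns quotients by powers of
  \<^term>\<open>fls_X\<close> into shifts.\<close>

definition fls_t :: "complex fls" where "fls_t = fls_X"

lemma fls_t [simp]: "fls_t \<noteq> 0" "fls_subdegree fls_t = 1"
  by (simp_all add: fls_t_def)

lemma fls_nth_t_times [simp]: "fls_nth (fls_t * g) i = fls_nth g (i - 1)"
  by (simp add: fls_t_def fls_X_times_conv_shift)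

lemma extract_root:
  fixes G :: "complex poly poly"
  assumes "\<And>i. poly (coeff G i) a = 0"
  shows "\<exists>H. G = smult [:-a, 1:] H"
proof (rule exI[of _ "map_poly (\<lambda>p. p div [:-a, 1:]) G"], rule poly_eqI)
  fix i
  have "[:-a, 1:] dvd coeff G i" using assms by (simp add: poly_eq_0_iff_dvd)
  then show "coeff G i = coeff (smult [:-a, 1:] (map_poly (\<lambda>p. p div [:-a, 1:]) G)) i"
    by (simp add: coeff_map_poly del: mult_pCons_left)
qed

text \<open>G is divided by as high a power of z - a as possible, so that its reduction at z = a is
  not identically 0. One fixed nonzero coefficient loses degree at each division, which bounds the
  power.\<close>

lemma extract_all_roots:
  fixes G :: "complex poly poly"
  assumes "G \<noteq> 0"
  shows "\<exists>k H. G = smult ([:-a, 1:] ^ k) H \<and> map_poly (\<lambda>p. poly p a) H \<noteq> 0"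
proof -
  from assms obtain i where i: "coeff G i \<noteq> 0" by (auto simp: poly_eq_iff)
  then show ?thesis
  proof (induction "degree (coeff G i)" arbitrary: G rule: less_induct)
    case less
    show ?case
    proof (cases "map_poly (\<lambda>p. poly p a) G = 0")
      case False
      then show ?thesis by (intro exI[of _ 0] exI[of _ G]) simp
    next
      case True
      have "poly (coeff G i) a = coeff (map_poly (\<lambda>p. poly p a) G) i" for i
        by (simp add: coeff_map_poly)
      then obtain H where H: "G = smult [:-a, 1:] H" using extract_root[of G a] True by auto
      then have c: "coeff G i = [:-a, 1:] * coeff H i" by simp
      then have "coeff H i \<noteq> 0" using less.prems by auto
      moreover from this have "degree (coeff H i) < degree (coeff G i)"
        unfolding c by (subst degree_mult_eq) auto
      ultimately obtain k H' where "H = smult ([:-a, 1:] ^ k) H'" "map_poly (\<lambda>p. poly p a) H' \<noteq> 0"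
        using less.hyps by blast
      then show ?thesis using H by (intro exI[of _ "Suc k"] exI[of _ H']) simp
    qed
  qed
qed

section \<open>Places and their completions\<close>

locale place = differential_function_field +
  fixes v :: "'a \<Rightarrow> int"
  assumes place: "v \<in> places emb"
begin

abbreviation kc :: "complex \<Rightarrow> 'a" where "kc \<equiv> const_emb emb"

lemma v_0 [simp]: "v 0 = 0"
  and v_mult: "x \<noteq> 0 \<Longrightarrow> y \<noteq> 0 \<Longrightarrow> v (x * y) = v x + v y"
  and v_add: "x \<noteq> 0 \<Longrightarrow> y \<noteq> 0 \<Longrightarrow> x + y \<noteq> 0 \<Longrightarrow> min (v x) (v y) \<le> v (x + y)"
  and v_const: "c \<noteq> 0 \<Longrightarrow> v (kc c) = 0"
  using place unfolding places_def by blast+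

definition t :: 'a where "t = (SOME x. x \<noteq> 0 \<and> v x = 1)"

lemma t: "t \<noteq> 0" "v t = 1"
proof -
  have "\<exists>x. x \<noteq> 0 \<and> v x = 1" using place unfolding places_def by blast
  from someI_ex[OF this] show "t \<noteq> 0" "v t = 1" by (simp_all add: t_def)
qed

definition vge :: "int \<Rightarrow> 'a \<Rightarrow> bool" where "vge k x \<longleftrightarrow> x = 0 \<or> k \<le> v x"

lemma vge_0 [simp]: "vge k 0"
  by (simp add: vge_def)

lemma vge_mono: "vge k x \<Longrightarrow> l \<le> k \<Longrightarrow> vge l x"
  by (auto simp: vge_def)

lemma vge_mult: "vge k x \<Longrightarrow> vge l y \<Longrightarrow> vge (k + l) (x * y)"
  by (cases "x = 0"; cases "y = 0") (auto simp: vge_def v_mult)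

lemma vge_add: "vge k x \<Longrightarrow> vge k y \<Longrightarrow> vge k (x + y)"
  using v_add[of x y] by (cases "x = 0"; cases "y = 0"; cases "x + y = 0") (auto simp: vge_def)

lemma vge_const: "vge 0 (kc c)"
  by (cases "c = 0") (auto simp: vge_def v_const)

lemma vge_minus: "vge k x \<Longrightarrow> vge k (- x)"
  using vge_mult[OF vge_const[of "-1"], of k x] by simp

lemma vge_diff: "vge k x \<Longrightarrow> vge k y \<Longrightarrow> vge k (x - y)"
  using vge_add[OF _ vge_minus, of k x y] by simp

lemma v_1: "v 1 = 0"
  using v_const[of 1] by simp

lemma v_inverse: "v (inverse x) = - v x"
proof (cases "x = 0")
  case False
  then show ?thesis using v_mult[of x "inverse x"] v_1 by simp
qed simp

lemma v_divide: "x \<noteq> 0 \<Longrightarrow> y \<noteq> 0 \<Longrightarrow> v (x / y) = v x - v y"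
  by (simp add: divide_inverse v_mult v_inverse)

lemma v_power: "x \<noteq> 0 \<Longrightarrow> v (x ^ n) = int n * v x"
  by (induction n) (simp_all add: v_1 v_mult algebra_simps)

lemma vge_power: "vge k x \<Longrightarrow> vge (int n * k) (x ^ n)"
  by (cases "x = 0") (auto simp: vge_def v_power mult_left_mono v_1 power_0_left)

lemma vge_pe: assumes "vge 0 (pe [:0, 1:])" shows "vge 0 (pe p)"
proof (induction p)
  case (pCons a p)
  have "pe (pCons a p) = pe [:a:] + pe [:0, 1:] * pe p"
    unfolding pe.hom_add[symmetric] pe.hom_mult[symmetric] by simp
  then show ?case
    using pCons vge_const[of a] vge_mult[OF assms, of 0 "pe p"] by (simp add: vge_add const_emb_eq)
qed simp

section \<open>The residue field of a place\<close>

definition no_residue :: "'a \<Rightarrow> bool" where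
  "no_residue x \<longleftrightarrow> vge 0 x \<and> (\<forall>c. \<not> vge 1 (x - kc c))"

lemma map_kc_pCons: "map_poly kc (pCons a p) = pCons (kc a) (map_poly kc p)"
  by (simp add: Polynomial.map_poly_pCons)

lemma poly_map_kc_mult:
  "poly (map_poly kc (p * q)) x = poly (map_poly kc p) x * poly (map_poly kc q) x"
proof -
  interpret k: idom_hom kc by unfold_locales simp_all
  interpret mk: map_poly_idom_hom kc ..
  show ?thesis by (simp add: mk.hom_mult)
qed

text \<open>Over C the polynomial Q is a product of linear factors. Each x - r is integral and not
  of positive order, hence of order 0, as x is congruent to no constant. So such an x would be
  transcendental in the residue field.\<close>

lemma no_residue_unit:
  assumes x: "no_residue x" and "Q \<noteq> 0"
  shows "poly (map_poly kc Q) x \<noteq> 0 \<and> v (poly (map_poly kc Q) x) = 0"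
  using assms(2)
proof (induction "degree Q" arbitrary: Q)
  case 0
  then obtain q where "Q = [:q:]" "q \<noteq> 0" using degree_eq_zeroE[of Q] by auto
  then show ?case by (simp add: map_kc_pCons v_const)
next
  case (Suc n)
  then have "\<not> constant (poly Q)" by (simp add: constant_degree)
  then obtain r where "poly Q r = 0" using fundamental_theorem_of_algebra by blast
  then obtain R where R: "Q = [:-r, 1:] * R" by (auto simp: poly_eq_0_iff_dvd)
  then have "R \<noteq> 0" "degree R = n" using Suc by (auto simp: degree_mult_eq simp del: mult_pCons_left)
  then have IH: "poly (map_poly kc R) x \<noteq> 0" "v (poly (map_poly kc R) x) = 0"
    using Suc.hyps(1)[of R] by auto
  have "vge 0 (x - kc r)" "\<not> vge 1 (x - kc r)"
    using x vge_const by (auto simp: no_residue_def intro: vge_diff)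
  then have "x - kc r \<noteq> 0" "v (x - kc r) = 0" by (auto simp: vge_def)
  moreover have "poly (map_poly kc Q) x = (x - kc r) * poly (map_poly kc R) x"
    unfolding R poly_map_kc_mult by (simp add: map_kc_pCons)
  ultimately show ?case using IH by (simp add: v_mult)
qed

text \<open>Otherwise every nonzero p(z) has order 0. But a relation p(z) + t G(z, t) = 0 of the
  uniformizer t with p nonzero gives p(z) positive order. The claim includes the places where z has
  a pole.\<close>

lemma z_has_residue: "\<not> no_residue (pe [:0, 1:])"
proof
  assume z: "no_residue (pe [:0, 1:])"
  obtain p G where p: "p \<noteq> 0" "ev (pCons p G) t = 0" using algebraic_constant_coeff t(1) by blast
  have z0: "vge 0 (pe [:0, 1:])" using z by (simp add: no_residue_def)
  have "vge 0 (ev G t)"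
  proof (induction G)
    case (pCons p G)
    have "vge 0 (t * ev G t)"
      using vge_mult[of 0 t 0 "ev G t"] pCons t by (simp add: vge_def)
    then show ?case using vge_pe[OF z0] by (simp add: vge_add)
  qed simp
  then have "vge (1 + 0) (t * ev G t)" by (intro vge_mult) (simp_all add: vge_def t)
  moreover have "pe p = - (t * ev G t)" using p(2) by (simp add: eq_neg_iff_add_eq_0)
  ultimately have "vge 1 (pe p)" using vge_minus by simp
  moreover have "pe p \<noteq> 0 \<and> v (pe p) = 0"
    using no_residue_unit[OF z p(1)] by (simp flip: pe_eq_poly)
  ultimately show False by (simp add: vge_def)
qed

lemma reduction_finite:
  assumes z: "vge 1 (pe [:0, 1:] - kc a)" and x: "vge 0 x"
  shows "vge 1 (ev H x - poly (map_poly kc (map_poly (\<lambda>p. poly p a) H)) x)"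
proof (induction H)
  case (pCons p H)
  have z0: "vge 0 (pe [:0, 1:])"
    using vge_add[OF vge_mono[OF z] vge_const[of a]] by simp
  have "[:-a, 1:] dvd p - [:poly p a:]" by (simp flip: poly_eq_0_iff_dvd)
  then obtain s where s: "p - [:poly p a:] = [:-a, 1:] * s" by blast
  have "pe p - kc (poly p a) = pe (p - [:poly p a:])" by (simp add: const_emb_eq pe.hom_minus)
  also have "\<dots> = (pe [:0, 1:] - kc a) * pe s"
    unfolding s const_emb_eq pe.hom_minus[symmetric] pe.hom_mult[symmetric] by simp
  finally have "vge 1 (pe p - kc (poly p a))"
    using vge_mult[OF z vge_pe[OF z0], of s] by simp
  moreover have "vge 1 (x * (ev H x - poly (map_poly kc (map_poly (\<lambda>p. poly p a) H)) x))"
    using vge_mult[OF x pCons(2)] by simp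
  moreover have "ev (pCons p H) x - poly (map_poly kc (map_poly (\<lambda>p. poly p a) (pCons p H))) x
    = (pe p - kc (poly p a)) + x * (ev H x - poly (map_poly kc (map_poly (\<lambda>p. poly p a) H)) x)"
    by (simp add: Polynomial.map_poly_pCons map_kc_pCons algebra_simps)
  ultimately show ?case by (simp only: vge_add)
qed simp

text \<open>Above z = \<infinity>, with s = 1/z and D a bound for the degrees in z, the term s^D z^i
  has positive order for i < D and equals 1 for i = D. So only the coefficients of z^D survive the
  reduction.\<close>

lemma reduction_infinite:
  assumes s: "s * pe [:0, 1:] = 1" "vge 1 s" and x: "vge 0 x" and H: "\<And>i. degree (coeff H i) \<le> D"
  shows "vge 1 (s ^ D * ev H x - poly (map_poly kc (map_poly (\<lambda>p. coeff p D) H)) x)"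
  using H
proof (induction H)
  case (pCons p H)
  have s0: "vge 0 s" using vge_mono[OF s(2), of 0] by simp
  have p_deg: "degree p \<le> D" using pCons.prems[of 0] by simp
  have H_deg: "degree (coeff H i) \<le> D" for i using pCons.prems[of "Suc i"] by simp
  have "vge 1 (s ^ D * pe p - kc (coeff p D))" if "degree p \<le> D" for p
    using that
  proof (induction D arbitrary: p)
    case 0
    then obtain c where "p = [:c:]" using degree_eq_zeroE by blast
    then show ?case by (simp add: const_emb_eq)
  next
    case (Suc D)
    obtain c q where p: "p = pCons c q" by (cases p)
    then have "degree q \<le> D" using Suc.prems by (simp split: if_splits)
    then have IH: "vge 1 (s ^ D * pe q - kc (coeff q D))" by (rule Suc.IH)
    have "pe p = kc c + pe [:0, 1:] * pe q"
      unfolding const_emb_eq pe.hom_add[symmetric] pe.hom_mult[symmetric] p by simp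
    then have "s ^ Suc D * pe p = s ^ Suc D * kc c + (s * pe [:0, 1:]) * (s ^ D * pe q)"
      by (simp add: algebra_simps)
    then have eq: "s ^ Suc D * pe p - kc (coeff p (Suc D))
        = s * (s ^ D * kc c) + (s ^ D * pe q - kc (coeff q D))"
      unfolding s(1) by (simp add: p mult.assoc)
    have "vge 0 (s ^ D * kc c)"
      using vge_mult[OF vge_power[OF s0, of D] vge_const[of c]] by simp
    then have "vge 1 (s * (s ^ D * kc c))" using vge_mult[OF s(2), of 0 "s ^ D * kc c"] by simp
    then show ?case unfolding eq using IH by (rule vge_add)
  qed
  from this[OF p_deg] have "vge 1 (s ^ D * pe p - kc (coeff p D))" .
  moreover have "vge 1 (x * (s ^ D * ev H x - poly (map_poly kc (map_poly (\<lambda>p. coeff p D) H)) x))"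
    using vge_mult[OF x pCons.IH[OF H_deg]] by simp
  moreover have "s ^ D * ev (pCons p H) x - poly (map_poly kc (map_poly (\<lambda>p. coeff p D) (pCons p H))) x
    = (s ^ D * pe p - kc (coeff p D))
      + x * (s ^ D * ev H x - poly (map_poly kc (map_poly (\<lambda>p. coeff p D) H)) x)"
    by (simp add: Polynomial.map_poly_pCons map_kc_pCons algebra_simps)
  ultimately show ?case by (simp only: vge_add)
qed simp

text \<open>The residue field is \<open>\<complex>\<close>: an algebraic relation for \<open>x\<close> over \<open>\<complex>[z]\<close>, suitably scaled,
  reduces at the place to a nontrivial one over \<open>\<complex>\<close>.\<close>

lemma residue_exists: assumes x: "vge 0 x" shows "\<exists>c. vge 1 (x - kc c)"
proof (rule ccontr)
  assume "\<not> ?thesis"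
  then have nr: "no_residue x" using x by (simp add: no_residue_def)
  obtain G where G: "G \<noteq> 0" "ev G x = 0" using algebraic by blast
  show False
  proof (cases "vge 0 (pe [:0, 1:])")
    case True
    then obtain a where a: "vge 1 (pe [:0, 1:] - kc a)"
      using z_has_residue by (auto simp: no_residue_def)
    obtain k H where H: "G = smult ([:-a, 1:] ^ k) H" "map_poly (\<lambda>p. poly p a) H \<noteq> 0"
      using extract_all_roots[OF G(1)] by blast
    have "pe ([:-a, 1:] ^ k) \<noteq> 0" by simp
    then have "ev H x = 0" using G(2) unfolding H(1) ev_smult by simp
    then have "vge 1 (poly (map_poly kc (map_poly (\<lambda>p. poly p a) H)) x)"
      using vge_minus[OF reduction_finite[OF a x, of H]] by simp
    then show False using no_residue_unit[OF nr H(2)] by (auto simp: vge_def)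
  next
    case False
    define s where "s = inverse (pe [:0, 1:])"
    have s: "s * pe [:0, 1:] = 1" "vge 1 s"
      using False by (auto simp: s_def vge_def v_inverse)
    define D where "D = Max ((\<lambda>i. degree (coeff G i)) ` {..degree G})"
    have D: "degree (coeff G i) \<le> D" for i
    proof (cases "i \<le> degree G")
      case True
      then show ?thesis unfolding D_def by (intro Max_ge) auto
    next
      case False
      then show ?thesis by (simp add: coeff_eq_0)
    qed
    have "D \<in> (\<lambda>i. degree (coeff G i)) ` {..degree G}" unfolding D_def by (intro Max_in) auto
    then obtain i where i: "degree (coeff G i) = D" by auto
    have "map_poly (\<lambda>p. coeff p D) G \<noteq> 0"
    proof
      assume 0: "map_poly (\<lambda>p. coeff p D) G = 0"
      have "coeff (coeff G j) D = 0" for j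
        using arg_cong[OF 0, of "\<lambda>p. coeff p j"] by (simp add: coeff_map_poly)
      from this[of i] have "coeff G i = 0" unfolding i[symmetric] leading_coeff_0_iff .
      \<comment> \<open>The degree of 0 is 0: if the coefficient attaining the maximum D vanishes,
        then D = 0, all coefficients are constants, and the reduction loses none of them.\<close>
      then have "D = 0" using i by simp
      then have "coeff G j = 0" for j
        using D[of j] \<open>\<And>j. coeff (coeff G j) D = 0\<close>[of j] leading_coeff_0_iff[of "coeff G j"]
        by simp
      then show False using G(1) by (simp add: poly_eq_iff)
    qed
    moreover have "vge 1 (poly (map_poly kc (map_poly (\<lambda>p. coeff p D) G)) x)"
      using vge_minus[OF reduction_infinite[OF s x D]] G(2) by simp
    ultimately show False using no_residue_unit[OF nr] by (auto simp: vge_def)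
  qed
qed

end

section \<open>The derivation of K\<close>

context differential_function_field
begin

lemma d_add: "d (x + y) = d x + d y"
  and d_mult: "d (x * y) = d x * y + x * d y"
  using derivation by (simp_all add: derivation_def)

lemma d_0 [simp]: "d 0 = 0"
  using d_add[of 0 0] by (metis add_cancel_left_right)

lemma d_1 [simp]: "d 1 = 0"
  using d_mult[of 1 1] by (metis add_cancel_left_right mult_1 mult_1_right)

lemma d_sum: "d (\<Sum>i\<in>I. f i) = (\<Sum>i\<in>I. d (f i))"
  by (induction I rule: infinite_finite_induct) (simp_all add: d_add)

lemma d_pe: "d (pe p) = pe (pderiv p)"
  using extends_ddz[of 1 p] by (simp add: pe_def)

lemma d_const: "d (const_emb emb c) = 0"
  by (simp add: const_emb_eq d_pe pderiv_pCons)

lemma d_divide: "y \<noteq> 0 \<Longrightarrow> d (x / y) = (d x * y - x * d y) / y ^ 2"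
proof -
  assume y: "y \<noteq> 0"
  then have "d x = d (x / y) * y + x / y * d y" using d_mult[of "x / y" y] by simp
  then show ?thesis using y by (simp add: field_simps power2_eq_square)
qed

lemma d_ev: "d (ev G y) = ev (map_poly pderiv G) y + ev (pderiv G) y * d y"
  by (induction G) (simp_all add: Polynomial.map_poly_pCons pderiv_pCons hom_distribs d_add d_mult d_pe algebra_simps)

end

section \<open>Expansion in a uniformizer\<close>

context place
begin

definition evK :: "complex poly \<Rightarrow> 'a" where "evK P = poly (map_poly kc P) t"

definition evF :: "complex poly \<Rightarrow> complex fls" where "evF P = poly (map_poly fls_const P) fls_t"

lemma evK_hom: "evK 0 = 0" "evK (pCons a P) = kc a + t * evK P"
    "evK (P + Q) = evK P + evK Q" "evK (P * Q) = evK P * evK Q" "evK (monom 1 k) = t ^ k"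
proof -
  interpret k: idom_hom kc by unfold_locales simp_all
  interpret mk: map_poly_idom_hom kc ..
  show "evK (P + Q) = evK P + evK Q" "evK (P * Q) = evK P * evK Q"
    by (simp_all add: evK_def mk.hom_add mk.hom_mult)
  show "evK 0 = 0" "evK (pCons a P) = kc a + t * evK P" "evK (monom 1 k) = t ^ k"
    by (simp_all add: evK_def map_kc_pCons map_poly_monom poly_monom)
qed

lemma evF_hom: "evF 0 = 0" "evF (pCons a P) = fls_const a + fls_t * evF P"
    "evF (P + Q) = evF P + evF Q" "evF (P * Q) = evF P * evF Q" "evF (monom 1 k) = fls_t ^ k"
proof -
  interpret k: idom_hom "fls_const :: complex \<Rightarrow> complex fls"
    by unfold_locales (simp_all add: fls_const_mult_const fls_plus_const)
  interpret mk: map_poly_idom_hom "fls_const :: complex \<Rightarrow> complex fls" ..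
  show "evF (P + Q) = evF P + evF Q" "evF (P * Q) = evF P * evF Q"
    by (simp_all add: evF_def mk.hom_add mk.hom_mult)
  show "evF 0 = 0" "evF (pCons a P) = fls_const a + fls_t * evF P" "evF (monom 1 k) = fls_t ^ k"
    by (simp_all add: evF_def Polynomial.map_poly_pCons map_poly_monom poly_monom)
qed

lemma evF_nth: "fls_nth (evF Q) i = (if i < 0 then 0 else coeff Q (nat i))"
proof (induction Q arbitrary: i)
  case (pCons a Q)
  then show ?case
    by (cases "nat i") (auto simp: evF_hom coeff_pCons nat_diff_distrib split: nat.split)
qed (simp add: evF_hom)

lemma evK_vge: "vge 0 (evK P)"
proof (induction P)
  case (pCons a P)
  have "vge 0 (t * evK P)" using vge_mult[of 0 t, OF _ pCons(2)] t by (simp add: vge_def)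
  then show ?case by (simp add: evK_hom vge_add vge_const)
qed (simp add: evK_hom)

lemma evF_ge: "fls_ge 0 (evF P)"
proof (induction P)
  case (pCons a P)
  have "fls_ge 0 (fls_t * evF P)"
    using fls_ge_mult[of 0 fls_t, OF _ pCons(2)] by (simp add: fls_ge_iff)
  then show ?case by (simp add: evF_hom fls_ge_add fls_ge_const)
qed (simp add: evF_hom)

text \<open>Both orders are the multiplicity of 0 as a root of \<open>P\<close>, because the
  uniformizer has order 1 and nonzero constants have order 0 on either side.\<close>

lemma evK_evF: "P \<noteq> 0 \<Longrightarrow> evK P \<noteq> 0 \<and> evF P \<noteq> 0 \<and> v (evK P) = fls_subdegree (evF P)"
proof (induction P)
  case (pCons a P)
  show ?case
  proof (cases "a = 0")
    case True
    then show ?thesis using pCons t by (simp add: evK_hom evF_hom v_mult)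
  next
    case False
    have K: "vge 1 (t * evK P)" and F: "fls_ge 1 (fls_t * evF P)"
      using vge_mult[of 1 t 0 "evK P"] evK_vge t fls_ge_mult[of 1 fls_t 0 "evF P"] evF_ge
      by (simp_all add: vge_def fls_ge_iff)
    have "\<not> vge 1 (evK (pCons a P))"
    proof
      assume "vge 1 (evK (pCons a P))"
      from vge_diff[OF this K] have "vge 1 (kc a)" by (simp add: evK_hom)
      then show False using False v_const[of a] by (simp add: vge_def)
    qed
    then have 1: "evK (pCons a P) \<noteq> 0" "v (evK (pCons a P)) = 0"
      using evK_vge[of "pCons a P"] by (auto simp: vge_def)
    have "fls_nth (evF (pCons a P)) 0 = a" using evF_ge[of P] by (simp add: evF_hom fls_ge_def)
    then have 2: "evF (pCons a P) \<noteq> 0" "fls_subdegree (evF (pCons a P)) \<le> 0"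
      using False by (auto intro: fls_subdegree_leI)
    then have "fls_subdegree (evF (pCons a P)) = 0"
      using evF_ge[of "pCons a P"] by (auto simp: fls_ge_iff)
    then show ?thesis using 1 2 by simp
  qed
qed simp

text \<open>The expansion of \<open>x\<close> in the uniformizer is the Laurent series approximated by the same
  Laurent polynomials as \<open>x\<close>.\<close>

definition laurent_pairs :: "('a \<times> complex fls) set" where
  "laurent_pairs = {(evK P / t ^ m, evF P / fls_t ^ m) | P m. True}"

lemma laurent_pairsI: "(evK P / t ^ m, evF P / fls_t ^ m) \<in> laurent_pairs"
  by (auto simp: laurent_pairs_def)

lemma laurent_pairs_add:
  assumes "(x, f) \<in> laurent_pairs" "(y, g) \<in> laurent_pairs"
  shows "(x + y, f + g) \<in> laurent_pairs"
proof -
  obtain P m Q n where eqs: "x = evK P / t ^ m" "f = evF P / fls_t ^ m"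
      "y = evK Q / t ^ n" "g = evF Q / fls_t ^ n"
    using assms by (auto simp: laurent_pairs_def)
  have "x + y = evK (P * monom 1 n + Q * monom 1 m) / t ^ (m + n)"
    using t(1) by (simp add: eqs evK_hom power_add add_frac_eq)
  moreover have "f + g = evF (P * monom 1 n + Q * monom 1 m) / fls_t ^ (m + n)"
    by (simp add: eqs evF_hom power_add add_frac_eq)
  ultimately show ?thesis using laurent_pairsI by simp
qed

lemma laurent_pairs_mult:
  assumes "(x, f) \<in> laurent_pairs" "(y, g) \<in> laurent_pairs"
  shows "(x * y, f * g) \<in> laurent_pairs"
proof -
  obtain P m Q n where eqs: "x = evK P / t ^ m" "f = evF P / fls_t ^ m"
      "y = evK Q / t ^ n" "g = evF Q / fls_t ^ n"
    using assms by (auto simp: laurent_pairs_def)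
  have "x * y = evK (P * Q) / t ^ (m + n)" by (simp add: eqs evK_hom power_add)
  moreover have "f * g = evF (P * Q) / fls_t ^ (m + n)" by (simp add: eqs evF_hom power_add)
  ultimately show ?thesis using laurent_pairsI by simp
qed

lemma laurent_pairs_const: "(kc c, fls_const c) \<in> laurent_pairs"
  using laurent_pairsI[of "[:c:]" 0] by (simp add: evK_hom evF_hom)

lemma laurent_pairs_diff:
  assumes "(x, f) \<in> laurent_pairs" "(y, g) \<in> laurent_pairs"
  shows "(x - y, f - g) \<in> laurent_pairs"
  using laurent_pairs_add[OF assms(1) laurent_pairs_mult[OF laurent_pairs_const[of "-1"] assms(2)]]
  by simp

lemma laurent_pairs_val:
  assumes "(x, f) \<in> laurent_pairs" shows "vge k x \<longleftrightarrow> fls_ge k f"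
proof -
  obtain P m where eqs: "x = evK P / t ^ m" "f = evF P / fls_t ^ m"
    using assms by (auto simp: laurent_pairs_def)
  show ?thesis
  proof (cases "P = 0")
    case False
    then show ?thesis using evK_evF[OF False] t
      by (simp add: eqs vge_def fls_ge_iff v_divide v_power fls_divide_subdegree fls_subdegree_pow)
  qed (simp add: eqs evK_hom evF_hom)
qed

text \<open>The closure of the graph \<open>laurent_pairs\<close> in K x C((t)). Describing
  expansions by approximation rather than by their coefficients lets sums and products pass to the
  limit.\<close>

definition expands_to :: "'a \<Rightarrow> complex fls \<Rightarrow> bool" where
  "expands_to x f \<longleftrightarrow> (\<forall>k. \<exists>y g. (y, g) \<in> laurent_pairs \<and> vge k (x - y) \<and> fls_ge k (f - g))"

lemma expands_toE:
  assumes "expands_to x f"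
  obtains y g where "(y, g) \<in> laurent_pairs" "vge k (x - y)" "fls_ge k (f - g)"
  using assms unfolding expands_to_def by blast

lemma expands_to_pair: "(x, f) \<in> laurent_pairs \<Longrightarrow> expands_to x f"
  unfolding expands_to_def by (intro allI exI[of _ x] exI[of _ f]) simp

lemma expands_to_diff:
  assumes "expands_to x f" "expands_to x' f'" shows "expands_to (x - x') (f - f')"
  unfolding expands_to_def
proof
  fix k
  obtain y g where 1: "(y, g) \<in> laurent_pairs" "vge k (x - y)" "fls_ge k (f - g)"
    using assms(1) by (rule expands_toE)
  obtain y' g' where 2: "(y', g') \<in> laurent_pairs" "vge k (x' - y')" "fls_ge k (f' - g')"
    using assms(2) by (rule expands_toE)
  show "\<exists>y g. (y, g) \<in> laurent_pairs \<and> vge k (x - x' - y) \<and> fls_ge k (f - f' - g)"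
    using laurent_pairs_diff[OF 1(1) 2(1)] vge_diff[OF 1(2) 2(2)] fls_ge_diff[OF 1(3) 2(3)]
    by (intro exI[of _ "y - y'"] exI[of _ "g - g'"]) (simp add: algebra_simps)
qed

lemma expands_to_add:
  assumes "expands_to x f" "expands_to x' f'" shows "expands_to (x + x') (f + f')"
proof -
  have "expands_to 0 0" using expands_to_pair[OF laurent_pairs_const[of 0]] by simp
  from expands_to_diff[OF assms(1) expands_to_diff[OF this assms(2)]] show ?thesis by simp
qed

lemma expands_to_mult:
  assumes "expands_to x f" "expands_to x' f'" shows "expands_to (x * x') (f * f')"
  unfolding expands_to_def
proof
  fix k
  \<comment> \<open>\<open>b\<close> bounds the orders of x, f, x', f' from below. The precision
    \<open>l\<close> = max b (k - b) gives every cross term order at least k, and b \<le> l carries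
    the lower bound over to the approximations y' and g'.\<close>
  define b where "b = min (min (v x) (fls_subdegree f)) (min (v x') (fls_subdegree f'))"
  define l where "l = max b (k - b)"
  have b: "vge b x" "fls_ge b f" "vge b x'" "fls_ge b f'"
    by (auto simp: b_def vge_def fls_ge_iff)
  obtain y g where 1: "(y, g) \<in> laurent_pairs" "vge l (x - y)" "fls_ge l (f - g)"
    using assms(1) by (rule expands_toE)
  obtain y' g' where 2: "(y', g') \<in> laurent_pairs" "vge l (x' - y')" "fls_ge l (f' - g')"
    using assms(2) by (rule expands_toE)
  have l: "b \<le> l" "k \<le> b + l" "k \<le> l + b" by (simp_all add: l_def)
  have "vge b y'" using vge_diff[OF b(3) vge_mono[OF 2(2) l(1)]] by simp
  then have "vge k (x * (x' - y') + (x - y) * y')"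
    using vge_mono[OF vge_mult[OF b(1) 2(2)] l(2)] vge_mono[OF vge_mult[OF 1(2)] l(3)]
    by (intro vge_add) auto
  moreover have "fls_ge b g'" using fls_ge_diff[OF b(4) fls_ge_mono[OF 2(3) l(1)]] by simp
  then have "fls_ge k (f * (f' - g') + (f - g) * g')"
    using fls_ge_mono[OF fls_ge_mult[OF b(2) 2(3)] l(2)] fls_ge_mono[OF fls_ge_mult[OF 1(3)] l(3)]
    by (intro fls_ge_add) auto
  moreover have "x * (x' - y') + (x - y) * y' = x * x' - y * y'" by (simp add: algebra_simps)
  moreover have "f * (f' - g') + (f - g) * g' = f * f' - g * g'" by (simp add: algebra_simps)
  ultimately show "\<exists>y g. (y, g) \<in> laurent_pairs \<and> vge k (x * x' - y) \<and> fls_ge k (f * f' - g)"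
    using laurent_pairs_mult[OF 1(1) 2(1)] by auto
qed

text \<open>An approximation to precision k decides whether the order is at least k, and for the
  approximating pairs the orders agree. Applied to a difference, this makes the expansion
  unique.\<close>

lemma expands_to_val: assumes "expands_to x f" shows "vge k x \<longleftrightarrow> fls_ge k f"
proof -
  obtain y g where 1: "(y, g) \<in> laurent_pairs" "vge k (x - y)" "fls_ge k (f - g)"
    using assms by (rule expands_toE)
  have "vge k x \<longleftrightarrow> vge k y"
    using vge_diff[OF _ 1(2), of x] vge_add[OF _ 1(2), of y] by auto
  moreover have "fls_ge k f \<longleftrightarrow> fls_ge k g"
    using fls_ge_diff[OF _ 1(3), of f] fls_ge_add[OF _ 1(3), of g] by auto
  ultimately show ?thesis using laurent_pairs_val[OF 1(1)] by simp
qed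

lemma expands_to_unique: assumes "expands_to x f" "expands_to x g" shows "f = g"
proof -
  have "fls_ge k (f - g)" for k
    using expands_to_val[OF expands_to_diff[OF assms], of k] by simp
  then have "f - g = 0" by (rule fls_eq_0_if_ge)
  then show ?thesis by simp
qed

definition residue_of :: "'a \<Rightarrow> complex" where "residue_of x = (SOME c. vge 1 (x - kc c))"

lemma residue_of: "vge 0 x \<Longrightarrow> vge 1 (x - kc (residue_of x))"
  unfolding residue_of_def by (rule someI_ex) (rule residue_exists)

text \<open>Subtract the residue and divide by the uniformizer: the residues of the successive
  remainders are the coefficients of the expansion.\<close>

primrec remainder :: "'a \<Rightarrow> nat \<Rightarrow> 'a" where
  "remainder x 0 = x"
| "remainder x (Suc k) = (remainder x k - kc (residue_of (remainder x k))) / t"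

lemma vge_remainder: assumes "vge 0 x" shows "vge 0 (remainder x k)"
proof (induction k)
  case (Suc k)
  then show ?case using residue_of[OF Suc] t
    by (cases "remainder x k - kc (residue_of (remainder x k)) = 0") (auto simp: vge_def v_divide)
qed (simp add: assms)

lemma remainder_sum:
  "x = evK (\<Sum>i<k. monom (residue_of (remainder x i)) i) + t ^ k * remainder x k"
proof (induction k)
  case (Suc k)
  have m: "evK (monom c i) = kc c * t ^ i" for c i
    by (simp add: evK_def map_poly_monom poly_monom)
  define r where "r = remainder x k"
  have "t ^ Suc k * remainder x (Suc k) = t ^ k * (t * remainder x (Suc k))" by simp
  also have "t * remainder x (Suc k) = r - kc (residue_of r)" using t(1) by (simp add: r_def)
  finally have "t ^ k * remainder x k
      = evK (monom (residue_of (remainder x k)) k) + t ^ Suc k * remainder x (Suc k)"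
    unfolding m by (simp add: r_def algebra_simps del: remainder.simps)
  then show ?case using Suc by (simp only: sum.lessThan_Suc evK_hom add.assoc)
qed (simp add: evK_hom)

lemma expansion_integral: assumes "vge 0 x" shows "\<exists>f. expands_to x f"
proof
  let ?c = "\<lambda>i. residue_of (remainder x i)"
  show "expands_to x (fps_to_fls (Abs_fps ?c))"
    unfolding expands_to_def
  proof
    fix k
    let ?P = "\<Sum>i<nat k. monom (?c i) i"
    have "x - evK ?P = t ^ nat k * remainder x (nat k)"
      unfolding diff_eq_eq add.commute[of "_ ^ _ * _"] by (rule remainder_sum)
    moreover have "vge (int (nat k) + 0) (t ^ nat k * remainder x (nat k))"
      using vge_remainder[OF assms] t by (intro vge_mult) (simp_all add: vge_def v_power)
    ultimately have 1: "vge k (x - evK ?P)" by (auto intro: vge_mono)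
    have 2: "fls_ge k (fps_to_fls (Abs_fps ?c) - evF ?P)"
      by (auto simp: fls_ge_def coeff_sum nat_less_iff evF_nth)
    show "\<exists>y g. (y, g) \<in> laurent_pairs \<and> vge k (x - y) \<and> fls_ge k (fps_to_fls (Abs_fps ?c) - g)"
      using laurent_pairsI[of ?P 0] 1 2 by auto
  qed
qed

lemma expansion_exists: "\<exists>f. expands_to x f"
proof -
  define m where "m = nat (- v x)"
  have "vge 0 (x * t ^ m)"
    using t by (cases "x = 0") (auto simp: m_def vge_def v_mult v_power)
  then obtain f where f: "expands_to (x * t ^ m) f" using expansion_integral by blast
  have "(1 / t ^ m, 1 / fls_t ^ m) \<in> laurent_pairs"
    using laurent_pairsI[of 1 m] by (simp add: one_pCons evK_hom evF_hom)
  from expands_to_mult[OF f expands_to_pair[OF this]] show ?thesis using t(1) by auto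
qed

definition expansion :: "'a \<Rightarrow> complex fls" where "expansion x = (THE f. expands_to x f)"

lemma expansion: "expands_to x (expansion x)"
  unfolding expansion_def using expansion_exists expands_to_unique by (blast intro: theI)

lemma expansion_eq: "expands_to x f \<Longrightarrow> expansion x = f"
  using expansion expands_to_unique by blast

lemma fls_approx: "\<exists>y g. (y, g) \<in> laurent_pairs \<and> fls_ge k (h - g)"
proof -
  define m where "m = nat (- fls_subdegree h)"
  define h0 where "h0 = fls_regpart (h * fls_t ^ m)"
  have "fls_ge 0 (h * fls_t ^ m)"
    by (cases "h = 0") (auto simp: m_def fls_ge_iff fls_subdegree_pow)
  then have h0: "h * fls_t ^ m = fps_to_fls h0"
    by (cases "h = 0") (simp_all add: h0_def fls_ge_iff)
  define n where "n = nat (k + int m)"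
  let ?P = "\<Sum>i<n. monom (fps_nth h0 i) i"
  have "fls_ge (int n) (fps_to_fls h0 - evF ?P)"
    by (auto simp: fls_ge_def coeff_sum nat_less_iff evF_nth)
  from fls_ge_divide[OF this, of "fls_t ^ m"] have "fls_ge k ((fps_to_fls h0 - evF ?P) / fls_t ^ m)"
    by (rule fls_ge_mono) (simp_all add: fls_subdegree_pow n_def)
  moreover have "(fps_to_fls h0 - evF ?P) / fls_t ^ m = h - evF ?P / fls_t ^ m"
    unfolding h0[symmetric] by (simp add: diff_divide_distrib)
  ultimately show ?thesis using laurent_pairsI by auto
qed

text \<open>This existence statement gives the \<open>SOME\<close> in \<open>completion\<close> its
  meaning. From here on the completion is known only through the properties in
  \<open>is_completion\<close>; it need not be \<open>expansion\<close> itself.\<close>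

lemma is_completion_expansion: "is_completion emb v expansion"
  unfolding is_completion_def
proof (intro conjI allI)
  have c: "expansion (kc c) = fls_const c" for c
    using expansion_eq[OF expands_to_pair[OF laurent_pairs_const]] .
  then show "expansion (kc c) = fls_const c" for c .
  show "field_hom expansion"
  proof unfold_locales
    show "expansion 0 = 0" "expansion 1 = 1" using c[of 0] c[of 1] by simp_all
  qed (simp_all add: expansion_eq expands_to_add expands_to_mult expansion)
  show "fls_subdegree (expansion x) = v x" for x
  proof (cases "x = 0")
    case True
    then show ?thesis using c[of 0] by simp
  next
    case False
    note val = expands_to_val[OF expansion, of _ x]
    have "fls_ge (v x) (expansion x)" "\<not> fls_ge (v x + 1) (expansion x)"
      unfolding val[symmetric] using False by (auto simp: vge_def)
    then show ?thesis by (auto simp: fls_ge_iff)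
  qed
  have "h \<in> closure (range expansion)" for h
    unfolding closure_approachable
  proof (intro allI impI)
    fix e :: real assume e: "e > 0"
    obtain n where n: "inverse (2 ^ n) < e"
      using real_arch_pow_inv[OF e, of "1/2"] by (auto simp: power_one_over inverse_eq_divide)
    obtain y g where yg: "(y, g) \<in> laurent_pairs" "fls_ge (int n) (h - g)" using fls_approx by blast
    then have "dist h g < e" using fls_dist_le[OF yg(2)] n by simp
    moreover have "expansion y = g" using expansion_eq[OF expands_to_pair[OF yg(1)]] .
    ultimately show "\<exists>y\<in>range expansion. dist y h < e" by (auto simp: dist_commute)
  qed
  then show "closure (range expansion) = UNIV" by auto
qed

section \<open>The chosen completion and its derivation\<close>

abbreviation \<psi> :: "'a \<Rightarrow> complex fls" where "\<psi> \<equiv> completion emb v"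

lemma is_completion: "is_completion emb v \<psi>"
  unfolding completion_def
  by (rule someI[of "is_completion emb v"]) (rule is_completion_expansion)

sublocale \<psi>: field_hom \<psi>
  using is_completion by (simp add: is_completion_def)

lemma \<psi>_const: "\<psi> (kc c) = fls_const c"
  and \<psi>_subdegree: "fls_subdegree (\<psi> x) = v x"
  and \<psi>_dense: "closure (range \<psi>) = UNIV"
  using is_completion by (simp_all add: is_completion_def)

lemma \<psi>_eq_0_iff [simp]: "\<psi> x = 0 \<longleftrightarrow> x = 0"
proof
  assume 0: "\<psi> x = 0"
  show "x = 0"
  proof (rule ccontr)
    assume "x \<noteq> 0"
    then have "\<psi> x * \<psi> (inverse x) = 1" by (simp flip: \<psi>.hom_mult)
    then show False using 0 by simp
  qed
qed simp

lemma \<psi>_ge: "fls_ge k (\<psi> x) \<longleftrightarrow> vge k x"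
  by (simp add: fls_ge_iff vge_def \<psi>_subdegree)

lemma deriv_z_neq_0: "fls_deriv (\<psi> (pe [:0, 1:])) \<noteq> 0"
proof
  assume "fls_deriv (\<psi> (pe [:0, 1:])) = 0"
  then obtain c where "\<psi> (pe [:0, 1:]) = \<psi> (kc c)" using fls_deriv_eq_0 \<psi>_const by metis
  then have "\<psi> (pe [:0, 1:] - kc c) = 0" by (simp add: \<psi>.hom_minus)
  then have "pe ([:0, 1:] - [:c:]) = 0" by (simp add: const_emb_eq pe.hom_minus)
  then show False by (simp del: pe.hom_minus)
qed

text \<open>By the chain rule d/dz is d/dt divided by dz/dt, where t is the variable of the Laurent
  series field and z is regarded as the series \<psi>(z).\<close>

definition deriv_v :: "complex fls \<Rightarrow> complex fls" where
  "deriv_v g = fls_deriv g / fls_deriv (\<psi> (pe [:0, 1:]))"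

lemma deriv_v_add: "deriv_v (f + g) = deriv_v f + deriv_v g"
  and deriv_v_diff: "deriv_v (f - g) = deriv_v f - deriv_v g"
  and deriv_v_mult: "deriv_v (f * g) = deriv_v f * g + f * deriv_v g"
  and deriv_v_const: "deriv_v (fls_const c) = 0"
  by (simp_all add: deriv_v_def add_divide_distrib diff_divide_distrib algebra_simps)

text \<open>The difference E of the two sides is a derivation from K to the completion that vanishes
  on C[z]. For a relation G of minimal degree of x it satisfies G_Y(x) E(x) = 0, and G_Y(x) is
  nonzero by minimality. So E vanishes on all of K.\<close>

lemma deriv_v_\<psi>: "deriv_v (\<psi> x) = \<psi> (d x)"
proof -
  define E where "E x = deriv_v (\<psi> x) - \<psi> (d x)" for x
  have E_add: "E (x + y) = E x + E y" for x y
    by (simp add: E_def deriv_v_add \<psi>.hom_add d_add)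
  have E_mult: "E (x * y) = E x * \<psi> y + \<psi> x * E y" for x y
    by (simp add: E_def deriv_v_mult \<psi>.hom_add \<psi>.hom_mult d_mult algebra_simps)
  have E_const: "E (kc c) = 0" for c
    by (simp add: E_def \<psi>_const deriv_v_const d_const)
  have "deriv_v (\<psi> (pe [:0, 1:])) = 1"
    using deriv_z_neq_0 by (simp add: deriv_v_def)
  then have E_z: "E (pe [:0, 1:]) = 0"
    by (simp add: E_def d_pe pderiv_pCons)
  have E_pe: "E (pe p) = 0" for p
  proof (induction p)
    case (pCons a p)
    have "pe (pCons a p) = kc a + pe [:0, 1:] * pe p"
      unfolding const_emb_eq pe.hom_add[symmetric] pe.hom_mult[symmetric] by simp
    then show ?case using pCons by (simp add: E_add E_mult E_const E_z)
  qed (use E_const[of 0] in simp)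
  have E_ev: "E (ev G x) = \<psi> (ev (pderiv G) x) * E x" for G
    by (induction G) (use E_const[of 0] in
      \<open>simp_all add: E_add E_mult E_pe pderiv_pCons hom_distribs algebra_simps\<close>)
  obtain G where "G \<noteq> 0" "ev G x = 0" "degree G > 0"
    and G_le: "\<And>H. H \<noteq> 0 \<Longrightarrow> ev H x = 0 \<Longrightarrow> degree G \<le> degree H"
    using minimal_relation[of x] by blast
  then have "pderiv G \<noteq> 0" "degree (pderiv G) < degree G"
    by (simp_all add: pderiv_eq_0_iff degree_pderiv)
  then have "ev (pderiv G) x \<noteq> 0"
    using G_le[of "pderiv G"] by auto
  moreover have "\<psi> (ev (pderiv G) x) * E x = 0"
    using E_ev[of G] \<open>ev G x = 0\<close> E_const[of 0] by simp
  ultimately have "E x = 0" by simp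
  then show ?thesis by (simp add: E_def)
qed

text \<open>\<open>deriv_v\<close> is continuous since it loses at most 1 + ord(dz/dt) orders. Two
  continuous maps that agree on the dense image of K are equal, so the definite description is met
  by it alone.\<close>

lemma completion_deriv: "completion_deriv emb d v = deriv_v"
  unfolding completion_deriv_def
proof (rule the_equality)
  have "continuous_on UNIV deriv_v"
  proof (rule fls_continuous_onI)
    show "deriv_v f - deriv_v g = deriv_v (f - g)" for f g by (simp add: deriv_v_diff)
    show "fls_ge (k - (1 + fls_subdegree (fls_deriv (\<psi> (pe [:0, 1:]))))) (deriv_v f)"
      if "fls_ge k f" for k f
      using fls_ge_divide[OF fls_ge_deriv_pred[OF that] deriv_z_neq_0]
      by (simp add: deriv_v_def algebra_simps)
  qed
  then show *: "derivation deriv_v \<and> continuous_on UNIV deriv_v \<and> (\<forall>x. deriv_v (\<psi> x) = \<psi> (d x))"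
    by (simp add: derivation_def deriv_v_add deriv_v_mult deriv_v_\<psi>)
  fix D assume D: "derivation D \<and> continuous_on UNIV D \<and> (\<forall>x. D (\<psi> x) = \<psi> (d x))"
  have "closed {g. D g = deriv_v g}"
    using D * by (intro closed_Collect_eq) auto
  moreover have "range \<psi> \<subseteq> {g. D g = deriv_v g}" using D deriv_v_\<psi> by auto
  ultimately have "closure (range \<psi>) \<subseteq> {g. D g = deriv_v g}" by (rule closure_minimal[rotated])
  then show "D = deriv_v" unfolding \<psi>_dense by auto
qed

text \<open>At an unramified place above a finite point, \<open>\<psi> z\<close> has derivative of order \<open>0\<close>.\<close>

lemma deriv_v_ge:
  assumes "v (pe [:-a, 1:]) = 1" "fls_ge 0 g"
  shows "fls_ge 0 (deriv_v g)"
proof -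
  define w where "w = \<psi> (pe [:-a, 1:])"
  have w: "fls_subdegree w = 1" using assms(1) by (simp add: w_def \<psi>_subdegree)
  then have "w \<noteq> 0" by auto
  then have w1: "fls_nth w 1 \<noteq> 0" using w by (metis nth_fls_subdegree_nonzero)
  have "pe [:0, 1:] = pe [:-a, 1:] + kc a"
    unfolding const_emb_eq pe.hom_add[symmetric] by simp
  then have "\<psi> (pe [:0, 1:]) = w + fls_const a" by (simp add: w_def \<psi>.hom_add \<psi>_const)
  then have eq: "fls_deriv (\<psi> (pe [:0, 1:])) = fls_deriv w" by simp
  have "fls_nth (fls_deriv w) 0 \<noteq> 0" using w1 by (simp add: fls_deriv_nth)
  then have "fls_subdegree (fls_deriv w) \<le> 0" by (rule fls_subdegree_leI)
  moreover have "fls_ge 0 (fls_deriv w)" using w by (intro fls_ge_deriv) (simp add: fls_ge_iff)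
  ultimately have "fls_subdegree (fls_deriv w) = 0" by (auto simp: fls_ge_iff)
  then show ?thesis
    using fls_ge_divide[OF fls_ge_deriv[OF assms(2)] deriv_z_neq_0] by (simp add: deriv_v_def eq)
qed

end

section \<open>Places above a point of the plane\<close>

lemma poly_diff_factor: "\<exists>R. poly P x - poly P y = (x - y) * R" for x y :: "'a::comm_ring_1"
proof (induction P)
  case (pCons p P)
  then obtain R where R: "poly P x - poly P y = (x - y) * R" by blast
  have "poly (pCons p P) x - poly (pCons p P) y = (x - y) * poly P x + y * (poly P x - poly P y)"
    by (simp add: algebra_simps)
  also have "\<dots> = (x - y) * (poly P x + y * R)" unfolding R by (simp add: algebra_simps)
  finally show ?case by blast
qed (auto intro: exI[of _ 0])

lemma poly_taylor2: "\<exists>R. poly P (y + e) = poly P y + e * poly (pderiv P) y + e ^ 2 * R"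
  for y :: "'a::idom"
proof (induction P)
  case (pCons p P)
  then obtain R where R: "poly P (y + e) = poly P y + e * poly (pderiv P) y + e ^ 2 * R" by blast
  have "poly (pCons p P) (y + e) = p + (y + e) * poly P (y + e)" by simp
  also have "\<dots> = p + (y + e) * (poly P y + e * poly (pderiv P) y + e ^ 2 * R)" by (simp only: R)
  also have "\<dots> = poly (pCons p P) y + e * poly (pderiv (pCons p P)) y
      + e ^ 2 * (poly (pderiv P) y + (y + e) * R)"
    by (simp add: pderiv_pCons algebra_simps power2_eq_square)
  finally show ?case by blast
qed simp

lemma fps_nth_0_poly: "fps_nth (poly P y) 0 = poly (map_poly (\<lambda>f. fps_nth f 0) P) (fps_nth y 0)"
  for P :: "'a::idom fps poly"
  by (induction P) (simp_all add: Polynomial.map_poly_pCons)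

text \<open>Newton iteration one coefficient at a time. With u = P0'(b), a correction e = c X^(n+1)
  changes coefficient n+1 of P(s n) by c u and no earlier one, because the quadratic term starts at
  order 2n+2. The root is the diagonal limit of the approximations.\<close>

lemma fps_hensel:
  fixes P :: "complex fps poly"
  defines "P0 \<equiv> map_poly (\<lambda>f. fps_nth f 0) P"
  assumes root: "poly P0 b = 0" and simple: "poly (pderiv P0) b \<noteq> 0"
  shows "\<exists>\<eta>. fps_nth \<eta> 0 = b \<and> poly P \<eta> = 0"
proof -
  define u where "u = poly (pderiv P0) b"
  have u: "u \<noteq> 0" using simple by (simp add: u_def)
  have pderiv0: "map_poly (\<lambda>f. fps_nth f 0) (pderiv P) = pderiv P0"
    unfolding P0_def by (rule poly_eqI) (simp add: coeff_pderiv coeff_map_poly flip: fps_of_nat del: of_nat_Suc)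
  define s where "s = rec_nat (fps_const b)
    (\<lambda>n y. y + fps_const (- fps_nth (poly P y) (Suc n) / u) * fps_X ^ Suc n)"
  have s0: "s 0 = fps_const b"
    and sS: "s (Suc n) = s n + fps_const (- fps_nth (poly P (s n)) (Suc n) / u) * fps_X ^ Suc n" for n
    by (simp_all add: s_def)
  have step: "fps_nth (fps_const c * fps_X ^ Suc n * g) i = (if i < Suc n then 0 else c * fps_nth g (i - Suc n))"
    for c :: complex and n i g
    by (simp add: mult.assoc fps_X_power_mult_nth del: power_Suc)
  have nth0: "fps_nth (s n) 0 = b" for n
    by (induction n) (simp_all add: s0 sS step[where g = 1, simplified])
  have approx: "fps_nth (poly P (s n)) i = 0" if "i \<le> n" for n i
    using that
  proof (induction n arbitrary: i)
    case 0
    then show ?case using root by (simp add: fps_nth_0_poly s0 flip: P0_def)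
  next
    case (Suc n)
    define c where "c = - fps_nth (poly P (s n)) (Suc n) / u"
    define e where "e = fps_const c * fps_X ^ Suc n"
    obtain R where R: "poly P (s n + e) = poly P (s n) + e * poly (pderiv P) (s n) + e ^ 2 * R"
      using poly_taylor2 by blast
    have "e ^ 2 * R = fps_const c * fps_X ^ Suc n * (fps_const c * fps_X ^ Suc n * R)"
      by (simp only: e_def power2_eq_square mult.assoc)
    then have "fps_nth (e ^ 2 * R) i = 0" using Suc.prems by (simp only: step) auto
    moreover have "fps_nth (e * poly (pderiv P) (s n)) i = (if i < Suc n then 0 else c * u)"
      unfolding e_def step using Suc.prems
      by (auto simp: fps_nth_0_poly pderiv0 nth0 u_def)
    moreover have "s (Suc n) = s n + e" by (simp add: sS e_def c_def)
    ultimately show ?case using Suc u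
      by (cases "i = Suc n") (simp_all add: R c_def)
  qed
  define \<eta> where "\<eta> = Abs_fps (\<lambda>n. fps_nth (s n) n)"
  have stable: "fps_nth (s n) i = fps_nth (s i) i" if "i \<le> n" for n i
    using that
  proof (induction n)
    case (Suc n)
    then show ?case
      by (cases "i = Suc n") (simp_all add: sS step[where g = 1, simplified])
  qed simp
  have "fps_nth (poly P \<eta>) n = 0" for n
  proof -
    obtain R where R: "poly P \<eta> - poly P (s n) = (\<eta> - s n) * R" using poly_diff_factor by blast
    have "fps_nth (\<eta> - s n) i = 0" if "i \<le> n" for i
      using stable[OF that] by (simp add: \<eta>_def)
    then have "fps_nth ((\<eta> - s n) * R) n = 0"
      unfolding fps_mult_nth by (intro sum.neutral) auto
    then show ?thesis using approx[of n n] unfolding R[symmetric] by simp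
  qed
  then have "poly P \<eta> = 0" by (simp add: fps_eq_iff)
  moreover have "fps_nth \<eta> 0 = b" by (simp add: \<eta>_def s0)
  ultimately show ?thesis by blast
qed

lemma dvd_if_vanishes_on_simple_roots:
  fixes Q R :: "complex poly"
  assumes "Q \<noteq> 0" "\<And>b. poly Q b = 0 \<Longrightarrow> poly (pderiv Q) b \<noteq> 0" "\<And>b. poly Q b = 0 \<Longrightarrow> poly R b = 0"
  shows "Q dvd R"
  using assms
proof (induction "degree Q" arbitrary: Q R)
  case 0
  from 0(1)[symmetric] obtain q where q: "Q = [:q:]" by (rule degree_eq_zeroE)
  then have "R = Q * smult (1 / q) R" using 0(2) by simp
  then show ?case by (rule dvdI)
next
  case (Suc n)
  then have "\<not> constant (poly Q)" by (simp add: constant_degree)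
  then obtain b where b: "poly Q b = 0" using fundamental_theorem_of_algebra by blast
  define t where "t = [:-b, 1:]"
  have t: "pderiv t = 1" "poly t c = c - b" "t \<noteq> 0" "degree t = 1" for c
    by (simp_all add: t_def pderiv_pCons)
  obtain Q1 where Q: "Q = t * Q1" using b by (auto simp: t_def poly_eq_0_iff_dvd)
  obtain R1 where R: "R = t * R1" using Suc.prems(3)[OF b] by (auto simp: t_def poly_eq_0_iff_dvd)
  have Q1: "Q1 \<noteq> 0" "degree Q1 = n" using Suc.prems(1) Suc.hyps(2) t by (auto simp: Q degree_mult_eq)
  have b1: "poly Q1 b \<noteq> 0"
    using Suc.prems(2)[OF b] by (simp add: Q pderiv_mult t)
  have "Q1 dvd R1"
  proof (rule Suc.hyps(1))
    fix c assume c: "poly Q1 c = 0"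
    then have "c \<noteq> b" using b1 by auto
    moreover have "poly Q c = 0" using c by (simp add: Q)
    ultimately show "poly (pderiv Q1) c \<noteq> 0" "poly R1 c = 0"
      using Suc.prems(2)[of c] Suc.prems(3)[of c] c by (simp_all add: Q R pderiv_mult t)
  qed (use Q1 in simp_all)
  then show ?case by (simp add: Q R)
qed

lemma interpolation:
  fixes c :: "'a::field \<Rightarrow> 'a"
  assumes "finite S" shows "\<exists>e. \<forall>b\<in>S. poly e b = c b"
  using assms
proof (induction S rule: finite_induct)
  case (insert s S)
  then obtain e where e: "\<forall>b\<in>S. poly e b = c b" by blast
  define q where "q = (\<Prod>b\<in>S. [:-b, 1:])"
  have q: "poly q b = 0" if "b \<in> S" for b using that insert.hyps by (auto simp: q_def poly_prod)
  have "poly q s \<noteq> 0" using insert.hyps by (auto simp: q_def poly_prod)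
  then have "\<forall>b\<in>insert s S. poly (e + smult ((c s - poly e s) / poly q s) q) b = c b"
    using e q by auto
  then show ?case by blast
qed simp

section \<open>The plane model P(z, y) = 0 and its unramified places\<close>

locale integral_generator = differential_function_field +
  fixes y :: 'a and P :: "complex poly poly"
  assumes monic: "lead_coeff P = 1" and ev_P: "ev P y = 0"
    and P_dvd: "\<And>G. ev G y = 0 \<Longrightarrow> P dvd G" and gen_y: "gen y = UNIV"
begin

abbreviation fiber :: "complex \<Rightarrow> complex poly poly \<Rightarrow> complex poly" where
  "fiber a G \<equiv> map_poly (\<lambda>p. poly p a) G"

lemma degree_P: "degree P > 0"
proof (rule ccontr)
  assume "\<not> degree P > 0"
  then have "degree P = 0" by simp
  then obtain c where "P = [:c:]" by (rule degree_eq_zeroE)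
  then have "P = 1" using monic by (simp add: one_pCons)
  then show False using ev_P by simp
qed

lemma reduce: "\<exists>H. ev H y = ev G y \<and> degree H < degree P"
proof -
  obtain Q R where QR: "G = P * Q + R" "R = 0 \<or> degree R < degree P"
    using monic_division[OF monic] by blast
  then have "ev R y = ev G y" by (simp add: hom_distribs ev_P)
  moreover have "degree R < degree P" using QR(2) degree_P by auto
  ultimately show ?thesis by blast
qed

lemma ev_unique: assumes "ev G y = 0" "degree G < degree P" shows "G = 0"
  using dvd_imp_degree_le[OF P_dvd[OF assms(1)]] assms(2) by fastforce

lemma fiber_hom:
  "poly (fiber a (G + H)) b = poly (fiber a G) b + poly (fiber a H) b"
  "poly (fiber a (G - H)) b = poly (fiber a G) b - poly (fiber a H) b"
  "poly (fiber a (G * H)) b = poly (fiber a G) b * poly (fiber a H) b"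
  "fiber a (pderiv G) = pderiv (fiber a G)"
proof -
  interpret m: map_poly_idom_hom "\<lambda>p. poly p a" ..
  show "poly (fiber a (G + H)) b = poly (fiber a G) b + poly (fiber a H) b"
    "poly (fiber a (G - H)) b = poly (fiber a G) b - poly (fiber a H) b"
    "poly (fiber a (G * H)) b = poly (fiber a G) b * poly (fiber a H) b"
    "fiber a (pderiv G) = pderiv (fiber a G)"
    by (simp_all add: m.hom_add m.hom_minus m.hom_mult poly_hom.map_poly_pderiv)
qed

text \<open>The place lies over the point (a, b) of the plane curve, and order 1 of z - a means that
  it is unramified over z = a. The case y = b is separate because v(0) = 0 by convention.\<close>

definition point_place :: "complex \<Rightarrow> complex \<Rightarrow> ('a \<Rightarrow> int) \<Rightarrow> bool" where
  "point_place a b v \<longleftrightarrow> v \<in> places emb \<and> v (pe [:-a, 1:]) = 1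
     \<and> (y = const_emb emb b \<or> 1 \<le> v (y - const_emb emb b))"

text \<open>Hensel lifts b to a root \<eta> of P in C[[z - a]]. Every relation of y is a multiple of
  P and so holds for \<eta>; therefore y \<mapsto> \<eta> extends to an embedding of K into C((z -
  a)). The place is the order of the image.\<close>

lemma point_place_exists:
  assumes root: "poly (fiber a P) b = 0" and simple: "poly (pderiv (fiber a P)) b \<noteq> 0"
  shows "\<exists>v. point_place a b v"
proof -
  \<comment> \<open>The Taylor expansion of p at \<open>a\<close>: the power series variable stands
    for z - a.\<close>
  define h :: "complex poly \<Rightarrow> complex fps" where "h p = fps_of_poly (pcompose p [:a, 1:])" for p
  have h_eq_0: "h p = 0 \<longleftrightarrow> p = 0" for p
    using fps_of_poly_eq_iff[of "pcompose p [:a, 1:]" 0] pcompose_eq_0[of p "[:a, 1:]"]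
    by (auto simp: h_def)
  interpret h: inj_idom_hom h
    by unfold_locales
      (simp_all add: h_eq_0, simp_all add: h_def pcompose_add pcompose_mult fps_of_poly_add
        fps_of_poly_mult pcompose_1)
  interpret mh: map_poly_inj_idom_hom h ..
  have "map_poly (\<lambda>f. fps_nth f 0) (map_poly h P) = fiber a P"
    by (rule poly_eqI) (simp add: coeff_map_poly h_def)
  then obtain \<eta> where \<eta>: "fps_nth \<eta> 0 = b" "poly (map_poly h P) \<eta> = 0"
    using fps_hensel[of "map_poly h P" b] root simple by auto
  define E where "E G = fps_to_fls (poly (map_poly h G) \<eta>)" for G
  define k where "k p = fps_to_fls (h p)" for p
  have E: "E (G + H) = E G + E H" "E (G * H) = E G * E H" "E (smult p G) = k p * E G"
    "E (G - H) = E G - E H" "E [:p:] = k p" "E 0 = 0" "E 1 = 1" "E [:0, 1:] = fps_to_fls \<eta>" for G H p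
    by (simp_all add: E_def k_def hom_distribs fps_to_fls_plus fps_to_fls_minus fls_times_fps_to_fls)
  have k: "k (p * q) = k p * k q" "k 1 = 1" "k p = 0 \<longleftrightarrow> p = 0" for p q
    by (simp_all add: k_def h.hom_mult fls_times_fps_to_fls)
  have "E P = 0" using \<eta>(2) by (simp add: E_def)
  then have E0: "E G = 0" if "ev G y = 0" for G
    using P_dvd[OF that] E(2) by (auto simp: dvd_def)
  \<comment> \<open>By \<open>gen_y\<close> every x is a fraction G(y)/q; \<open>\<phi>_eq\<close>
    shows that the value does not depend on which one is chosen.\<close>
  define \<phi> where "\<phi> x = (SOME f. \<exists>q G. q \<noteq> 0 \<and> pe q * x = ev G y \<and> f = E G / k q)" for x
  have \<phi>_eq: "\<phi> x = E G / k q" if q: "q \<noteq> 0" "pe q * x = ev G y" for x q G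
  proof -
    have "\<exists>r H. r \<noteq> 0 \<and> pe r * x = ev H y \<and> \<phi> x = E H / k r"
      unfolding \<phi>_def by (rule someI_ex) (use q in blast)
    then obtain r H where r: "r \<noteq> 0" "pe r * x = ev H y" "\<phi> x = E H / k r" by blast
    have "ev (smult r G - smult q H) y = pe r * (pe q * x) - pe q * (pe r * x)"
      by (simp add: ev.hom_minus ev_smult q r)
    then have "E (smult r G - smult q H) = 0" by (intro E0) simp
    then have "k r * E G = k q * E H" by (simp add: E)
    then show ?thesis using q(1) r(1) by (simp add: r(3) k frac_eq_eq mult.commute)
  qed
  have repr: "\<exists>q G. q \<noteq> 0 \<and> pe q * x = ev G y" for x
    using genE[of x y] gen_y by blast
  have \<phi>_ev: "\<phi> (ev G y) = E G" for G
    using \<phi>_eq[of 1 "ev G y" G] by (simp add: k)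
  interpret \<phi>: field_hom \<phi>
  proof unfold_locales
    show "\<phi> 0 = 0" "\<phi> 1 = 1" using \<phi>_ev[of 0] \<phi>_ev[of 1] by (simp_all add: E)
    fix x x'
    obtain q G where q: "q \<noteq> 0" "pe q * x = ev G y" using repr by blast
    obtain r H where r: "r \<noteq> 0" "pe r * x' = ev H y" using repr by blast
    have "pe (q * r) * (x + x') = pe r * (pe q * x) + pe q * (pe r * x')"
      by (simp add: pe.hom_mult algebra_simps)
    then have "pe (q * r) * (x + x') = ev (smult r G + smult q H) y"
      by (simp add: q r ev.hom_add ev_smult)
    then show "\<phi> (x + x') = \<phi> x + \<phi> x'"
      using q r by (simp add: \<phi>_eq[of "q * r"] \<phi>_eq[OF q] \<phi>_eq[OF r] E k add_frac_eq mult.commute)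
    have "pe (q * r) * (x * x') = (pe q * x) * (pe r * x')" by (simp add: pe.hom_mult)
    then have "pe (q * r) * (x * x') = ev (G * H) y" by (simp add: q r ev.hom_mult)
    then show "\<phi> (x * x') = \<phi> x * \<phi> x'"
      using q r by (simp add: \<phi>_eq[of "q * r"] \<phi>_eq[OF q] \<phi>_eq[OF r] E k)
  qed
  have \<phi>_nz: "\<phi> x \<noteq> 0" if "x \<noteq> 0" for x
  proof
    assume "\<phi> x = 0"
    then have "\<phi> (x * inverse x) = 0" by (simp add: \<phi>.hom_mult)
    then show False using that by simp
  qed
  have \<phi>_pe: "\<phi> (pe p) = k p" for p using \<phi>_ev[of "[:p:]"] by (simp add: E)
  have k_const: "k [:c:] = fls_const c" for c by (simp add: k_def h_def fps_of_poly_const)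
  have "h [:-a, 1:] = fps_X" by (simp add: h_def pcompose_pCons fps_of_poly_pCons)
  then have k_t: "k [:-a, 1:] = fls_X" by (simp add: k_def)
  define v where "v x = fls_subdegree (\<phi> x)" for x
  have vt: "v (pe [:-a, 1:]) = 1" by (simp add: v_def \<phi>_pe k_t)
  have "v \<in> places emb"
    unfolding places_def
  proof (intro CollectI conjI allI impI)
    show "v 0 = 0" by (simp add: v_def)
    show "v (x * x') = v x + v x'" if "x \<noteq> 0" "x' \<noteq> 0" for x x'
      using \<phi>_nz that by (simp add: v_def \<phi>.hom_mult)
    show "min (v x) (v x') \<le> v (x + x')" if "x + x' \<noteq> 0" for x x'
      using fls_plus_subdegree[of "\<phi> x" "\<phi> x'"] \<phi>_nz[OF that] by (simp add: v_def \<phi>.hom_add)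
    show "v (const_emb emb c) = 0" for c by (simp add: v_def const_emb_eq \<phi>_pe k_const)
    show "\<exists>x. x \<noteq> 0 \<and> v x = 1" using vt by (intro exI[of _ "pe [:-a, 1:]"]) simp
  qed
  moreover have "y = const_emb emb b \<or> 1 \<le> v (y - const_emb emb b)"
  proof (cases "y = const_emb emb b")
    case False
    have "\<phi> y = fps_to_fls \<eta>" using \<phi>_ev[of "[:0, 1:]"] by (simp add: E)
    then have eq: "\<phi> (y - const_emb emb b) = fps_to_fls (\<eta> - fps_const b)"
      by (simp add: \<phi>.hom_minus const_emb_eq \<phi>_pe k_const fps_to_fls_minus)
    have "fls_nth (\<phi> (y - const_emb emb b)) i = 0" if "i < 1" for i
      using that \<eta>(1) unfolding eq by (cases "i = 0") auto
    then have "1 \<le> v (y - const_emb emb b)"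
      unfolding v_def using False by (intro fls_subdegree_geI \<phi>_nz) auto
    then show ?thesis by simp
  qed simp
  ultimately show ?thesis using vt by (auto simp: point_place_def)
qed

end

section \<open>Elimination of poles\<close>

context place
begin

lemma vge_poly_at:
  assumes x: "vge 0 x" "vge 1 (x - kc b)"
  shows "vge 1 (poly (map_poly kc Q) x - kc (poly Q b))"
proof (induction Q)
  case (pCons q Q)
  have "vge 1 (x * (poly (map_poly kc Q) x - kc (poly Q b)))"
    using vge_mult[OF x(1) pCons(2)] by simp
  moreover have "vge 1 ((x - kc b) * kc (poly Q b))"
    using vge_mult[OF x(2) vge_const] by simp
  moreover have "poly (map_poly kc (pCons q Q)) x - kc (poly (pCons q Q) b)
      = x * (poly (map_poly kc Q) x - kc (poly Q b)) + (x - kc b) * kc (poly Q b)"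
    by (simp add: map_kc_pCons algebra_simps)
  ultimately show ?case by (simp only: vge_add)
qed simp

end

context integral_generator
begin

context
  fixes a b v assumes pp: "point_place a b v"
begin

interpretation place emb d v
  by unfold_locales (use pp in \<open>simp add: point_place_def\<close>)

text \<open>These facts are exported from the locale \<open>place\<close> because the places over
  all roots b of one fibre are used together. \<open>point_place_ev\<close> says that G(z, y) has
  residue G(a, b).\<close>

lemma point_place_facts:
  shows point_place_hom: "field_hom (completion emb v)"
    and point_place_t: "completion emb v (pe [:-a, 1:]) \<noteq> 0"
      "fls_subdegree (completion emb v (pe [:-a, 1:])) = 1"
    and point_place_ev: "fls_ge 1 (completion emb v (ev G y) - fls_const (poly (fiber a G) b))"
    and point_place_ev_ge: "fls_ge 0 (completion emb v (ev G y))"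
    and point_place_deriv_ge: "fls_ge 0 g \<Longrightarrow> fls_ge 0 (completion_deriv emb d v g)"
proof -
  show "field_hom (completion emb v)" by (rule \<psi>.field_hom_axioms)
  have vt: "v (pe [:-a, 1:]) = 1" using pp by (simp add: point_place_def)
  then show t: "\<psi> (pe [:-a, 1:]) \<noteq> 0" "fls_subdegree (\<psi> (pe [:-a, 1:])) = 1"
    using \<psi>_subdegree[of "pe [:-a, 1:]"] by auto
  have "pe [:0, 1:] - kc a = pe [:-a, 1:]"
    unfolding const_emb_eq pe.hom_minus[symmetric] by simp
  then have z: "vge 1 (pe [:0, 1:] - kc a)" by (simp add: vge_def vt)
  have y1: "vge 1 (y - kc b)" using pp by (auto simp: point_place_def vge_def)
  have y0: "vge 0 y" using vge_add[OF vge_mono[OF y1] vge_const[of b]] by simp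
  have "vge 1 (ev G y - kc (poly (fiber a G) b))"
    using vge_add[OF reduction_finite[OF z y0, of G] vge_poly_at[OF y0 y1, of "fiber a G"]] by simp
  then show 1: "fls_ge 1 (\<psi> (ev G y) - fls_const (poly (fiber a G) b))"
    unfolding \<psi>_ge[symmetric] by (simp add: \<psi>.hom_minus \<psi>_const)
  show "fls_ge 0 (\<psi> (ev G y))"
    using fls_ge_add[OF fls_ge_mono[OF 1] fls_ge_const[of "poly (fiber a G) b"]] by simp
  show "fls_ge 0 (completion_deriv emb d v g)" if "fls_ge 0 g"
    unfolding completion_deriv by (rule deriv_v_ge[OF vt that])
qed

end

section \<open>Fibres of the plane model and denominators\<close>

lemma roots_finite: "finite {b. poly (fiber a P) b = 0}" and fiber_P: "fiber a P \<noteq> 0"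
  and degree_fiber_P: "degree (fiber a P) = degree P"
proof -
  have lc: "coeff (fiber a P) (degree P) = 1" using monic by (simp add: coeff_map_poly)
  show *: "fiber a P \<noteq> 0"
  proof
    assume "fiber a P = 0"
    from lc[unfolded this] show False by simp
  qed
  have "degree (fiber a P) \<le> degree P" by (rule degree_map_poly_le)
  moreover have "degree P \<le> degree (fiber a P)"
    by (rule le_degree) (simp only: lc, simp)
  ultimately show "degree (fiber a P) = degree P" by simp
  show "finite {b. poly (fiber a P) b = 0}" using * by (rule poly_roots_finite)
qed

text \<open>Denominators are taken relative to C[z][y], which need not be integrally closed. Above
  points where the fibre of P has only simple roots, \<open>has_denominator_if_integral\<close>
  makes up for this.\<close>

definition has_denominator :: "complex poly \<Rightarrow> 'a \<Rightarrow> bool" where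
  "has_denominator h x \<longleftrightarrow> (\<exists>G. pe h * x = ev G y)"

lemma has_denominatorI: "pe h * x = ev G y \<Longrightarrow> has_denominator h x"
  by (auto simp: has_denominator_def)

lemma has_denominator_exists: "\<exists>h. h \<noteq> 0 \<and> has_denominator h x"
  using genE[of x y] gen_y by (metis UNIV_I has_denominatorI)

lemma has_denominator_ev: "has_denominator 1 (ev G y)"
  by (rule has_denominatorI[of _ _ G]) simp

lemma has_denominator_mult:
  assumes "has_denominator g x" "has_denominator h x'" shows "has_denominator (g * h) (x * x')"
proof -
  obtain G H where GH: "pe g * x = ev G y" "pe h * x' = ev H y"
    using assms by (auto simp: has_denominator_def)
  have "pe (g * h) * (x * x') = (pe g * x) * (pe h * x')" by (simp add: pe.hom_mult)
  then show ?thesis unfolding GH ev.hom_mult[symmetric] by (rule has_denominatorI)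
qed

lemma has_denominator_dvd: assumes "has_denominator g x" "g dvd h" shows "has_denominator h x"
proof -
  obtain k where k: "h = g * k" using assms(2) by (rule dvdE)
  have "has_denominator k 1" by (rule has_denominatorI[of _ _ "[:k:]"]) simp
  from has_denominator_mult[OF assms(1) this] show ?thesis by (simp add: k)
qed

lemma has_denominator_add:
  assumes "has_denominator h x" "has_denominator h x'" shows "has_denominator h (x + x')"
proof -
  obtain G H where GH: "pe h * x = ev G y" "pe h * x' = ev H y"
    using assms by (auto simp: has_denominator_def)
  have "pe h * (x + x') = ev (G + H) y" by (simp add: distrib_left GH ev.hom_add)
  then show ?thesis by (rule has_denominatorI)
qed

lemma has_denominator_diff:
  assumes "has_denominator h x" "has_denominator h x'" shows "has_denominator h (x - x')"
proof -
  obtain G H where GH: "pe h * x = ev G y" "pe h * x' = ev H y"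
    using assms by (auto simp: has_denominator_def)
  have "pe h * (x - x') = ev (G - H) y" by (simp add: right_diff_distrib GH ev.hom_minus)
  then show ?thesis by (rule has_denominatorI)
qed

lemma has_denominator_sum:
  assumes "\<And>i. i \<in> I \<Longrightarrow> has_denominator h (x i)" shows "has_denominator h (\<Sum>i\<in>I. x i)"
proof -
  have 0: "has_denominator h 0" by (rule has_denominatorI[of _ _ 0]) simp
  show ?thesis
    using assms 0 by (induction I rule: infinite_finite_induct) (auto intro: has_denominator_add)
qed

lemma has_denominator_deriv:
  assumes f: "has_denominator f (d y)" and x: "has_denominator h x" "h \<noteq> 0"
  shows "has_denominator (f * h ^ 2) (d x)"
proof -
  obtain G where G: "pe h * x = ev G y" using x(1) by (auto simp: has_denominator_def)
  have 1: "has_denominator f (d (ev H y))" for H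
    unfolding d_ev
    using has_denominator_add[OF has_denominator_dvd[OF has_denominator_ev, of f "map_poly pderiv H"]
        has_denominator_dvd[OF has_denominator_mult[OF has_denominator_ev f], of f "pderiv H"]]
    by simp
  have hx: "x = ev G y / pe h" using x(2) G by (simp add: field_simps)
  have "has_denominator f (d (ev G y) * pe h - ev G y * d (pe h))"
  proof (rule has_denominator_diff)
    show "has_denominator f (d (ev G y) * pe h)"
      using has_denominator_mult[OF 1 has_denominator_ev, of G "[:h:]"] by simp
    show "has_denominator f (ev G y * d (pe h))"
      using has_denominator_mult[OF has_denominator_ev 1, of G "[:h:]"] by simp
  qed
  moreover have "pe (f * h ^ 2) * d x = pe f * (d (ev G y) * pe h - ev G y * d (pe h))"
    unfolding hx using x(2) by (subst d_divide) (simp_all add: pe.hom_mult pe.hom_power)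
  ultimately show ?thesis by (auto simp: has_denominator_def)
qed

text \<open>\<open>f\<close> replaces the discriminant. That f/P_Y(y) lies in C[z][y] means f = W
  P_Y + P U for some polynomials W and U. At a point (a, b) of the curve this reads f(a) = W(a, b)
  P_Y(a, b).\<close>

lemma simple_roots:
  assumes f: "has_denominator f (1 / ev (pderiv P) y)" and a: "poly f a \<noteq> 0"
    and b: "poly (fiber a P) b = 0"
  shows "poly (pderiv (fiber a P)) b \<noteq> 0"
proof -
  have "pderiv P \<noteq> 0" "degree (pderiv P) < degree P"
    using degree_P by (simp_all add: pderiv_eq_0_iff degree_pderiv)
  then have nz: "ev (pderiv P) y \<noteq> 0" using ev_unique by blast
  obtain W where "pe f * (1 / ev (pderiv P) y) = ev W y" using f by (auto simp: has_denominator_def)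
  then have "pe f = ev W y * ev (pderiv P) y" using nz by (simp add: field_simps)
  then have "ev ([:f:] - W * pderiv P) y = 0" by (simp add: ev.hom_minus ev.hom_mult)
  then obtain U where U: "[:f:] - W * pderiv P = P * U" using P_dvd by (auto elim: dvdE)
  have "poly (fiber a ([:f:] - W * pderiv P)) b = 0"
    unfolding U fiber_hom b by simp
  then have "poly f a = poly (fiber a W) b * poly (pderiv (fiber a P)) b"
    by (simp add: fiber_hom Polynomial.map_poly_pCons)
  then show ?thesis using a by auto
qed

section \<open>Poles above a single point\<close>

context
  fixes a :: complex and V :: "complex \<Rightarrow> 'a \<Rightarrow> int"
  assumes simple: "\<And>b. poly (fiber a P) b = 0 \<Longrightarrow> poly (pderiv (fiber a P)) b \<noteq> 0"
    and V: "\<And>b. poly (fiber a P) b = 0 \<Longrightarrow> point_place a b (V b)"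
begin

text \<open>The leading coefficients of the poles of order k+1 are removed at all places above
  \<open>a\<close> at once. The places are separated by the values b of y, so interpolation gives a
  polynomial e over C with the prescribed values e(b), and e(y)/(z-a)^(k+1) has the required leading
  coefficients. What remains has poles of order at most k.\<close>

lemma approximate_principal_parts:
  assumes "\<And>b. poly (fiber a P) b = 0 \<Longrightarrow> fls_ge (- int k) (u b)"
  shows "\<exists>G. \<forall>b. poly (fiber a P) b = 0 \<longrightarrow>
    fls_ge 0 (u b - completion emb (V b) (ev G y / pe [:-a, 1:] ^ k))"
  using assms
proof (induction k arbitrary: u)
  case 0
  have "fls_ge 0 (u b - completion emb (V b) (ev 0 y / pe [:-a, 1:] ^ 0))"
    if b: "poly (fiber a P) b = 0" for b
  proof -
    interpret \<psi>: field_hom "completion emb (V b)" using point_place_hom[OF V[OF b]] .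
    show ?thesis using 0[OF b] by simp
  qed
  then show ?case by blast
next
  case (Suc k)
  define s where "s = pe [:-a, 1:]"
  have s: "s \<noteq> 0" by (simp add: s_def)
  define c where "c b = fls_nth (completion emb (V b) s ^ Suc k * u b) 0" for b
  obtain e where e: "\<forall>b\<in>{b. poly (fiber a P) b = 0}. poly e b = c b"
    using interpolation[OF roots_finite] by blast
  define E where "E = map_poly (\<lambda>c. [:c:]) e"
  have fE: "fiber a E = e" unfolding E_def by (rule poly_eqI) (simp add: coeff_map_poly)
  define u' where "u' b = u b - completion emb (V b) (ev E y / s ^ Suc k)" for b
  have u': "fls_ge (- int k) (u' b)" if b: "poly (fiber a P) b = 0" for b
  proof -
    interpret \<psi>: field_hom "completion emb (V b)" using point_place_hom[OF V[OF b]] .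
    define \<tau> where "\<tau> = completion emb (V b) s"
    have \<tau>: "\<tau> \<noteq> 0" "fls_subdegree \<tau> = 1"
      using point_place_t[OF V[OF b]] by (simp_all add: \<tau>_def s_def)
    have u: "fls_ge 0 (\<tau> ^ Suc k * u b)"
      using fls_ge_mult[OF _ Suc.prems[OF b], of "int (Suc k)" "\<tau> ^ Suc k"] \<tau>
      by (simp add: fls_ge_iff[of "int (Suc k)"] fls_subdegree_pow del: power_Suc of_nat_Suc)
    have 1: "fls_ge 1 (\<tau> ^ Suc k * u b - fls_const (c b))"
      using u by (auto simp: fls_ge_def c_def \<tau>_def simp del: power_Suc)
    have 2: "fls_ge 1 (completion emb (V b) (ev E y) - fls_const (c b))"
      using point_place_ev[OF V[OF b], of E] e b by (simp add: fE)
    have "fls_ge 1 (\<tau> ^ Suc k * u b - completion emb (V b) (ev E y))"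
      using fls_ge_diff[OF 1 2] by (simp del: power_Suc)
    from fls_ge_divide[OF this, of "\<tau> ^ Suc k"]
    have "fls_ge (- int k) ((\<tau> ^ Suc k * u b - completion emb (V b) (ev E y)) / \<tau> ^ Suc k)"
      using \<tau> by (simp add: fls_subdegree_pow del: power_Suc)
    also have "(\<tau> ^ Suc k * u b - completion emb (V b) (ev E y)) / \<tau> ^ Suc k = u' b"
      using \<tau>(1) unfolding u'_def diff_divide_distrib \<psi>.hom_div \<psi>.hom_power \<tau>_def[symmetric] by simp
    finally show ?thesis .
  qed
  obtain G where G: "\<forall>b. poly (fiber a P) b = 0 \<longrightarrow>
      fls_ge 0 (u' b - completion emb (V b) (ev G y / s ^ k))"
    using Suc.IH[of u', OF u'] unfolding s_def by blast
  have eq: "ev (E + smult [:-a, 1:] G) y / s ^ Suc k = ev E y / s ^ Suc k + ev G y / s ^ k"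
    using s by (simp add: ev.hom_add ev_smult add_divide_distrib flip: s_def)
  have "fls_ge 0 (u b - completion emb (V b) (ev (E + smult [:-a, 1:] G) y / s ^ Suc k))"
    if b: "poly (fiber a P) b = 0" for b
  proof -
    interpret \<psi>: field_hom "completion emb (V b)" using point_place_hom[OF V[OF b]] .
    show ?thesis using G b unfolding eq \<psi>.hom_add u'_def by (simp add: algebra_simps)
  qed
  then show ?case unfolding s_def by blast
qed

text \<open>G(a, Y) vanishes at all roots of P(a, Y). These are simple, so P(a, Y) divides G(a, Y),
  which has smaller degree and is therefore 0. Thus z - a divides every coefficient of G.\<close>

lemma divisible_if_vanishing:
  assumes "degree G < degree P"
    "\<And>b. poly (fiber a P) b = 0 \<Longrightarrow> fls_ge 1 (completion emb (V b) (ev G y))"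
  shows "\<exists>H. G = smult [:-a, 1:] H"
proof -
  have "poly (fiber a G) b = 0" if b: "poly (fiber a P) b = 0" for b
  proof -
    have "fls_ge 1 (fls_const (poly (fiber a G) b))"
      using fls_ge_diff[OF assms(2)[OF b] point_place_ev[OF V[OF b], of G]] by simp
    from this[unfolded fls_ge_def, rule_format, of 0] show ?thesis by simp
  qed
  then have "fiber a P dvd fiber a G"
    using fiber_P simple by (intro dvd_if_vanishes_on_simple_roots) auto
  moreover have "degree (fiber a G) < degree (fiber a P)"
    using degree_map_poly_le[of "\<lambda>p. poly p a" G] assms(1) by (simp add: degree_fiber_P)
  ultimately have 0: "fiber a G = 0" using dvd_imp_degree_le not_less by blast
  have "poly (coeff G i) a = coeff (fiber a G) i" for i by (simp add: coeff_map_poly)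
  then have "poly (coeff G i) a = 0" for i unfolding 0 by simp
  then show ?thesis
    by (rule extract_root)
qed

text \<open>After reduction modulo P the numerator has degree below that of P and vanishes at all
  places above \<open>a\<close>, so a factor z - a cancels. This is repeated s times.\<close>

lemma has_denominator_if_integral:
  assumes "has_denominator ([:-a, 1:] ^ s * h) x"
    and int: "\<And>b. poly (fiber a P) b = 0 \<Longrightarrow> fls_ge 0 (completion emb (V b) x)"
  shows "has_denominator h x"
  using assms(1)
proof (induction s)
  case (Suc s)
  then obtain G0 where G0: "pe ([:-a, 1:] ^ Suc s * h) * x = ev G0 y"
    by (auto simp: has_denominator_def)
  obtain G where G: "ev G y = ev G0 y" "degree G < degree P" using reduce by blast
  have "fls_ge 1 (completion emb (V b) (ev G y))" if b: "poly (fiber a P) b = 0" for b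
  proof -
    interpret \<psi>: field_hom "completion emb (V b)" using point_place_hom[OF V[OF b]] .
    have "ev G y = pe [:-a, 1:] * (ev [:[:-a, 1:] ^ s * h:] y * x)"
      unfolding G(1) G0[symmetric] by (simp add: pe.hom_mult mult.assoc del: mult_pCons_left)
    moreover have "fls_ge 1 (completion emb (V b) (pe [:-a, 1:]))"
      using point_place_t[OF V[OF b]] by (simp add: fls_ge_iff)
    moreover have "fls_ge 0 (completion emb (V b) (ev [:[:-a, 1:] ^ s * h:] y * x))"
      unfolding \<psi>.hom_mult
      using fls_ge_mult[OF point_place_ev_ge[OF V[OF b]] int[OF b], of "[:[:-a, 1:] ^ s * h:]"] by simp
    ultimately show ?thesis using fls_ge_mult[of 1 _ 0] by (simp add: \<psi>.hom_mult)
  qed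
  then obtain H where "G = smult [:-a, 1:] H" using divisible_if_vanishing[OF G(2)] by blast
  then have "pe [:-a, 1:] * (pe ([:-a, 1:] ^ s * h) * x) = pe [:-a, 1:] * ev H y"
    using G0 G(1) by (simp add: ev_smult pe.hom_mult mult.assoc del: mult_pCons_left)
  then have "pe ([:-a, 1:] ^ s * h) * x = ev H y" by simp
  then show ?case using Suc.IH by (blast intro: has_denominatorI)
qed simp

end

end

section \<open>Connections over K and their local solutions\<close>

context differential_function_field
begin

definition nabla :: "nat \<Rightarrow> (nat \<Rightarrow> nat \<Rightarrow> 'k) \<Rightarrow> (nat \<Rightarrow> 'k) \<Rightarrow> nat \<Rightarrow> 'k" where
  "nabla r A x i = d (x i) + (\<Sum>j<r. A i j * x j)"

definition locally_solvable ::
  "nat \<Rightarrow> (nat \<Rightarrow> nat \<Rightarrow> 'k) \<Rightarrow> (nat \<Rightarrow> 'k) \<Rightarrow> ('k \<Rightarrow> int) \<Rightarrow> bool" where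
  "locally_solvable r A m v \<longleftrightarrow> (\<exists>u. \<forall>i<r. completion emb v (m i) =
    completion_deriv emb d v (u i) + (\<Sum>j<r. completion emb v (A i j) * u j))"

lemma nabla_add: "nabla r A (\<lambda>i. x i + y i) i = nabla r A x i + nabla r A y i"
  by (simp add: nabla_def d_add distrib_left sum.distrib)

lemma nabla_scale: "nabla r A (\<lambda>i. const_emb emb c * x i) i = const_emb emb c * nabla r A x i"
  by (simp add: nabla_def d_mult d_const distrib_left sum_distrib_left mult.left_commute)

lemma nabla_0: "nabla r A (\<lambda>_. 0) i = 0"
  by (simp add: nabla_def)

lemma nabla_sum: "nabla r A (\<lambda>i. \<Sum>l\<in>L. x l i) i = (\<Sum>l\<in>L. nabla r A (x l) i)"
  by (induction L rule: infinite_finite_induct) (simp_all add: nabla_0 nabla_add)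

end

context place
begin

lemma nabla_difference:
  assumes "\<psi> (m i) = completion_deriv emb d v (u i) + (\<Sum>j<r. \<psi> (A i j) * u j)"
  shows "\<psi> (m i - nabla r A x i) =
    completion_deriv emb d v (u i - \<psi> (x i)) + (\<Sum>j<r. \<psi> (A i j) * (u j - \<psi> (x j)))"
  using assms unfolding completion_deriv
  by (simp add: nabla_def \<psi>.hom_minus \<psi>.hom_add \<psi>.hom_sum \<psi>.hom_mult deriv_v_diff deriv_v_\<psi>
      right_diff_distrib sum_subtractf)

lemma locally_solvable_diff:
  assumes "locally_solvable r A m v"
  shows "locally_solvable r A (\<lambda>i. m i - nabla r A x i) v"
proof -
  obtain u where u: "\<And>i. i < r \<Longrightarrow>
      \<psi> (m i) = completion_deriv emb d v (u i) + (\<Sum>j<r. \<psi> (A i j) * u j)"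
    using assms unfolding locally_solvable_def by blast
  show ?thesis
    unfolding locally_solvable_def
    by (intro exI[of _ "\<lambda>i. u i - \<psi> (x i)"] allI impI nabla_difference u)
qed

end

lemma fls_common_bound:
  fixes g :: "'i \<Rightarrow> 'b::zero fls"
  assumes "finite S" shows "\<exists>k. \<forall>x\<in>S. fls_ge (- int k) (g x)"
proof (intro exI ballI)
  fix x assume "x \<in> S"
  then have "nat (- fls_subdegree (g x)) \<le> (\<Sum>x\<in>S. nat (- fls_subdegree (g x)))"
    using assms by (intro member_le_sum) auto
  then show "fls_ge (- int (\<Sum>x\<in>S. nat (- fls_subdegree (g x)))) (g x)"
    unfolding fls_ge_iff by linarith
qed

context integral_generator
begin

lemma eliminate_poles_at:
  assumes f: "f \<noteq> 0" "has_denominator f (d y)" "has_denominator f (1 / ev (pderiv P) y)"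
    and A: "\<And>i j. i < r \<Longrightarrow> j < r \<Longrightarrow> has_denominator f (A i j)"
    and loc: "\<And>v. v \<in> places emb \<Longrightarrow> locally_solvable r A m v"
    and a: "poly f a \<noteq> 0"
    and m: "\<And>i. i < r \<Longrightarrow> has_denominator (f ^ k * ([:-a, 1:] ^ s * h)) (m i)"
  shows "\<exists>x. \<forall>i<r. has_denominator (f ^ Suc k * h) (m i - nabla r A x i)"
proof -
  let ?R = "{b. poly (fiber a P) b = 0}"
  have simple: "poly (pderiv (fiber a P)) b \<noteq> 0" if "poly (fiber a P) b = 0" for b
    using simple_roots[OF f(3) a that] .
  define V where "V b = (SOME v. point_place a b v)" for b
  have V: "point_place a b (V b)" if "poly (fiber a P) b = 0" for b
    using someI_ex[OF point_place_exists[OF that simple[OF that]]] by (simp add: V_def)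
  have VP: "V b \<in> places emb" if "poly (fiber a P) b = 0" for b
    using V[OF that] by (simp add: point_place_def)
  have "\<forall>b\<in>?R. \<exists>u. \<forall>i<r. completion emb (V b) (m i) =
      completion_deriv emb d (V b) (u i) + (\<Sum>j<r. completion emb (V b) (A i j) * u j)"
    using loc[OF VP] unfolding locally_solvable_def by blast
  from bchoice[OF this] obtain u where u: "\<And>b i. poly (fiber a P) b = 0 \<Longrightarrow> i < r \<Longrightarrow>
      completion emb (V b) (m i) =
      completion_deriv emb d (V b) (u b i) + (\<Sum>j<r. completion emb (V b) (A i j) * u b j)"
    by auto
  have "finite (?R \<times> {..<r})" using roots_finite by simp
  from fls_common_bound[OF this, of "\<lambda>(b, i). u b i"] obtain K where
    K: "\<And>b i. poly (fiber a P) b = 0 \<Longrightarrow> i < r \<Longrightarrow> fls_ge (- int K) (u b i)"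
    by auto
  have "\<forall>i\<in>{..<r}. \<exists>G. \<forall>b. poly (fiber a P) b = 0 \<longrightarrow>
      fls_ge 0 (u b i - completion emb (V b) (ev G y / pe [:-a, 1:] ^ K))"
    using approximate_principal_parts[where V = V, OF simple V K] by auto
  from bchoice[OF this] obtain G where G: "\<And>i b. i < r \<Longrightarrow> poly (fiber a P) b = 0 \<Longrightarrow>
      fls_ge 0 (u b i - completion emb (V b) (ev (G i) y / pe [:-a, 1:] ^ K))"
    by auto
  define q where "q = [:-a, 1:]"
  have q: "q \<noteq> 0" by (simp add: q_def)
  define x where "x i = ev (G i) y / pe q ^ K" for i
  have x: "has_denominator (q ^ K) (x i)" for i
    using q by (intro has_denominatorI[of _ _ "G i"]) (simp add: x_def pe.hom_power)
  have "has_denominator (f ^ Suc k * h) (m i - nabla r A x i)" if i: "i < r" for i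
  proof -
    \<comment> \<open>A denominator for all terms at once: q^s and h come from m, the square of q^K
      and one factor f from the derivative of x, and one factor f from the entries of
      \<open>A\<close>.\<close>
    let ?e = "q ^ (s + 2 * K) * (f ^ Suc k * h)"
    have "has_denominator ?e (m i)"
    proof (rule has_denominator_dvd[OF m[OF i]])
      have "?e = (f ^ k * (q ^ s * h)) * (q ^ (2 * K) * f)" by (simp add: power_add)
      then show "f ^ k * ([:-a, 1:] ^ s * h) dvd ?e" unfolding q_def[symmetric] by (rule dvdI)
    qed
    moreover have e1: "f * (q ^ K)\<^sup>2 dvd ?e"
    proof -
      have "?e = (f * (q ^ K)\<^sup>2) * (q ^ s * f ^ k * h)" by (simp add: power_add power_mult mult.commute[of 2] mult_ac)
      then show ?thesis by (rule dvdI)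
    qed
    have "has_denominator ?e (d (x i))"
      using has_denominator_deriv[OF f(2) x] q e1 by (intro has_denominator_dvd[OF _ e1]) simp
    moreover have "has_denominator ?e (\<Sum>j<r. A i j * x j)"
    proof (rule has_denominator_sum)
      fix j assume "j \<in> {..<r}"
      then have "has_denominator (f * q ^ K) (A i j * x j)"
        using A[OF i] x by (intro has_denominator_mult) auto
      moreover have "f * q ^ K dvd f * (q ^ K)\<^sup>2" by (simp add: power2_eq_square)
      ultimately show "has_denominator ?e (A i j * x j)"
        using e1 by (meson has_denominator_dvd dvd_trans)
    qed
    ultimately have den: "has_denominator ?e (m i - nabla r A x i)"
      unfolding nabla_def by (intro has_denominator_diff has_denominator_add)
    \<comment> \<open>In the completion, m - nabla x is the connection applied to u - x, which is
      integral by the choice of x. The connection preserves integrality: z is unramified here, and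
      the entries of \<open>A\<close> are integral since f(a) is nonzero.\<close>
    have int: "fls_ge 0 (completion emb (V b) (m i - nabla r A x i))"
      if b: "poly (fiber a P) b = 0" for b
    proof -
      interpret place emb d "V b" by unfold_locales (rule VP[OF b])
      have 1: "fls_ge 0 (u b j - \<psi> (x j))" if "j < r" for j
        using G[OF that b] by (simp add: x_def q_def)
      have A0: "fls_ge 0 (\<psi> (A i j))" if j: "j < r" for j
      proof -
        obtain H where H: "pe f * A i j = ev H y"
          using A[OF i j] by (auto simp: has_denominator_def)
        have "fls_ge 1 (\<psi> (pe f) - fls_const (poly f a))"
          using point_place_ev[OF V[OF b], of "[:f:]"] by (simp add: Polynomial.map_poly_pCons)
        then have "fls_nth (\<psi> (pe f) - fls_const (poly f a)) 0 = 0" by (simp add: fls_ge_def)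
        then have "fls_nth (\<psi> (pe f)) 0 \<noteq> 0" using a by simp
        then have nz: "\<psi> (pe f) \<noteq> 0" and le: "fls_subdegree (\<psi> (pe f)) \<le> 0"
          by (auto intro: fls_subdegree_leI)
        have "fls_ge 0 (\<psi> (pe f))" using point_place_ev_ge[OF V[OF b], of "[:f:]"] by simp
        then have sd: "fls_subdegree (\<psi> (pe f)) = 0" using nz le by (simp add: fls_ge_iff)
        have "\<psi> (pe f) * \<psi> (A i j) = \<psi> (ev H y)" unfolding H[symmetric] \<psi>.hom_mult ..
        then have "\<psi> (A i j) = \<psi> (ev H y) / \<psi> (pe f)" using nz by (simp add: field_simps)
        then show ?thesis
          using fls_ge_divide[OF point_place_ev_ge[OF V[OF b], of H] nz] sd by simp
      qed
      have "fls_ge 0 (completion_deriv emb d (V b) (u b i - \<psi> (x i)))"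
        using point_place_deriv_ge[OF V[OF b] 1[OF i]] .
      moreover have "fls_ge 0 (\<Sum>j<r. \<psi> (A i j) * (u b j - \<psi> (x j)))"
        using fls_ge_mult[OF A0 1] by (intro fls_ge_sum) auto
      ultimately show ?thesis
        unfolding nabla_difference[where m = m and u = "u b" and A = A and r = r, OF u[OF b i]] by (rule fls_ge_add)
    qed
    show ?thesis
      by (rule has_denominator_if_integral[where V = V, OF simple V den[unfolded q_def] int])
  qed
  then show ?thesis by blast
qed

text \<open>Induction on the degree of h. A root shared with f is absorbed by one more power of f.
  Any other root is removed with its full multiplicity by \<open>eliminate_poles_at\<close>, again
  at the cost of a factor f; the difference stays locally solvable, so the induction applies to
  it.\<close>

lemma eliminate_poles:
  assumes f: "f \<noteq> 0" "has_denominator f (d y)" "has_denominator f (1 / ev (pderiv P) y)"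
    and A: "\<And>i j. i < r \<Longrightarrow> j < r \<Longrightarrow> has_denominator f (A i j)"
    and loc: "\<And>v. v \<in> places emb \<Longrightarrow> locally_solvable r A m v"
    and h: "h \<noteq> 0" and m: "\<And>i. i < r \<Longrightarrow> has_denominator (f ^ k * h) (m i)"
  shows "\<exists>x k. \<forall>i<r. has_denominator (f ^ k) (m i - nabla r A x i)"
  using loc h m
proof (induction "degree h" arbitrary: h m k rule: less_induct)
  case less
  show ?case
  proof (cases "degree h = 0")
    case True
    then obtain c where c: "h = [:c:]" by (rule degree_eq_zeroE)
    then have "c \<noteq> 0" using less.prems(2) by simp
    then have "f ^ k = f ^ k * h * [:1 / c:]" by (simp add: c)
    then have "f ^ k * h dvd f ^ k" by (rule dvdI)
    then have "\<forall>i<r. has_denominator (f ^ k) (m i - nabla r A (\<lambda>_. 0) i)"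
      using has_denominator_dvd[OF less.prems(3)] by (simp add: nabla_0)
    then show ?thesis by blast
  next
    case False
    then have "\<not> constant (poly h)" by (simp add: constant_degree)
    then obtain a where a: "poly h a = 0" using fundamental_theorem_of_algebra by blast
    show ?thesis
    proof (cases "poly f a = 0")
      case True
      obtain h1 where h1: "h = [:-a, 1:] * h1" using a by (auto simp: poly_eq_0_iff_dvd elim: dvdE)
      obtain f1 where f1: "f = [:-a, 1:] * f1" using True by (auto simp: poly_eq_0_iff_dvd elim: dvdE)
      have "h1 \<noteq> 0" using less.prems(2) h1 by auto
      moreover from this have "degree h1 < degree h" unfolding h1 by (subst degree_mult_eq) auto
      moreover have "has_denominator (f ^ Suc k * h1) (m i)" if "i < r" for i
      proof (rule has_denominator_dvd[OF less.prems(3)[OF that]])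
        have "f ^ Suc k * h1 = f ^ k * (f * h1)" by simp
        also have "\<dots> = f ^ k * ([:-a, 1:] * f1 * h1)" using f1 by simp
        also have "\<dots> = (f ^ k * h) * f1" unfolding h1 by (simp only: mult_ac)
        finally show "f ^ k * h dvd f ^ Suc k * h1" by (rule dvdI)
      qed
      ultimately show ?thesis using less.hyps[of h1 m "Suc k"] less.prems(1) by blast
    next
      case nz: False
      obtain h1 where h1: "h = [:-a, 1:] ^ order a h * h1" "\<not> [:-a, 1:] dvd h1"
        using order_decomp[OF less.prems(2)] by blast
      have h1_nz: "h1 \<noteq> 0" using h1(2) by auto
      have "order a h > 0" using a less.prems(2) by (simp add: order_root)
      then have deg: "degree h1 < degree h"
        using h1_nz arg_cong[OF h1(1), of degree] by (simp add: degree_mult_eq degree_linear_power)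
      have "has_denominator (f ^ k * ([:-a, 1:] ^ order a h * h1)) (m i)" if "i < r" for i
        using less.prems(3)[OF that] unfolding h1(1)[symmetric] .
      from eliminate_poles_at[where A = A, OF f A less.prems(1) nz this] obtain x where
        x: "\<And>i. i < r \<Longrightarrow> has_denominator (f ^ Suc k * h1) (m i - nabla r A x i)" by blast
      have "locally_solvable r A (\<lambda>i. m i - nabla r A x i) v" if "v \<in> places emb" for v
      proof -
        interpret place emb d v by unfold_locales (rule that)
        show ?thesis by (rule locally_solvable_diff[OF less.prems(1)[OF that]])
      qed
      from less.hyps[OF deg this h1_nz x] obtain x' k' where
        x': "\<And>i. i < r \<Longrightarrow> has_denominator (f ^ k') (m i - nabla r A x i - nabla r A x' i)" by blast
      have "\<forall>i<r. has_denominator (f ^ k') (m i - nabla r A (\<lambda>i. x i + x' i) i)"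
        using x' by (simp add: nabla_add diff_diff_eq)
      then show ?thesis by blast
    qed
  qed
qed

lemma common_denominator_exists:
  assumes "finite S" shows "\<exists>h. h \<noteq> 0 \<and> (\<forall>x\<in>S. has_denominator h x)"
  using assms
proof (induction S rule: finite_induct)
  case empty
  show ?case by (intro exI[of _ 1]) simp
next
  case (insert x S)
  then obtain h where h: "h \<noteq> 0" "\<forall>x\<in>S. has_denominator h x" by blast
  obtain g where g: "g \<noteq> 0" "has_denominator g x" using has_denominator_exists by blast
  have "\<forall>x\<in>insert x S. has_denominator (g * h) x"
    using h(2) g(2) by (auto intro: has_denominator_dvd)
  then show ?case using h(1) g(1) by (intro exI[of _ "g * h"]) simp
qed

section \<open>Restriction of scalars to C(z)\<close>

lemma ev_as_sum: assumes "degree G < degree P" shows "ev G y = (\<Sum>j<degree P. pe (coeff G j) * y ^ j)"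
proof -
  have "ev G y = (\<Sum>j\<le>degree G. pe (coeff G j) * y ^ j)" by (simp add: ev_def poly_altdef)
  also have "\<dots> = (\<Sum>j<degree P. pe (coeff G j) * y ^ j)"
    using assms by (intro sum.mono_neutral_left) (auto simp: coeff_eq_0)
  finally show ?thesis .
qed

lemma has_denominator_coeffs:
  assumes "has_denominator h x"
  shows "\<exists>p. pe h * x = (\<Sum>j<degree P. pe (p j) * y ^ j)"
proof -
  obtain G where "pe h * x = ev G y" using assms by (auto simp: has_denominator_def)
  moreover obtain H where "ev H y = ev G y" "degree H < degree P" using reduce by blast
  ultimately show ?thesis using ev_as_sum by metis
qed

text \<open>In the C(z)-basis y^l of each coordinate the connection has the matrix B/f; the
  derivative of y^j contributes to the diagonal blocks i' = i only. The quotient rule for 1/f^k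
  supplies the remaining terms of \<open>polynomial_connection\<close>.\<close>

lemma nabla_polynomial_connection:
  assumes f: "f \<noteq> 0" and i: "i < r"
    and B: "\<And>i' j. i' < r \<Longrightarrow> j < degree P \<Longrightarrow>
      pe f * (A i i' * y ^ j + (if i' = i then d (y ^ j) else 0)) = (\<Sum>l<degree P. pe (B (i, l) (i', j)) * y ^ l)"
  shows "nabla r A (\<lambda>i. (\<Sum>j<degree P. pe (p (i, j)) * y ^ j) / pe f ^ k) i =
    (\<Sum>l<degree P. pe (polynomial_connection f k ({..<r} \<times> {..<degree P}) B p (i, l)) * y ^ l) / pe f ^ Suc k"
proof -
  let ?n = "degree P" and ?F = "pe f"
  have F: "?F \<noteq> 0" using f by simp
  define Z where "Z i' j = A i i' * y ^ j + (if i' = i then d (y ^ j) else 0)" for i' j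
  \<comment> \<open>The factor f^(k+1) suffices in place of f^(2k), since the derivative of f^k is
    divisible by f^(k-1). \<open>dF\<close> expresses this without a negative exponent at k =
    0.\<close>
  have d1: "d (pe q * y ^ j / ?F ^ k) * ?F ^ Suc k =
      pe (pderiv q * f - of_nat k * (pderiv f * q)) * y ^ j + ?F * (pe q * d (y ^ j))" for q j
  proof -
    have dF: "d (?F ^ k) * ?F = of_nat k * ?F ^ k * pe (pderiv f)"
    proof (induction k)
      case (Suc k)
      have "d (?F ^ Suc k) * ?F = pe (pderiv f) * ?F ^ k * ?F + ?F * (d (?F ^ k) * ?F)"
        by (simp add: d_mult d_pe algebra_simps)
      then show ?case unfolding Suc.IH by (simp add: algebra_simps)
    qed simp
    have "d (pe q * y ^ j / ?F ^ k) * ?F ^ k * ?F ^ k = d (pe q * y ^ j) * ?F ^ k - pe q * y ^ j * d (?F ^ k)"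
      using F by (subst d_divide) (simp_all add: power2_eq_square)
    then have "d (pe q * y ^ j / ?F ^ k) * ?F ^ k * ?F ^ k * ?F =
        (d (pe q * y ^ j) * ?F ^ k - pe q * y ^ j * d (?F ^ k)) * ?F"
      by (rule arg_cong)
    also have "\<dots> = d (pe q * y ^ j) * ?F ^ k * ?F - pe q * y ^ j * (d (?F ^ k) * ?F)"
      by (simp add: algebra_simps)
    finally have "?F ^ k * (d (pe q * y ^ j / ?F ^ k) * ?F ^ Suc k) =
        ?F ^ k * (d (pe q * y ^ j) * ?F - pe q * y ^ j * (of_nat k * pe (pderiv f)))"
      unfolding dF by (simp add: algebra_simps)
    then have "d (pe q * y ^ j / ?F ^ k) * ?F ^ Suc k =
        d (pe q * y ^ j) * ?F - pe q * y ^ j * (of_nat k * pe (pderiv f))"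
      using F by simp
    then show ?thesis
      by (simp add: d_mult d_pe pe.hom_mult pe.hom_minus pe.hom_of_nat algebra_simps)
  qed
  have "nabla r A (\<lambda>i. (\<Sum>j<?n. pe (p (i, j)) * y ^ j) / ?F ^ k) i * ?F ^ Suc k =
      (\<Sum>j<?n. d (pe (p (i, j)) * y ^ j / ?F ^ k) * ?F ^ Suc k)
      + (\<Sum>i'<r. \<Sum>j<?n. ?F * (pe (p (i', j)) * (A i i' * y ^ j)))"
  proof -
    have "A i i' * ((\<Sum>j<?n. pe (p (i', j)) * y ^ j) / ?F ^ k) * ?F ^ Suc k
        = (\<Sum>j<?n. ?F * (pe (p (i', j)) * (A i i' * y ^ j)))" for i'
    proof -
      have e: "A i i' * (S / ?F ^ k) * ?F ^ Suc k = ?F * A i i' * S" for S using F by simp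
      show ?thesis unfolding e by (simp add: sum_distrib_left mult_ac)
    qed
    then show ?thesis
      by (simp add: nabla_def sum_divide_distrib d_sum distrib_right sum_distrib_right del: power_Suc)
  qed
  also have "(\<Sum>j<?n. d (pe (p (i, j)) * y ^ j / ?F ^ k) * ?F ^ Suc k) =
      (\<Sum>j<?n. pe (pderiv (p (i, j)) * f - of_nat k * (pderiv f * p (i, j))) * y ^ j)
      + (\<Sum>j<?n. ?F * (pe (p (i, j)) * d (y ^ j)))"
    unfolding d1 sum.distrib ..
  also have "(\<Sum>j<?n. ?F * (pe (p (i, j)) * d (y ^ j)))
      = (\<Sum>i'<r. \<Sum>j<?n. ?F * (pe (p (i', j)) * (if i' = i then d (y ^ j) else 0)))"
  proof -
    have "(\<Sum>i'<r. \<Sum>j<?n. ?F * (pe (p (i', j)) * (if i' = i then d (y ^ j) else 0)))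
        = (\<Sum>i'<r. if i' = i then \<Sum>j<?n. ?F * (pe (p (i, j)) * d (y ^ j)) else 0)"
      by (intro sum.cong refl) simp
    also have "\<dots> = (\<Sum>j<?n. ?F * (pe (p (i, j)) * d (y ^ j)))"
      using i by (subst sum.delta) simp_all
    finally show ?thesis ..
  qed
  also have "(\<Sum>j<?n. pe (pderiv (p (i, j)) * f - of_nat k * (pderiv f * p (i, j))) * y ^ j)
      + (\<Sum>i'<r. \<Sum>j<?n. ?F * (pe (p (i', j)) * (if i' = i then d (y ^ j) else 0)))
      + (\<Sum>i'<r. \<Sum>j<?n. ?F * (pe (p (i', j)) * (A i i' * y ^ j)))
      = (\<Sum>j<?n. pe (pderiv (p (i, j)) * f - of_nat k * (pderiv f * p (i, j))) * y ^ j)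
      + (\<Sum>i'<r. \<Sum>j<?n. pe (p (i', j)) * (?F * Z i' j))"
    unfolding add.assoc sum.distrib[symmetric] Z_def
    by (intro arg_cong2[where f = "(+)"] sum.cong refl) (simp add: algebra_simps)
  also have "(\<Sum>i'<r. \<Sum>j<?n. pe (p (i', j)) * (?F * Z i' j))
      = (\<Sum>i'<r. \<Sum>j<?n. \<Sum>l<?n. pe (B (i, l) (i', j) * p (i', j)) * y ^ l)"
    using B unfolding Z_def
    by (intro sum.cong refl) (simp add: sum_distrib_left pe.hom_mult mult_ac)
  also have "\<dots> = (\<Sum>i'<r. \<Sum>l<?n. \<Sum>j<?n. pe (B (i, l) (i', j) * p (i', j)) * y ^ l)"
    by (rule sum.cong, rule refl, rule sum.swap)
  also have "\<dots> = (\<Sum>l<?n. \<Sum>i'<r. \<Sum>j<?n. pe (B (i, l) (i', j) * p (i', j)) * y ^ l)"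
    by (rule sum.swap)
  also have "\<dots> = (\<Sum>l<?n. pe (\<Sum>x\<in>{..<r} \<times> {..<?n}. B (i, l) x * p x) * y ^ l)"
    by (simp add: pe.hom_sum sum_distrib_right sum.cartesian_product case_prod_unfold)
  finally have "nabla r A (\<lambda>i. (\<Sum>j<?n. pe (p (i, j)) * y ^ j) / ?F ^ k) i * ?F ^ Suc k =
      (\<Sum>l<?n. pe (polynomial_connection f k ({..<r} \<times> {..<?n}) B p (i, l)) * y ^ l)"
    unfolding polynomial_connection_def by (simp add: pe.hom_add distrib_right sum.distrib)
  then show ?thesis using F by (simp only: eq_divide_eq power_not_zero) simp
qed

end

lemma (in differential_function_field) pe_smult: "pe (smult c q) = const_emb emb c * pe q"
proof -
  have "smult c q = [:c:] * q" by simp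
  then show ?thesis unfolding const_emb_eq pe.hom_mult[symmetric] by simp
qed

context integral_generator
begin

text \<open>The bound depends only on \<open>A\<close> and on y: they determine f and e. The poles
  and degrees of the vectors w affect only the level k of the filtration, which does not enter the
  count.\<close>

lemma dependence:
  "\<exists>N::nat. \<forall>w. (\<forall>l\<le>N. \<forall>v\<in>places emb. locally_solvable r A (w l) v) \<longrightarrow>
    (\<exists>c x. (\<exists>l\<le>N. c l \<noteq> 0) \<and> (\<forall>i<r. (\<Sum>l\<le>N. const_emb emb (c l) * w l i) = nabla r A x i))"
proof -
  let ?n = "degree P"
  define Z where "Z = (\<lambda>(i, i', j). A i i' * y ^ j + (if i' = i then d (y ^ j) else 0))"
  let ?T = "{..<r} \<times> {..<r} \<times> {..<?n}"
  \<comment> \<open>f must clear \<open>d y\<close> for derivatives, 1/P_Y(y) for simple fibres, the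
    entries of \<open>A\<close> for regularity, and the values \<open>Z\<close> of the connection on
    the basis y^j for the polynomial matrix B.\<close>
  let ?S = "{d y, 1 / ev (pderiv P) y} \<union> (\<lambda>(i, j). A i j) ` ({..<r} \<times> {..<r}) \<union> Z ` ?T"
  have "finite ?S" by simp
  from common_denominator_exists[OF this] obtain f where
    f0: "f \<noteq> 0" and f: "\<And>x. x \<in> ?S \<Longrightarrow> has_denominator f x" by blast
  have fy: "has_denominator f (d y)" "has_denominator f (1 / ev (pderiv P) y)"
    by (rule f, simp)+
  have fA: "has_denominator f (A i j)" if "i < r" "j < r" for i j
    using that by (intro f) force
  have "\<forall>x\<in>?T. \<exists>p. pe f * Z x = (\<Sum>l<?n. pe (p l) * y ^ l)"
    using f has_denominator_coeffs by simp
  from bchoice[OF this] obtain C where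
    C: "\<And>x. x \<in> ?T \<Longrightarrow> pe f * Z x = (\<Sum>l<?n. pe (C x l) * y ^ l)" by auto
  define B where "B = (\<lambda>(i, l) (i', j). C (i, i', j) l)"
  let ?I = "{..<r} \<times> {..<?n}"
  define e where "e = Suc (degree f + (\<Sum>x\<in>?I. \<Sum>x'\<in>?I. degree (B x x')))"
  have fe: "degree f < e" by (simp add: e_def)
  have Be: "degree (B x x') \<le> e" if "x \<in> ?I" "x' \<in> ?I" for x x'
  proof -
    have "degree (B x x') \<le> (\<Sum>x'\<in>?I. degree (B x x'))"
      using that by (intro member_le_sum) auto
    also have "\<dots> \<le> (\<Sum>x\<in>?I. \<Sum>x'\<in>?I. degree (B x x'))"
      by (rule member_le_sum[OF that(1)]) auto
    finally show ?thesis by (simp add: e_def)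
  qed
  define N where "N = card ?I * (e + 1)"
  show ?thesis
  proof (intro exI[of _ N] allI impI)
    fix w :: "nat \<Rightarrow> nat \<Rightarrow> 'a"
    assume loc: "\<forall>l\<le>N. \<forall>v\<in>places emb. locally_solvable r A (w l) v"
    have "\<forall>l\<in>{..N}. \<exists>xk. \<forall>i<r. has_denominator (f ^ snd xk) (w l i - nabla r A (fst xk) i)"
    proof
      fix l assume l: "l \<in> {..N}"
      have "finite (w l ` {..<r})" by simp
      from common_denominator_exists[OF this] obtain h where
        h: "h \<noteq> 0" "\<And>i. i < r \<Longrightarrow> has_denominator h (w l i)" by auto
      have loc_l: "locally_solvable r A (w l) v" if "v \<in> places emb" for v using loc l that by auto
      have h': "has_denominator (f ^ 0 * h) (w l i)" if "i < r" for i using h(2)[OF that] by simp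
      obtain x k where "\<forall>i<r. has_denominator (f ^ k) (w l i - nabla r A x i)"
        using eliminate_poles[where A = A and m = "w l", OF f0 fy fA loc_l h(1) h'] by blast
      then show "\<exists>xk. \<forall>i<r. has_denominator (f ^ snd xk) (w l i - nabla r A (fst xk) i)"
        by (intro exI[of _ "(x, k)"]) simp
    qed
    from bchoice[OF this] obtain xk where
      xk: "\<And>l i. l \<le> N \<Longrightarrow> i < r \<Longrightarrow> has_denominator (f ^ snd (xk l)) (w l i - nabla r A (fst (xk l)) i)"
      by auto
    define X where "X l = fst (xk l)" for l
    define K where "K = (\<Sum>l\<le>N. snd (xk l))"
    have XK: "has_denominator (f ^ K) (w l i - nabla r A (X l) i)" if "l \<le> N" "i < r" for l i
      unfolding X_def K_def using that
      by (intro has_denominator_dvd[OF xk] le_imp_power_dvd member_le_sum) auto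
    have "\<forall>li\<in>{..N} \<times> {..<r}. \<exists>p. pe (f ^ K) * (w (fst li) (snd li) - nabla r A (X (fst li)) (snd li))
        = (\<Sum>j<?n. pe (p j) * y ^ j)"
      using has_denominator_coeffs[OF XK] by auto
    from bchoice[OF this] obtain W where W: "\<And>l i. l \<le> N \<Longrightarrow> i < r \<Longrightarrow>
        pe (f ^ K) * (w l i - nabla r A (X l) i) = (\<Sum>j<?n. pe (W (l, i) j) * y ^ j)" by auto
    define D where "D = (\<Sum>l\<le>N. \<Sum>(i, j)\<in>?I. degree (W (l, i) j))"
    have WD: "degree (W (l, i) j) \<le> D" if "l \<le> N" "i < r" "j < ?n" for l i j
    proof -
      have "degree (W (l, i) j) \<le> (\<Sum>(i, j)\<in>?I. degree (W (l, i) j))"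
        using that member_le_sum[of "(i, j)" ?I "\<lambda>(i, j). degree (W (l, i) j)"] by simp
      also have "\<dots> \<le> D" unfolding D_def using that by (intro member_le_sum) auto
      finally show ?thesis .
    qed
    \<comment> \<open>The numerators W over f^K have degree at most D. Over f^(k+1) they become
      f^(D+1) W, of degree at most (D+1) deg f + D \<le> (D+1)e \<le> (k+1)e, because deg f < e. The
      exponent is D + 1 because the connection maps level k to level k + 1.\<close>
    define k where "k = K + D"
    define w' where "w' l = (\<lambda>(i, j). f ^ Suc D * W (l, i) j)" for l
    have w': "degree (w' l x) \<le> k * e + e" if l: "l \<in> {..N}" and xI: "x \<in> ?I" for l x
    proof -
      obtain i j where x: "x = (i, j)" "i < r" "j < ?n" using xI by auto
      have "degree (w' l x) \<le> degree (f ^ Suc D) + degree (W (l, i) j)"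
        unfolding w'_def x(1) prod.case by (rule degree_mult_le)
      also have "degree (f ^ Suc D) \<le> degree f * Suc D" by (rule degree_power_le)
      also have "degree (W (l, i) j) \<le> D" using WD l x by simp
      finally have "degree (w' l x) \<le> degree f * Suc D + D" by simp
      also have "\<dots> \<le> Suc (degree f) * Suc D" by simp
      also have "\<dots> \<le> e * Suc D" using fe by (intro mult_le_mono1) simp
      also have "\<dots> \<le> k * e + e" by (simp add: k_def algebra_simps)
      finally show ?thesis .
    qed
    have finJ: "finite ?I" "finite {..N}" "card {..N} > card ?I * (e + 1)" by (auto simp: N_def)
    obtain c p where c0: "\<exists>l\<in>{..N}. c l \<noteq> 0" and
      cp: "\<And>x. x \<in> ?I \<Longrightarrow> (\<Sum>l\<le>N. smult (c l) (w' l x)) = polynomial_connection f k ?I B p x"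
      using polynomial_connection_dependence[where w = w' and k = k and B = B, OF finJ f0 fe Be w'] by blast
    define x' where "x' i = (\<Sum>j<?n. pe (p (i, j)) * y ^ j) / pe f ^ k" for i
    \<comment> \<open>The dependence is found for the vectors after pole elimination, so the
      corrections \<open>X l\<close> are added back with the same coefficients.\<close>
    define x where "x i = (\<Sum>l\<le>N. const_emb emb (c l) * X l i) + x' i" for i
    have F: "pe f \<noteq> 0" using f0 by simp
    have "(\<Sum>l\<le>N. const_emb emb (c l) * w l i) = nabla r A x i" if i: "i < r" for i
    proof -
      have C': "pe f * (A i i' * y ^ j + (if i' = i then d (y ^ j) else 0))
          = (\<Sum>l<?n. pe (B (i, l) (i', j)) * y ^ l)" if "i' < r" "j < ?n" for i' j
        using C[of "(i, i', j)"] i that by (simp add: Z_def B_def)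
      have "nabla r A x' i = (\<Sum>j<?n. pe (polynomial_connection f k ?I B p (i, j)) * y ^ j) / pe f ^ Suc k"
        unfolding x'_def by (rule nabla_polynomial_connection[where A = A and B = B and r = r and i = i, OF f0 i C'])
      also have "(\<Sum>j<?n. pe (polynomial_connection f k ?I B p (i, j)) * y ^ j)
          = (\<Sum>j<?n. pe (\<Sum>l\<le>N. smult (c l) (w' l (i, j))) * y ^ j)"
        using i by (intro sum.cong refl) (simp add: cp)
      also have "\<dots> = (\<Sum>j<?n. \<Sum>l\<le>N. const_emb emb (c l) * (pe f ^ Suc D * (pe (W (l, i) j) * y ^ j)))"
        by (intro sum.cong refl)
          (simp add: pe.hom_sum pe_smult w'_def pe.hom_mult pe.hom_power sum_distrib_left sum_distrib_right mult_ac)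
      also have "\<dots> = (\<Sum>l\<le>N. const_emb emb (c l) * (pe f ^ Suc D * (\<Sum>j<?n. pe (W (l, i) j) * y ^ j)))"
        by (subst sum.swap) (simp add: sum_distrib_left)
      also have "\<dots> = (\<Sum>l\<le>N. const_emb emb (c l) * (w l i - nabla r A (X l) i)) * pe f ^ Suc k"
        unfolding sum_distrib_right
      proof (intro sum.cong refl)
        fix l assume "l \<in> {..N}"
        then have "(\<Sum>j<?n. pe (W (l, i) j) * y ^ j) = pe f ^ K * (w l i - nabla r A (X l) i)"
          using W i by (simp add: pe.hom_power)
        then show "const_emb emb (c l) * (pe f ^ Suc D * (\<Sum>j<?n. pe (W (l, i) j) * y ^ j))
            = const_emb emb (c l) * (w l i - nabla r A (X l) i) * pe f ^ Suc k"
          by (simp add: k_def power_add mult_ac)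
      qed
      finally have "nabla r A x' i = (\<Sum>l\<le>N. const_emb emb (c l) * (w l i - nabla r A (X l) i))"
        using F by simp
      moreover have "nabla r A x i
          = (\<Sum>l\<le>N. const_emb emb (c l) * nabla r A (X l) i) + nabla r A x' i"
        unfolding x_def by (simp only: nabla_add nabla_sum nabla_scale)
      ultimately show ?thesis
        by (simp add: right_diff_distrib sum_subtractf)
    qed
    then show "\<exists>c x. (\<exists>l\<le>N. c l \<noteq> 0) \<and>
        (\<forall>i<r. (\<Sum>l\<le>N. const_emb emb (c l) * w l i) = nabla r A x i)"
      using c0 by blast
  qed
qed

end

lemma (in differential_function_field) local_global_dependence:
  "\<exists>N::nat. \<forall>w. (\<forall>l\<le>N. \<forall>v\<in>places emb. locally_solvable r A (w l) v) \<longrightarrow>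
    (\<exists>c x. (\<exists>l\<le>N. c l \<noteq> 0) \<and> (\<forall>i<r. (\<Sum>l\<le>N. const_emb emb (c l) * w l i) = nabla r A x i))"
proof -
  obtain y P where "lead_coeff P = 1" "ev P y = 0" "\<forall>G. ev G y = 0 \<longrightarrow> P dvd G" "gen y = UNIV"
    using integral_generator by blast
  then interpret integral_generator emb d y P by unfold_locales auto
  show ?thesis by (rule dependence)
qed

section \<open>Quotients of complex vector spaces\<close>

lemma univ_space_simps [simp]:
  "carrier (univ_space sc) = UNIV" "add (univ_space sc) = (+)" "zero (univ_space sc) = 0"
  "module.smult (univ_space sc) = sc"
  by (simp_all add: univ_space_def)

lemma abelian_group_univ_space: "abelian_group (univ_space sc)"
  by (rule abelian_groupI) (auto simp: algebra_simps intro: exI[of _ "- _"] left_minus)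

lemma univ_space_coset: "U +>\<^bsub>univ_space sc\<^esub> x = {u + x | u. u \<in> U}"
  unfolding a_r_coset_def' by auto

text \<open>\<open>sc\<close> is an arbitrary function because the scaling of the free abelian group
  under a tensor product is not a vector space structure. The facts on the additive group of the
  quotient hold in that case too.\<close>

locale subgroup_of_type =
  fixes sc :: "complex \<Rightarrow> 'v \<Rightarrow> 'v::ab_group_add" and U :: "'v set"
  assumes zero_mem: "0 \<in> U" and diff_mem: "\<And>x y. x \<in> U \<Longrightarrow> y \<in> U \<Longrightarrow> x - y \<in> U"
begin

lemma minus_mem: "x \<in> U \<Longrightarrow> - x \<in> U"
  using diff_mem[OF zero_mem] by simp

lemma add_mem: "x \<in> U \<Longrightarrow> y \<in> U \<Longrightarrow> x + y \<in> U"
  using diff_mem[OF _ minus_mem, of x y] by simp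

abbreviation Q :: "(complex, 'v set) module" where "Q \<equiv> quotient_space (univ_space sc) U"

definition coset :: "'v \<Rightarrow> 'v set" where "coset x = {u + x | u. u \<in> U}"

lemma coset_eq: "U +>\<^bsub>univ_space sc\<^esub> x = coset x"
  by (simp add: univ_space_coset coset_def)

lemma mem_coset: "y \<in> coset x \<longleftrightarrow> y - x \<in> U"
  unfolding coset_def by (auto simp: algebra_simps intro: exI[of _ "y - x"])

lemma coset_self: "x \<in> coset x"
  by (simp add: mem_coset zero_mem)

lemma coset_eq_iff: "coset x = coset y \<longleftrightarrow> x - y \<in> U"
proof
  assume "coset x = coset y"
  then show "x - y \<in> U" using coset_self[of x] by (simp add: mem_coset)
next
  assume xy: "x - y \<in> U"
  show "coset x = coset y"
  proof (intro Set.set_eqI)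
    fix z
    have "z - y = (z - x) + (x - y)" "z - x = (z - y) - (x - y)" by simp_all
    then show "z \<in> coset x \<longleftrightarrow> z \<in> coset y"
      unfolding mem_coset using add_mem[OF _ xy] diff_mem[OF _ xy] by metis
  qed
qed

lemma coset_0: "coset 0 = U"
  by (auto simp: mem_coset)

lemma carrier_Q: "carrier Q = range coset"
  by (auto simp: quotient_space_def A_RCOSETS_def' coset_eq)

lemma zero_Q: "zero Q = coset 0"
  by (simp add: quotient_space_def coset_0)

lemma add_Q: "add Q (coset x) (coset y) = coset (x + y)"
proof -
  have "add Q (coset x) (coset y) = {a + b | a b. a \<in> coset x \<and> b \<in> coset y}"
    by (auto simp: quotient_space_def set_add_def')
  also have "\<dots> = coset (x + y)"
  proof (intro Set.set_eqI iffI)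
    fix z assume "z \<in> {a + b | a b. a \<in> coset x \<and> b \<in> coset y}"
    then obtain a b where "z = a + b" "a - x \<in> U" "b - y \<in> U" by (auto simp: mem_coset)
    then show "z \<in> coset (x + y)"
      using add_mem[of "a - x" "b - y"] by (simp add: mem_coset algebra_simps)
  next
    fix z assume "z \<in> coset (x + y)"
    then have "z - y \<in> coset x" by (simp add: mem_coset algebra_simps)
    moreover have "z = (z - y) + y" by simp
    ultimately show "z \<in> {a + b | a b. a \<in> coset x \<and> b \<in> coset y}" using coset_self by blast
  qed
  finally show ?thesis .
qed

lemma abelian_group_Q: "abelian_group Q"
proof (rule abelian_groupI)
  fix X assume "X \<in> carrier Q"
  then obtain x where "X = coset x" by (auto simp: carrier_Q)
  then show "\<exists>Y\<in>carrier Q. Y \<oplus>\<^bsub>Q\<^esub> X = \<zero>\<^bsub>Q\<^esub>"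
    by (intro bexI[of _ "coset (- x)"]) (auto simp: add_Q zero_Q carrier_Q)
qed (auto simp: carrier_Q zero_Q add_Q ac_simps)

lemma smult_Q:
  assumes "\<And>x y. sc c (x + y) = sc c x + sc c y" "\<And>u. u \<in> U \<Longrightarrow> sc c u \<in> U"
  shows "module.smult Q c (coset x) = coset (sc c x)"
proof -
  have diff: "sc c (y - x) = sc c y - sc c x" for y
    using assms(1)[of "y - x" x] by simp
  have "coset (sc c y) = coset (sc c x)" if "y \<in> coset x" for y
    using assms(2)[of "y - x"] that by (simp add: coset_eq_iff mem_coset diff)
  then have "(\<Union>y\<in>coset x. coset (sc c y)) = coset (sc c x)" using coset_self by blast
  then show ?thesis by (simp add: quotient_space_def coset_eq)
qed

lemma induced_map_coset:
  assumes N: "abelian_group N" and W: "additive_subgroup W N"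
    and h: "\<And>x. h x \<in> carrier N" "\<And>x y. h (x + y) = h x \<oplus>\<^bsub>N\<^esub> h y" "\<And>u. u \<in> U \<Longrightarrow> h u \<in> W"
  shows "induced_map N W h (coset x) = W +>\<^bsub>N\<^esub> h x"
proof -
  interpret abelian_subgroup W N by (rule abelian_subgroupI3[OF W N])
  have "W +>\<^bsub>N\<^esub> h y = W +>\<^bsub>N\<^esub> h x" if "y \<in> coset x" for y
  proof -
    have "h y = h ((y - x) + x)" by simp
    also have "\<dots> = h (y - x) \<oplus>\<^bsub>N\<^esub> h x" by (rule h(2))
    finally have "h y = h (y - x) \<oplus>\<^bsub>N\<^esub> h x" .
    moreover have "h (y - x) \<in> W" using that h(3) by (simp add: mem_coset)
    ultimately have "h y \<in> W +>\<^bsub>N\<^esub> h x" by (auto simp: a_r_coset_def')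
    then show ?thesis by (rule a_repr_independence[symmetric, OF _ h(1) a_subgroup])
  qed
  then show ?thesis unfolding induced_map_def using coset_self by blast
qed

lemma induced_map_eq_iff:
  assumes N: "abelian_group N" and W: "additive_subgroup W N"
    and h: "\<And>x. h x \<in> carrier N" "\<And>x y. h (x + y) = h x \<oplus>\<^bsub>N\<^esub> h y" "\<And>u. u \<in> U \<Longrightarrow> h u \<in> W"
  shows "induced_map N W h (coset x) = W \<longleftrightarrow> h x \<in> W"
proof -
  have eq: "induced_map N W h (coset x) = W +>\<^bsub>N\<^esub> h x" 
    by (rule induced_map_coset[where N = N and W = W and h = h, OF N W h])
  have sub: "subgroup W (add_monoid N)" using W by (rule additive_subgroup.a_subgroup)
  show ?thesis
    unfolding eq
  proof
    show "h x \<in> W" if "W +>\<^bsub>N\<^esub> h x = W"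
      using abelian_group.a_coset_join1[OF N that h(1) sub] .
    show "W +>\<^bsub>N\<^esub> h x = W" if "h x \<in> W"
      using abelian_group.a_coset_join2[OF N h(1) sub that] .
  qed
qed

end

text \<open>Take a family in V that is independent modulo U and of maximal length; the dependence
  hypothesis bounds the length by N. Adding any x in V destroys independence, and in the resulting
  relation the coefficient of x cannot vanish.\<close>

lemma finite_codimension:
  fixes sc :: "complex \<Rightarrow> 'v \<Rightarrow> 'v::ab_group_add" and N :: nat
  assumes "vector_space sc" and U: "module.subspace sc U"
    and dep: "\<And>w. (\<And>l. l \<le> N \<Longrightarrow> w l \<in> V) \<Longrightarrow> \<exists>c. (\<exists>l\<le>N. c l \<noteq> 0) \<and> (\<Sum>l\<le>N. sc (c l) (w l)) \<in> U"
  shows "\<exists>(w :: nat \<Rightarrow> 'v) k. (\<forall>l<k. w l \<in> V) \<and> (\<forall>x\<in>V. \<exists>c. x - (\<Sum>l<k. sc (c l) (w l)) \<in> U)"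
proof -
  interpret vector_space sc by fact
  define indep where "indep k w \<longleftrightarrow> (\<forall>l<k. w l \<in> V) \<and>
    (\<forall>c. (\<Sum>l<k. sc (c l) (w l)) \<in> U \<longrightarrow> (\<forall>l<k. c l = 0))" for k :: nat and w
  have bound: "k \<le> N" if "indep k w" for k w
  proof (rule ccontr)
    assume "\<not> k \<le> N"
    then have wV: "w l \<in> V" if "l \<le> N" for l using \<open>indep k w\<close> that by (simp add: indep_def)
    obtain c where c: "\<exists>l\<le>N. c l \<noteq> 0" "(\<Sum>l\<le>N. sc (c l) (w l)) \<in> U" using dep[of w, OF wV] by blast
    \<comment> \<open>A relation among the first N + 1 vectors, continued by zero coefficients to
      all k of them.\<close>
    have "(\<Sum>l<k. sc (if l \<le> N then c l else 0) (w l)) = (\<Sum>l\<le>N. sc (c l) (w l))"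
      using \<open>\<not> k \<le> N\<close> by (intro sum.mono_neutral_cong_right) auto
    then have "(\<Sum>l<k. sc (if l \<le> N then c l else 0) (w l)) \<in> U" using c(2) by simp
    then have "\<forall>l<k. (if l \<le> N then c l else 0) = 0"
      using spec[OF conjunct2[OF \<open>indep k w\<close>[unfolded indep_def]], of "\<lambda>l. if l \<le> N then c l else 0"]
      by (rule rev_mp)
    moreover obtain l where "l \<le> N" "c l \<noteq> 0" using c(1) by blast
    moreover from this have "l < k" using \<open>\<not> k \<le> N\<close> by simp
    ultimately show False by auto
  qed
  define k where "k = Max {k. \<exists>w. indep k w}"
  have fin: "finite {k. \<exists>w. indep k w}"
    by (rule finite_subset[of _ "{..N}"]) (use bound in auto)
  have "indep 0 (\<lambda>_. 0)" by (simp add: indep_def)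
  then have "k \<in> {k. \<exists>w. indep k w}" unfolding k_def using fin by (intro Max_in) auto
  then obtain w where w: "indep k w" by blast
  have "\<exists>c. x - (\<Sum>l<k. sc (c l) (w l)) \<in> U" if x: "x \<in> V" for x
  proof -
    define w' where "w' = w(k := x)"
    have w'_eq: "(\<Sum>l<k. sc (c l) (w' l)) = (\<Sum>l<k. sc (c l) (w l))" for c
      by (intro sum.cong) (auto simp: w'_def)
    have "\<not> indep (Suc k) w'"
    proof
      assume "indep (Suc k) w'"
      then have "Suc k \<le> k" unfolding k_def using fin by (intro Max_ge) auto
      then show False by simp
    qed
    moreover have "w' l \<in> V" if "l < Suc k" for l
      using that x w by (auto simp: w'_def indep_def)
    ultimately obtain c l where c: "(\<Sum>l<Suc k. sc (c l) (w' l)) \<in> U" "l < Suc k" "c l \<noteq> 0"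
      unfolding indep_def by blast
    have sum: "(\<Sum>l<k. sc (c l) (w l)) + sc (c k) x \<in> U"
      using c(1) by (simp add: w'_eq) (simp add: w'_def)
    have "c k \<noteq> 0"
    proof
      assume "c k = 0"
      then have "(\<Sum>l<k. sc (c l) (w l)) \<in> U" using sum by simp
      then have "\<forall>l<k. c l = 0" using w by (simp add: indep_def)
      then show False using c(2,3) \<open>c k = 0\<close> less_Suc_eq by auto
    qed
    have "sc (1 / c k) ((\<Sum>l<k. sc (c l) (w l)) + sc (c k) x) \<in> U"
      using sum by (rule subspace_scale[OF U])
    also have "sc (1 / c k) ((\<Sum>l<k. sc (c l) (w l)) + sc (c k) x)
        = x - (\<Sum>l<k. sc (- c l / c k) (w l))"
      using \<open>c k \<noteq> 0\<close> by (simp add: scale_right_distrib scale_sum_right sum_negf)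
    finally show ?thesis by (intro exI[of _ "\<lambda>l. - c l / c k"])
  qed
  then show ?thesis using w by (intro exI[of _ w] exI[of _ k]) (simp add: indep_def)
qed

lemma restrict_eq_iff: "restrict f I = restrict g I \<longleftrightarrow> (\<forall>i\<in>I. f i = g i)"
proof
  assume eq: "restrict f I = restrict g I"
  show "\<forall>i\<in>I. f i = g i"
  proof
    fix i assume "i \<in> I"
    with fun_cong[OF eq, of i] show "f i = g i" by simp
  qed
next
  assume "\<forall>i\<in>I. f i = g i"
  then show "restrict f I = restrict g I" by (intro restrict_ext) simp
qed

text \<open>The kernel is the set of cosets of V, the elements that satisfy the local conditions, so
  a family spanning V modulo U generates it. The targets enter as abelian groups with subgroups,
  which keeps scalar multiplication on the tensor products out of the argument.\<close>

theorem finite_dimensional_local_global_kernel: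
  fixes sc :: "complex \<Rightarrow> 'v \<Rightarrow> 'v::ab_group_add" and n :: nat
  defines "V \<equiv> \<lambda>I h W. {x. \<forall>i\<in>I. h i x \<in> W i}"
  assumes vs: "vector_space sc" and U: "module.subspace sc U"
    and N: "\<And>i. i \<in> I \<Longrightarrow> abelian_group (N i)"
    and W: "\<And>i. i \<in> I \<Longrightarrow> additive_subgroup (W i) (N i)"
    and h: "\<And>i x. i \<in> I \<Longrightarrow> h i x \<in> carrier (N i)"
      "\<And>i x y. i \<in> I \<Longrightarrow> h i (x + y) = h i x \<oplus>\<^bsub>N i\<^esub> h i y"
      "\<And>i u. i \<in> I \<Longrightarrow> u \<in> U \<Longrightarrow> h i u \<in> W i"
    and V: "module.subspace sc (V I h W)"
    and dep: "\<And>w. (\<And>l. l \<le> n \<Longrightarrow> w l \<in> V I h W) \<Longrightarrow>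
      \<exists>c. (\<exists>l\<le>n. c l \<noteq> 0) \<and> (\<Sum>l\<le>n. sc (c l) (w l)) \<in> U"
  shows "finite_dimensional_complex (local_global_kernel (univ_space sc) U I N W h)"
proof -
  interpret vector_space sc by fact
  interpret U: subgroup_of_type sc U
    by unfold_locales (use subspace_0[OF U] subspace_diff[OF U] in auto)
  let ?L = "local_global_kernel (univ_space sc) U I N W h"
  let ?V = "V I h W"
  have ker: "induced_map (N i) (W i) (h i) (U.coset x) = W i \<longleftrightarrow> h i x \<in> W i" if "i \<in> I" for i x
    by (rule U.induced_map_eq_iff[where N = "N i" and W = "W i" and h = "h i"])
      (rule N[OF that] W[OF that] h[OF that], assumption?)+
  have carrier: "carrier ?L = U.coset ` ?V"
  proof -
    have "carrier ?L = {X \<in> carrier U.Q. (\<lambda>i\<in>I. induced_map (N i) (W i) (h i) X) = (\<lambda>i\<in>I. W i)}"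
      by (simp add: local_global_kernel_def a_kernel_def kernel_def product_space_def)
        (simp add: quotient_space_def)
    also have "\<dots> = {X \<in> carrier U.Q. \<forall>i\<in>I. induced_map (N i) (W i) (h i) X = W i}"
      by (simp only: restrict_eq_iff)
    also have "\<dots> = {U.coset x | x. \<forall>i\<in>I. induced_map (N i) (W i) (h i) (U.coset x) = W i}"
      unfolding U.carrier_Q by blast
    also have "\<dots> = U.coset ` ?V" unfolding V_def using ker by auto
    finally show ?thesis .
  qed
  have zero: "zero ?L = U.coset 0" and add: "add ?L = add U.Q" and smult: "module.smult ?L = module.smult U.Q"
    using U.zero_Q by (simp_all add: local_global_kernel_def)
  note ops = zero add smult U.add_Q
  have sm: "module.smult U.Q c (U.coset x) = U.coset (sc c x)" for c x
    by (rule U.smult_Q) (simp_all add: scale_right_distrib subspace_scale[OF U])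
  have "abelian_group ?L"
  proof (rule abelian_groupI)
    fix X assume "X \<in> carrier ?L"
    then obtain x where x: "X = U.coset x" "x \<in> ?V" by (auto simp: carrier)
    then show "\<exists>Y\<in>carrier ?L. Y \<oplus>\<^bsub>?L\<^esub> X = \<zero>\<^bsub>?L\<^esub>"
      using subspace_neg[OF V] by (intro bexI[of _ "U.coset (- x)"]) (auto simp: carrier ops)
  qed (use subspace_0[OF V] subspace_add[OF V] in \<open>auto simp: carrier ops ac_simps\<close>)
  then have mod: "Module.module class_ring ?L"
  proof (rule moduleI[rotated])
    show "cring (class_ring :: complex ring)" by (rule class_cring.cring_axioms)
  qed (use subspace_scale[OF V] in \<open>auto simp: carrier ops sm class_ring_simps scale_left_distrib scale_right_distrib\<close>)
  then have vs: "vectorspace class_ring ?L"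
    by (simp add: vectorspace_def class_field.field_axioms)
  interpret L: vectorspace class_ring ?L by fact
  have "\<exists>(w :: nat \<Rightarrow> 'v) k. (\<forall>l<k. w l \<in> ?V) \<and> (\<forall>x\<in>?V. \<exists>c. x - (\<Sum>l<k. sc (c l) (w l)) \<in> U)"
    by (rule finite_codimension[where N = n, OF \<open>vector_space sc\<close> U]) (rule dep)
  then obtain w :: "nat \<Rightarrow> 'v" and k where w: "\<forall>l<k. w l \<in> ?V"
    and span: "\<forall>x\<in>?V. \<exists>c. x - (\<Sum>l<k. sc (c l) (w l)) \<in> U"
    by (elim exE conjE) (rule that)
  define S where "S = (\<lambda>l. U.coset (w l)) ` {..<k}"
  have S: "finite S" "S \<subseteq> carrier ?L" using w by (auto simp: S_def carrier)
  have sub: "LinearCombinations.submodule class_ring (L.span S) ?L"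
    using S(2) by (rule L.span_is_submodule)
  have comb: "U.coset (\<Sum>l<m. sc (c l) (w l)) \<in> L.span S" if "m \<le> k" for m c
    using that
  proof (induction m)
    case 0
    then show ?case using sub by (simp add: submodule_def ops)
  next
    case (Suc m)
    have "U.coset (w m) \<in> L.span S"
      using L.in_own_span[OF S(2)] Suc.prems by (auto simp: S_def)
    then have "c m \<odot>\<^bsub>?L\<^esub> U.coset (w m) \<in> L.span S"
      using sub by (simp add: submodule_def class_ring_simps)
    moreover have "U.coset (\<Sum>l<m. sc (c l) (w l)) \<in> L.span S" using Suc by simp
    ultimately have "U.coset (\<Sum>l<m. sc (c l) (w l)) \<oplus>\<^bsub>?L\<^esub> (c m \<odot>\<^bsub>?L\<^esub> U.coset (w m)) \<in> L.span S"
      using sub by (simp add: submodule_def)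
    then show ?case by (simp add: ops sm)
  qed
  have "L.span S = carrier ?L"
  proof
    show "L.span S \<subseteq> carrier ?L" using S(2) by (rule L.span_is_subset2)
    show "carrier ?L \<subseteq> L.span S"
    proof
      fix X assume "X \<in> carrier ?L"
      then obtain x where x: "X = U.coset x" "x \<in> ?V" by (auto simp: carrier)
      obtain c where "x - (\<Sum>l<k. sc (c l) (w l)) \<in> U" using bspec[OF span x(2)] by blast
      then have "X = U.coset (\<Sum>l<k. sc (c l) (w l))" by (simp add: x U.coset_eq_iff)
      then show "X \<in> L.span S" using comb[of k c] by simp
    qed
  qed
  then have "L.fin_dim" unfolding L.fin_dim_def using S by blast
  then show ?thesis using vs by (simp add: finite_dimensional_complex_def)
qed

lemma additive_subgroupI':
  assumes N: "abelian_group N" and W: "W \<subseteq> carrier N" "\<zero>\<^bsub>N\<^esub> \<in> W"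
    "\<And>x y. x \<in> W \<Longrightarrow> y \<in> W \<Longrightarrow> x \<oplus>\<^bsub>N\<^esub> y \<in> W"
    "\<And>x. x \<in> W \<Longrightarrow> \<exists>y\<in>W. y \<oplus>\<^bsub>N\<^esub> x = \<zero>\<^bsub>N\<^esub>"
  shows "additive_subgroup W N"
proof -
  interpret abelian_group N by fact
  have "\<ominus>\<^bsub>N\<^esub> x \<in> W" if x: "x \<in> W" for x
  proof -
    obtain y where y: "y \<in> W" "y \<oplus>\<^bsub>N\<^esub> x = \<zero>\<^bsub>N\<^esub>" using W(4)[OF x] by blast
    then have "\<ominus>\<^bsub>N\<^esub> x = y" using W(1) x by (intro minus_equality) auto
    then show ?thesis using y by simp
  qed
  then show ?thesis
    using W by (intro additive_subgroupI add.subgroupI) (auto simp: a_inv_def)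
qed

lemma (in subgroup_of_type) additive_subgroup: "additive_subgroup U (univ_space sc)"
proof (rule additive_subgroupI'[OF abelian_group_univ_space])
  show "\<exists>y\<in>U. y \<oplus>\<^bsub>univ_space sc\<^esub> x = \<zero>\<^bsub>univ_space sc\<^esub>" if "x \<in> U" for x
    using minus_mem[OF that] by (intro bexI[of _ "- x"]) auto
qed (auto simp: zero_mem add_mem)


section \<open>Local-global spaces of operators\<close>

lemma funpow_additive:
  fixes D :: "'a::plus \<Rightarrow> 'a"
  assumes "\<And>x y. D (x + y) = D x + D y"
  shows "(D ^^ i) (x + y) = (D ^^ i) x + (D ^^ i) y"
  by (induction i) (simp_all add: assms)

lemma funpow_scale:
  fixes D :: "'a::times \<Rightarrow> 'a"
  assumes "\<And>x. D (c * x) = c * D x"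
  shows "(D ^^ i) (c * x) = c * (D ^^ i) x"
  by (induction i) (simp_all add: assms)

lemma diffop_add:
  assumes "\<And>x y. D (x + y) = D x + D y"
  shows "diffop \<iota> D L (x + y) = diffop \<iota> D L x + diffop \<iota> D L y"
  by (simp add: diffop_def funpow_additive[of D, OF assms] distrib_left sum.distrib)

lemma diffop_scale:
  assumes "\<And>x. D (c * x) = c * D x"
  shows "diffop \<iota> D L (c * x) = c * diffop \<iota> D L x"
  by (simp add: diffop_def funpow_scale[of D, OF assms] sum_distrib_left mult.left_commute)

context place
begin

abbreviation D :: "complex fls \<Rightarrow> complex fls" where "D \<equiv> completion_deriv emb d v"

lemma D_add: "D (f + g) = D f + D g"
  and D_mult: "D (f * g) = D f * g + f * D g"
  and D_scale: "D (fls_const c * g) = fls_const c * D g"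
  and D_\<psi>: "D (\<psi> x) = \<psi> (d x)"
  by (simp_all add: completion_deriv deriv_v_add deriv_v_mult deriv_v_const deriv_v_\<psi>)

lemma funpow_D_\<psi>: "(D ^^ i) (\<psi> x) = \<psi> ((d ^^ i) x)"
  by (induction i) (simp_all add: D_\<psi>)

lemma diffop_\<psi>: "diffop \<psi> D L (\<psi> x) = \<psi> (diffop id d L x)"
  by (simp add: diffop_def funpow_D_\<psi> \<psi>.hom_sum \<psi>.hom_mult)

lemma operator_image:
  "0 \<in> range (diffop \<psi> D L)"
  "f \<in> range (diffop \<psi> D L) \<Longrightarrow> g \<in> range (diffop \<psi> D L) \<Longrightarrow> f + g \<in> range (diffop \<psi> D L)"
  "f \<in> range (diffop \<psi> D L) \<Longrightarrow> fls_const c * f \<in> range (diffop \<psi> D L)"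
proof -
  show sc: "fls_const c * f \<in> range (diffop \<psi> D L)" if "f \<in> range (diffop \<psi> D L)" for c f
    using that by (auto simp: D_scale simp flip: diffop_scale)
  show "f + g \<in> range (diffop \<psi> D L)" if "f \<in> range (diffop \<psi> D L)" "g \<in> range (diffop \<psi> D L)" for f g
    using that by (auto simp: D_add simp flip: diffop_add)
  show "0 \<in> range (diffop \<psi> D L)" using sc[of "diffop \<psi> D L 0" 0] by simp
qed

end

context differential_function_field
begin

lemma place_locale: "v \<in> places emb \<Longrightarrow> place emb d v"
  by unfold_locales

text \<open>The system x_i' = x_(i+1) closed by the equation L x_0 = f divided by the leading
  coefficient. The entries -1 come from the convention that the connection is d + A.\<close>

definition companion :: "'k poly \<Rightarrow> nat \<Rightarrow> nat \<Rightarrow> 'k" where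
  "companion L i j = (if Suc i < degree L then if j = Suc i then - 1 else 0
     else coeff L j / lead_coeff L)"

lemma companion_sum:
  fixes u :: "nat \<Rightarrow> 'b::field"
  assumes "field_hom \<iota>" and L: "L \<noteq> 0" and i: "i < degree L"
  shows "(\<Sum>j<degree L. \<iota> (companion L i j) * u j) =
    (if Suc i < degree L then - u (Suc i) else (\<Sum>j<degree L. \<iota> (coeff L j) * u j) / \<iota> (lead_coeff L))"
proof -
  interpret \<iota>: field_hom \<iota> by fact
  have "(\<Sum>j<degree L. \<iota> (if j = Suc i then - 1 else 0) * u j)
      = (\<Sum>j<degree L. if j = Suc i then - u j else 0)"
    by (intro sum.cong) (auto simp: \<iota>.hom_uminus)
  then show ?thesis
    by (auto simp: companion_def sum.delta \<iota>.hom_div sum_divide_distrib)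
qed

lemma diffop_split: "diffop \<iota> D' L g =
    (\<Sum>j<degree L. \<iota> (coeff L j) * (D' ^^ j) g) + \<iota> (lead_coeff L) * (D' ^^ degree L) g"
  by (simp add: diffop_def flip: lessThan_Suc_atMost)

definition last_component :: "'k poly \<Rightarrow> 'k \<Rightarrow> nat \<Rightarrow> 'k" where
  "last_component L f i = (if Suc i = degree L then f / lead_coeff L else 0)"

lemma locally_solvable_companion:
  assumes L: "L \<noteq> 0" and v: "v \<in> places emb"
    and f: "completion emb v f \<in> range (diffop (completion emb v) (completion_deriv emb d v) L)"
  shows "locally_solvable (degree L) (companion L) (last_component L f) v"
proof -
  interpret place emb d v using v by (rule place_locale)
  obtain g where g: "\<psi> f = diffop \<psi> D L g" using f by auto
  have lc: "\<psi> (lead_coeff L) \<noteq> 0" using L by simp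
  show ?thesis
    unfolding locally_solvable_def
  proof (intro exI[of _ "\<lambda>i. (D ^^ i) g"] allI impI)
    fix i assume i: "i < degree L"
    show "\<psi> (last_component L f i) = D ((D ^^ i) g) + (\<Sum>j<degree L. \<psi> (companion L i j) * (D ^^ j) g)"
    proof (cases "Suc i < degree L")
      case True
      then show ?thesis
        using i companion_sum[OF \<psi>.field_hom_axioms L i, of "\<lambda>j. (D ^^ j) g"]
        by (simp add: last_component_def)
    next
      case False
      then have Suc: "Suc i = degree L" using i by simp
      then have "D ((D ^^ i) g) = (D ^^ degree L) g" by (metis comp_apply funpow.simps(2))
      then show ?thesis
        using companion_sum[OF \<psi>.field_hom_axioms L i, of "\<lambda>j. (D ^^ j) g"] Suc lc
        by (simp add: last_component_def g diffop_split \<psi>.hom_div field_simps)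
    qed
  qed
qed

lemma solution_of_companion:
  assumes L: "L \<noteq> 0" "degree L > 0"
    and x: "\<And>i. i < degree L \<Longrightarrow> nabla (degree L) (companion L) x i = last_component L f i"
  shows "diffop id d L (x 0) = f"
proof -
  have id: "field_hom (id :: 'k \<Rightarrow> 'k)" by unfold_locales auto
  note sum = companion_sum[OF id L(1), of _ x, unfolded id_apply]
  have step: "x (Suc i) = d (x i)" if "Suc i < degree L" for i
    using x[of i] that sum[of i] by (simp add: nabla_def last_component_def)
  have pow: "(d ^^ i) (x 0) = x i" if "i < degree L" for i
    using that by (induction i) (simp_all add: step)
  obtain n where n: "degree L = Suc n" using L(2) by (cases "degree L") auto
  have "(d ^^ degree L) (x 0) = d (x n)" using pow[of n] n by simp
  moreover have "d (x n) + (\<Sum>j<degree L. coeff L j * x j) / lead_coeff L = f / lead_coeff L"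
    using x[of n] sum[of n] n by (simp add: nabla_def last_component_def)
  moreover have "lead_coeff L \<noteq> 0" using L(1) by simp
  ultimately show ?thesis
    by (simp add: diffop_split pow field_simps)
qed

theorem lgl_operator_finite_dimensional:
  assumes L: "L \<noteq> 0"
  shows "finite_dimensional_complex (lgl_operator emb d L)"
proof -
  let ?sc = "\<lambda>c f. const_emb emb c * f"
  let ?W = "\<lambda>v. range (diffop (completion emb v) (completion_deriv emb d v) L)"
  let ?V = "{f. \<forall>v\<in>places emb. completion emb v f \<in> ?W v}"
  have vs: "vector_space ?sc"
    by unfold_locales (simp_all add: algebra_simps)
  interpret vector_space ?sc by fact
  have d_scale: "d (const_emb emb c * x) = const_emb emb c * d x" for c x
    by (simp add: d_mult d_const)
  have U: "subspace (range (diffop id d L))"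
  proof (rule subspaceI)
    show sc: "const_emb emb c * f \<in> range (diffop id d L)" if "f \<in> range (diffop id d L)" for c f
      using that by (auto simp: d_scale simp flip: diffop_scale)
    show "f + g \<in> range (diffop id d L)" if "f \<in> range (diffop id d L)" "g \<in> range (diffop id d L)" for f g
      using that by (auto simp: d_add simp flip: diffop_add)
    show "0 \<in> range (diffop id d L)"
      using sc[of "diffop id d L 0" 0] by (simp add: const_emb_eq)
  qed
  have V: "subspace ?V"
  proof (rule subspaceI)
    show "0 \<in> ?V"
    proof (intro CollectI ballI)
      fix v assume "v \<in> places emb"
      then interpret place emb d v by (rule place_locale)
      show "\<psi> 0 \<in> ?W v" using operator_image(1) by simp
    qed
    fix f assume f: "f \<in> ?V"
    show "f + g \<in> ?V" if g: "g \<in> ?V" for g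
    proof (intro CollectI ballI)
      fix v assume v: "v \<in> places emb"
      then interpret place emb d v by (rule place_locale)
      show "\<psi> (f + g) \<in> ?W v"
        using operator_image(2)[of "\<psi> f" L "\<psi> g"] f g v by (simp add: \<psi>.hom_add)
    qed
    show "const_emb emb c * f \<in> ?V" for c
    proof (intro CollectI ballI)
      fix v assume v: "v \<in> places emb"
      then interpret place emb d v by (rule place_locale)
      show "\<psi> (const_emb emb c * f) \<in> ?W v"
        using operator_image(3)[of "\<psi> f" L c] f v by (simp add: \<psi>.hom_mult \<psi>_const)
    qed
  qed
  obtain N :: nat where N: "\<forall>w. (\<forall>l\<le>N. \<forall>v\<in>places emb. locally_solvable (degree L) (companion L) (w l) v) \<longrightarrow>
    (\<exists>c x. (\<exists>l\<le>N. c l \<noteq> 0) \<and> (\<forall>i<degree L. (\<Sum>l\<le>N. const_emb emb (c l) * w l i)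
      = nabla (degree L) (companion L) x i))"
    using local_global_dependence[of "degree L" "companion L"] by blast
  show ?thesis
    unfolding lgl_operator_def
  proof (rule finite_dimensional_local_global_kernel[where n = N, OF vs U _ _ _ _ _ V])
    show "abelian_group (univ_space (\<lambda>c g. fls_const c * g) :: (complex, complex fls) module)"
      by (rule abelian_group_univ_space)
    fix v assume v: "v \<in> places emb"
    then interpret place emb d v by (rule place_locale)
    show "additive_subgroup (?W v) (univ_space (\<lambda>c g. fls_const c * g))"
    proof (rule additive_subgroupI'[OF abelian_group_univ_space])
      show "\<exists>y\<in>?W v. y \<oplus>\<^bsub>univ_space (\<lambda>c g. fls_const c * g)\<^esub> x = \<zero>\<^bsub>univ_space (\<lambda>c g. fls_const c * g)\<^esub>"
        if "x \<in> ?W v" for x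
        using operator_image(3)[OF that, of "-1"] by (intro bexI[of _ "- x"]) simp_all
    qed (simp_all add: operator_image)
    show "completion emb v x \<in> carrier (univ_space (\<lambda>c g. fls_const c * g))" for x by simp
    show "completion emb v (x + y) = completion emb v x \<oplus>\<^bsub>univ_space (\<lambda>c g. fls_const c * g)\<^esub> completion emb v y" for x y
      by (simp add: \<psi>.hom_add)
    show "completion emb v u \<in> ?W v" if "u \<in> range (diffop id d L)" for u
      using that by (auto simp flip: diffop_\<psi>)
  next
    fix w :: "nat \<Rightarrow> 'k" assume w: "\<And>l. l \<le> N \<Longrightarrow> w l \<in> ?V"
    show "\<exists>c. (\<exists>l\<le>N. c l \<noteq> 0) \<and> (\<Sum>l\<le>N. const_emb emb (c l) * w l) \<in> range (diffop id d L)"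
    \<comment> \<open>In degree 0 the companion system has no rows and says nothing about f. Then L
      is multiplication by a nonzero element and is surjective.\<close>
    proof (cases "degree L = 0")
      case True
      then obtain a where a: "L = [:a:]" by (rule degree_eq_zeroE)
      then have "diffop id d L (f / a) = f" for f using L by (simp add: diffop_def)
      then have "f \<in> range (diffop id d L)" for f by (metis rangeI)
      then show ?thesis by (intro exI[of _ "\<lambda>_. 1"]) auto
    next
      case False
      have "\<forall>l\<le>N. \<forall>v\<in>places emb. locally_solvable (degree L) (companion L) (last_component L (w l)) v"
        using w locally_solvable_companion[OF L] by blast
      with N[rule_format, of "\<lambda>l. last_component L (w l)"] obtain c x where c: "\<exists>l\<le>N. c l \<noteq> 0"
        and x: "\<forall>i<degree L. (\<Sum>l\<le>N. const_emb emb (c l) * last_component L (w l) i)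
          = nabla (degree L) (companion L) x i" by blast
      have "(\<Sum>l\<le>N. const_emb emb (c l) * last_component L (w l) i)
          = last_component L (\<Sum>l\<le>N. const_emb emb (c l) * w l) i" for i
        by (simp add: last_component_def sum_divide_distrib)
      then have "diffop id d L (x 0) = (\<Sum>l\<le>N. const_emb emb (c l) * w l)"
        using x False by (intro solution_of_companion[OF L]) simp_all
      then show ?thesis using c by (metis rangeI)
    qed
  qed
qed

end

section \<open>Local-global spaces of differential modules\<close>

text \<open>The counterpart of \<open>frag_extend\<close> with values in a ring: the additive
  extension of f to the free abelian group.\<close>

definition frag_sum :: "('i \<Rightarrow> 'b::comm_ring_1) \<Rightarrow> ('i \<Rightarrow>\<^sub>0 int) \<Rightarrow> 'b" where
  "frag_sum f x = (\<Sum>i\<in>Poly_Mapping.keys x. of_int (Poly_Mapping.lookup x i) * f i)"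

lemma frag_sum_superset:
  assumes "finite S" "Poly_Mapping.keys x \<subseteq> S"
  shows "frag_sum f x = (\<Sum>i\<in>S. of_int (Poly_Mapping.lookup x i) * f i)"
  unfolding frag_sum_def using assms
  by (intro sum.mono_neutral_left) (auto simp: in_keys_iff)

lemma frag_sum_add: "frag_sum f (x + y) = frag_sum f x + frag_sum f y"
proof -
  let ?S = "Poly_Mapping.keys x \<union> Poly_Mapping.keys y"
  have S: "finite ?S" "Poly_Mapping.keys x \<subseteq> ?S" "Poly_Mapping.keys y \<subseteq> ?S"
      "Poly_Mapping.keys (x + y) \<subseteq> ?S"
    using Poly_Mapping.keys_add[of x y] by auto
  show ?thesis
    unfolding frag_sum_superset[OF S(1,2)] frag_sum_superset[OF S(1,3)] frag_sum_superset[OF S(1,4)]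
    by (simp add: lookup_add distrib_right sum.distrib)
qed

lemma frag_sum_diff: "frag_sum f (x - y) = frag_sum f x - frag_sum f y"
  using frag_sum_add[of f "x - y" y] by simp

lemma frag_sum_0 [simp]: "frag_sum f 0 = 0"
  by (simp add: frag_sum_def)

lemma frag_sum_of [simp]: "frag_sum f (frag_of i) = f i"
  by (simp add: frag_sum_def)

lemma (in differential_module) vector_space_smul: "vector_space smul"
  using finite_dimensional by (auto simp: finite_dimensional_vector_space_def)

lemma (in differential_module) coordinates:
  "\<exists>(r :: nat) e \<kappa>. (\<forall>m. m = (\<Sum>i<r. smul (\<kappa> m i) (e i)))
    \<and> (\<forall>m n i. \<kappa> (m + n) i = \<kappa> m i + \<kappa> n i) \<and> (\<forall>f m i. \<kappa> (smul f m) i = f * \<kappa> m i)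
    \<and> (\<forall>x i. i < r \<longrightarrow> \<kappa> (\<Sum>j<r. smul (x j) (e j)) i = x i)"
proof -
  obtain B where "finite_dimensional_vector_space smul B" using finite_dimensional by blast
  then interpret finite_dimensional_vector_space smul B .
  obtain e where e: "bij_betw e {..<card B} B"
    using ex_bij_betw_nat_finite[OF finite_Basis] by (auto simp: atLeast0LessThan)
  define \<kappa> where "\<kappa> m i = representation B m (e i)" for m i
  have mem: "m \<in> span B" for m by (simp add: span_Basis)
  have add: "\<kappa> (m + n) i = \<kappa> m i + \<kappa> n i" and scale: "\<kappa> (smul f m) i = f * \<kappa> m i" for m n f i
    by (simp_all add: \<kappa>_def representation_add[OF independent_Basis mem mem]
        representation_scale[OF independent_Basis mem])
  have sum: "(\<Sum>i<card B. smul (\<kappa> m i) (e i)) = m" for m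
    using sum.reindex_bij_betw[OF e, of "\<lambda>b. smul (representation B m b) b"]
      sum_representation_eq[OF independent_Basis mem finite_Basis order_refl, of m]
    by (simp add: \<kappa>_def)
  have basis: "\<kappa> (e j) i = (if i = j then 1 else 0)" if "i < card B" "j < card B" for i j
  proof -
    have "e j \<in> B" using e that by (auto simp: bij_betw_def)
    moreover have "e i = e j \<longleftrightarrow> i = j"
      using e that by (auto simp: bij_betw_def inj_on_def)
    ultimately show ?thesis by (auto simp: \<kappa>_def representation_basis[OF independent_Basis])
  qed
  have "\<kappa> 0 i = 0" for i using scale[of 0 0 i] by simp
  then have \<kappa>_sum: "\<kappa> (\<Sum>j\<in>J. g j) i = (\<Sum>j\<in>J. \<kappa> (g j) i)" for J :: "nat set" and g i
    by (induction J rule: infinite_finite_induct) (simp_all add: add)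
  have unit: "\<kappa> (\<Sum>j<card B. smul (x j) (e j)) i = x i" if "i < card B" for x i
  proof -
    have "\<kappa> (\<Sum>j<card B. smul (x j) (e j)) i = (\<Sum>j<card B. if j = i then x j else 0)"
      unfolding \<kappa>_sum scale using that by (intro sum.cong refl) (auto simp: basis)
    then show ?thesis using that by simp
  qed
  show ?thesis
    by (intro exI[of _ "card B"] exI[of _ e] exI[of _ \<kappa>]) (simp add: sum add scale unit)
qed

section \<open>The tensor product at a place\<close>

context place
begin

context
  fixes smul :: "'a \<Rightarrow> 'm::ab_group_add \<Rightarrow> 'm" and dM :: "'m \<Rightarrow> 'm"
  assumes dm: "differential_module d smul dM"
begin

interpretation dm: differential_module d smul dM by (rule dm)

interpretation M: vector_space smul by (rule dm.vector_space_smul)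

abbreviation \<sigma> :: "complex \<Rightarrow> ((complex fls \<times> 'm) \<Rightarrow>\<^sub>0 int) \<Rightarrow> ((complex fls \<times> 'm) \<Rightarrow>\<^sub>0 int)" where
  "\<sigma> c \<equiv> frag_extend (\<lambda>(g, m). frag_of (fls_const c * g, m))"

abbreviation \<Delta> :: "((complex fls \<times> 'm) \<Rightarrow>\<^sub>0 int) \<Rightarrow> ((complex fls \<times> 'm) \<Rightarrow>\<^sub>0 int)" where
  "\<Delta> \<equiv> frag_extend (\<lambda>(g, m). frag_of (D g, m) + frag_of (g, dM m))"

abbreviation T :: "((complex fls \<times> 'm) \<Rightarrow>\<^sub>0 int) set" where "T \<equiv> tensor_rel \<psi> smul"

interpretation T: subgroup_of_type \<sigma> T
proof
  fix x y :: "(complex fls \<times> 'm) \<Rightarrow>\<^sub>0 int"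
  show "x - y \<in> T" if "x \<in> T" "y \<in> T" using that by (rule tensor_rel.diff)
  have "frag_of (0 + 0, 0) - frag_of (0, 0) - frag_of (0, 0) \<in> T" by (rule tensor_rel.add_left)
  from tensor_rel.diff[OF this this] show "0 \<in> T" by simp
qed

lemma \<Delta>_T: "x \<in> T \<Longrightarrow> \<Delta> x \<in> T"
proof (induction rule: tensor_rel.induct)
  case (add_left g h m)
  have "\<Delta> (frag_of (g + h, m) - frag_of (g, m) - frag_of (h, m))
      = (frag_of (D g + D h, m) - frag_of (D g, m) - frag_of (D h, m))
        + (frag_of (g + h, dM m) - frag_of (g, dM m) - frag_of (h, dM m))"
    by (simp add: frag_extend_diff D_add)
  then show ?case by (simp only: T.add_mem tensor_rel.add_left)
next
  case (add_right g m n)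
  have "\<Delta> (frag_of (g, m + n) - frag_of (g, m) - frag_of (g, n))
      = (frag_of (D g, m + n) - frag_of (D g, m) - frag_of (D g, n))
        + (frag_of (g, dM m + dM n) - frag_of (g, dM m) - frag_of (g, dM n))"
    by (simp add: frag_extend_diff dm.dM_add)
  then show ?case by (simp only: T.add_mem tensor_rel.add_right)
next
  case (balanced a g m)
  \<comment> \<open>The Leibniz rules of \<open>D\<close> and \<open>dM\<close> each produce a term
    with \<open>d a\<close>, on the left and on the right factor; \<open>balanced\<close> identifies
    the two. The remaining relations split the sums and move \<open>a\<close> across.\<close>
  have "\<Delta> (frag_of (\<psi> a * g, m) - frag_of (g, smul a m))
      = (frag_of (\<psi> (d a) * g + \<psi> a * D g, m) - frag_of (\<psi> (d a) * g, m) - frag_of (\<psi> a * D g, m))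
        + (frag_of (\<psi> (d a) * g, m) - frag_of (g, smul (d a) m))
        + (frag_of (\<psi> a * D g, m) - frag_of (D g, smul a m))
        + (frag_of (\<psi> a * g, dM m) - frag_of (g, smul a (dM m)))
        - (frag_of (g, smul (d a) m + smul a (dM m)) - frag_of (g, smul (d a) m)
            - frag_of (g, smul a (dM m)))"
    by (simp add: frag_extend_diff D_mult D_\<psi> dm.dM_scale)
  then show ?case
    by (simp only: T.add_mem T.diff_mem tensor_rel.add_left tensor_rel.add_right tensor_rel.balanced)
next
  case (diff x y)
  then show ?case by (simp only: frag_extend_diff T.diff_mem)
qed

lemma \<sigma>_T: "x \<in> T \<Longrightarrow> \<sigma> c x \<in> T"
proof (induction rule: tensor_rel.induct)
  case (add_left g h m)
  have "\<sigma> c (frag_of (g + h, m) - frag_of (g, m) - frag_of (h, m))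
      = frag_of (fls_const c * g + fls_const c * h, m) - frag_of (fls_const c * g, m)
        - frag_of (fls_const c * h, m)"
    by (simp add: frag_extend_diff distrib_left)
  then show ?case by (simp only: tensor_rel.add_left)
next
  case (add_right g m n)
  have "\<sigma> c (frag_of (g, m + n) - frag_of (g, m) - frag_of (g, n))
      = frag_of (fls_const c * g, m + n) - frag_of (fls_const c * g, m) - frag_of (fls_const c * g, n)"
    by (simp add: frag_extend_diff)
  then show ?case by (simp only: tensor_rel.add_right)
next
  case (balanced a g m)
  have "\<sigma> c (frag_of (\<psi> a * g, m) - frag_of (g, smul a m))
      = frag_of (\<psi> a * (fls_const c * g), m) - frag_of (fls_const c * g, smul a m)"
    by (simp add: frag_extend_diff mult.left_commute)
  then show ?case by (simp only: tensor_rel.balanced)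
next
  case (diff x y)
  then show ?case by (simp only: frag_extend_diff T.diff_mem)
qed

lemma \<sigma>_\<Delta>: "\<sigma> c (\<Delta> x) = \<Delta> (\<sigma> c x)"
  by (induction x rule: frag_induction[OF subset_UNIV])
    (auto simp: frag_extend_diff frag_extend_add D_scale)

lemma tensor_Q: "tensor \<psi> smul = T.Q"
  by (simp add: tensor_def)

lemma abelian_group_tensor: "abelian_group (tensor \<psi> smul)"
  unfolding tensor_Q by (rule T.abelian_group_Q)

lemma tensor_unit_coset: "tensor_unit \<psi> smul m = T.coset (frag_of (1, m))"
  by (simp add: tensor_unit_def T.coset_eq)

lemma tensor_deriv_coset: "tensor_deriv \<psi> D smul dM (T.coset x) = T.coset (\<Delta> x)"
proof -
  have "induced_map (univ_space \<sigma>) T \<Delta> (T.coset x) = T +>\<^bsub>univ_space \<sigma>\<^esub> \<Delta> x"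
    by (rule T.induced_map_coset[OF abelian_group_univ_space T.additive_subgroup])
      (simp_all add: frag_extend_add \<Delta>_T)
  then show ?thesis by (simp only: tensor_deriv_def T.coset_eq)
qed

lemma tensor_deriv_image:
  "tensor_deriv \<psi> D smul dM ` carrier (tensor \<psi> smul) = range (\<lambda>x. T.coset (\<Delta> x))"
  unfolding tensor_Q T.carrier_Q by (simp add: image_image tensor_deriv_coset)

lemma tensor_unit_mem_iff:
  "tensor_unit \<psi> smul m \<in> tensor_deriv \<psi> D smul dM ` carrier (tensor \<psi> smul)
    \<longleftrightarrow> (\<exists>x. frag_of (1, m) - \<Delta> x \<in> T)"
  unfolding tensor_deriv_image tensor_unit_coset by (auto simp: image_iff T.coset_eq_iff)

lemma additive_subgroup_tensor_deriv:
  "additive_subgroup (tensor_deriv \<psi> D smul dM ` carrier (tensor \<psi> smul)) (tensor \<psi> smul)"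
proof -
  have "additive_subgroup (range (\<lambda>x. T.coset (\<Delta> x))) T.Q"
  proof (rule additive_subgroupI'[OF T.abelian_group_Q])
    show "range (\<lambda>x. T.coset (\<Delta> x)) \<subseteq> carrier T.Q" by (auto simp: T.carrier_Q)
    show "\<zero>\<^bsub>T.Q\<^esub> \<in> range (\<lambda>x. T.coset (\<Delta> x))"
      by (intro image_eqI[of _ _ 0]) (simp_all add: T.zero_Q)
    show "X \<oplus>\<^bsub>T.Q\<^esub> Y \<in> range (\<lambda>x. T.coset (\<Delta> x))"
      if "X \<in> range (\<lambda>x. T.coset (\<Delta> x))" "Y \<in> range (\<lambda>x. T.coset (\<Delta> x))" for X Y
      using that by (auto simp: T.add_Q simp flip: frag_extend_add)
    fix X assume "X \<in> range (\<lambda>x. T.coset (\<Delta> x))"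
    then obtain x where "X = T.coset (\<Delta> x)" by blast
    moreover have "T.coset (\<Delta> (- x)) \<oplus>\<^bsub>T.Q\<^esub> T.coset (\<Delta> x) = \<zero>\<^bsub>T.Q\<^esub>"
      by (simp add: T.add_Q T.zero_Q frag_extend_minus)
    ultimately show "\<exists>Y\<in>range (\<lambda>x. T.coset (\<Delta> x)). Y \<oplus>\<^bsub>T.Q\<^esub> X = \<zero>\<^bsub>T.Q\<^esub>" by blast
  qed
  then show ?thesis by (simp only: tensor_deriv_image flip: tensor_Q)
qed

lemma tensor_unit_carrier: "tensor_unit \<psi> smul m \<in> carrier (tensor \<psi> smul)"
  unfolding tensor_unit_coset tensor_Q T.carrier_Q by simp

lemma tensor_unit_add:
  "tensor_unit \<psi> smul (m + n) = tensor_unit \<psi> smul m \<oplus>\<^bsub>tensor \<psi> smul\<^esub> tensor_unit \<psi> smul n"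
  unfolding tensor_unit_coset tensor_Q T.add_Q T.coset_eq_iff diff_diff_eq[symmetric]
  by (rule tensor_rel.add_right)

abbreviation local_image where
  "local_image \<equiv> tensor_deriv \<psi> D smul dM ` carrier (tensor \<psi> smul)"

lemma frag_zero_mem: "frag_of (0, m) \<in> T" "frag_of (g, 0) \<in> T"
  using T.minus_mem[OF tensor_rel.add_left[of 0 0 m \<psi> smul]]
    T.minus_mem[OF tensor_rel.add_right[of g 0 0 \<psi> smul]] by simp_all

lemma tensor_unit_mem:
  "tensor_unit \<psi> smul 0 \<in> local_image"
  "tensor_unit \<psi> smul (dM m) \<in> local_image"
  "tensor_unit \<psi> smul m \<in> local_image \<Longrightarrow> tensor_unit \<psi> smul n \<in> local_image \<Longrightarrow>
    tensor_unit \<psi> smul (m + n) \<in> local_image"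
  "tensor_unit \<psi> smul m \<in> local_image \<Longrightarrow> tensor_unit \<psi> smul (smul (kc c) m) \<in> local_image"
  unfolding tensor_unit_mem_iff
proof -
  show "\<exists>x. frag_of (1, 0) - \<Delta> x \<in> T"
    using frag_zero_mem by (intro exI[of _ 0]) simp
  have "D 1 = 0" using D_\<psi>[of 1] by simp
  then have "frag_of (1, dM m) - \<Delta> (frag_of (1, m)) = - frag_of (0, m)" by simp
  also have "\<dots> \<in> T" by (intro T.minus_mem frag_zero_mem)
  finally show "\<exists>x. frag_of (1, dM m) - \<Delta> x \<in> T" by (rule exI)
  show "\<exists>x. frag_of (1, m + n) - \<Delta> x \<in> T"
    if m: "\<exists>x. frag_of (1, m) - \<Delta> x \<in> T" and n: "\<exists>x. frag_of (1, n) - \<Delta> x \<in> T"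
  proof -
    obtain x y where xy: "frag_of (1, m) - \<Delta> x \<in> T" "frag_of (1, n) - \<Delta> y \<in> T" using m n by blast
    have "frag_of (1, m + n) - \<Delta> (x + y) = (frag_of (1, m + n) - frag_of (1, m) - frag_of (1, n))
        + ((frag_of (1, m) - \<Delta> x) + (frag_of (1, n) - \<Delta> y))"
      by (simp add: frag_extend_add)
    also have "\<dots> \<in> T" by (intro T.add_mem xy tensor_rel.add_right)
    finally show ?thesis by (rule exI)
  qed
  show "\<exists>x. frag_of (1, smul (kc c) m) - \<Delta> x \<in> T"
    if m: "\<exists>x. frag_of (1, m) - \<Delta> x \<in> T"
  proof -
    obtain x where x: "frag_of (1, m) - \<Delta> x \<in> T" using m by blast
    have "\<sigma> c (frag_of (1, m) - \<Delta> x) = frag_of (\<psi> (kc c) * 1, m) - \<Delta> (\<sigma> c x)"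
      unfolding frag_extend_diff \<sigma>_\<Delta> by (simp add: \<psi>_const)
    \<comment> \<open>\<sigma> scales the left factor and \<open>smul\<close> the right one;
      \<open>balanced\<close> exchanges them.\<close>
    then have "frag_of (1, smul (kc c) m) - \<Delta> (\<sigma> c x)
        = \<sigma> c (frag_of (1, m) - \<Delta> x) - (frag_of (\<psi> (kc c) * 1, m) - frag_of (1, smul (kc c) m))"
      by simp
    also have "\<dots> \<in> T" by (intro T.diff_mem \<sigma>_T x tensor_rel.balanced)
    finally show ?thesis by (rule exI)
  qed
qed

text \<open>\<open>\<Theta> i\<close> sends g \<otimes> m to g times the i-th coordinate of m. It
  vanishes on the tensor relations and turns the derivation into the connection with matrix
  \<open>A\<close>, so a preimage of 1 \<otimes> m gives a local solution. Only this implication is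
  required, so the tensor product is never identified with a power of the completion.\<close>

lemma locally_solvable_module:
  assumes \<kappa>: "\<And>m n i. \<kappa> (m + n) i = \<kappa> m i + \<kappa> n i" "\<And>f m i. \<kappa> (smul f m) i = f * \<kappa> m i"
    and A: "\<And>m i. i < r \<Longrightarrow> \<kappa> (dM m) i = d (\<kappa> m i) + (\<Sum>j<r. A i j * \<kappa> m j)"
    and m: "tensor_unit \<psi> smul m \<in> local_image"
  shows "locally_solvable r A (\<kappa> m) v"
proof -
  define \<Theta> where "\<Theta> i = frag_sum (\<lambda>(g, m). g * \<psi> (\<kappa> m i))" for i
  have T0: "\<Theta> i x = 0" if "x \<in> T" for x i
    using that
    by (induction rule: tensor_rel.induct)
      (simp_all add: \<Theta>_def frag_sum_diff frag_sum_add \<kappa> \<psi>.hom_add \<psi>.hom_mult algebra_simps)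
  have \<Theta>_\<Delta>: "\<Theta> i (\<Delta> x) = D (\<Theta> i x) + (\<Sum>j<r. \<psi> (A i j) * \<Theta> j x)" if i: "i < r" for i x
  proof (induction x rule: frag_induction[OF subset_UNIV])
    case 1
    have "D 0 = 0" using D_\<psi>[of 0] by simp
    then show ?case by (simp add: \<Theta>_def)
  next
    case (2 x)
    obtain g m where x: "x = (g, m)" by (cases x)
    show ?case
      by (simp add: x \<Theta>_def frag_sum_add A[OF i] D_mult D_\<psi> \<psi>.hom_add \<psi>.hom_sum \<psi>.hom_mult
          distrib_left sum_distrib_left mult_ac)
  next
    case (3 a b)
    have "D (f - g) = D f - D g" for f g using D_add[of "f - g" g] by simp
    then show ?case
      using 3 by (simp add: frag_extend_diff \<Theta>_def frag_sum_diff right_diff_distrib sum_subtractf)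
  qed
  obtain x where x: "frag_of (1, m) - \<Delta> x \<in> T" using m unfolding tensor_unit_mem_iff by blast
  have "\<psi> (\<kappa> m i) = D (\<Theta> i x) + (\<Sum>j<r. \<psi> (A i j) * \<Theta> j x)" if i: "i < r" for i
    using T0[OF x, of i] by (simp add: \<Theta>_def frag_sum_diff flip: \<Theta>_\<Delta>[OF i, unfolded \<Theta>_def])
  then show ?thesis unfolding locally_solvable_def by (intro exI[of _ "\<lambda>i. \<Theta> i x"]) simp
qed

end

end

context differential_function_field
begin

theorem lgl_module_finite_dimensional:
  fixes smul :: "'k \<Rightarrow> 'm::ab_group_add \<Rightarrow> 'm" and dM :: "'m \<Rightarrow> 'm"
  assumes dm: "differential_module d smul dM"
  shows "finite_dimensional_complex (lgl_module emb d smul dM)"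
proof -
  interpret dm: differential_module d smul dM by (rule dm)
  interpret M: vector_space smul by (rule dm.vector_space_smul)
  let ?sc = "\<lambda>c. smul (const_emb emb c)"
  let ?N = "\<lambda>v. tensor (completion emb v) smul"
  let ?W = "\<lambda>v. tensor_deriv (completion emb v) (completion_deriv emb d v) smul dM ` carrier (?N v)"
  let ?V = "{m. \<forall>v\<in>places emb. tensor_unit (completion emb v) smul m \<in> ?W v}"
  have vs: "vector_space ?sc"
    by unfold_locales
      (simp_all add: M.scale_left_distrib M.scale_right_distrib)
  interpret vector_space ?sc by fact
  have dM0: "dM 0 = 0" using dm.dM_add[of 0 0] by simp
  have U: "subspace (range dM)"
  proof (rule subspaceI)
    show "0 \<in> range dM" using rangeI[of dM 0] by (simp add: dM0)
    show "m + n \<in> range dM" if "m \<in> range dM" "n \<in> range dM" for m n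
      using that by (auto simp flip: dm.dM_add)
    show "?sc c m \<in> range dM" if m: "m \<in> range dM" for c m
    proof -
      obtain n where "m = dM n" using m by blast
      then have "?sc c m = dM (?sc c n)" by (simp add: dm.dM_scale d_const)
      then show ?thesis by simp
    qed
  qed
  have V: "subspace ?V"
  proof (rule subspaceI)
    show "0 \<in> ?V" using place.tensor_unit_mem(1)[OF place_locale dm] by simp
    show "m + n \<in> ?V" if "m \<in> ?V" "n \<in> ?V" for m n
      using place.tensor_unit_mem(3)[OF place_locale dm] that by simp
    show "?sc c m \<in> ?V" if "m \<in> ?V" for c m
      using place.tensor_unit_mem(4)[OF place_locale dm] that by simp
  qed
  obtain r :: nat and e \<kappa> where "\<forall>m. m = (\<Sum>i<r. smul (\<kappa> m i) (e i))"
    "\<forall>m n i. \<kappa> (m + n) i = \<kappa> m i + \<kappa> n i" "\<forall>f m i. \<kappa> (smul f m) i = f * \<kappa> m i"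
    "\<forall>x i. i < r \<longrightarrow> \<kappa> (\<Sum>j<r. smul (x j) (e j)) i = x i"
    using dm.coordinates by (elim exE conjE) (rule that)
  note sum = this(1)[rule_format] and add = this(2)[rule_format]
    and scale = this(3)[rule_format] and unit = this(4)[rule_format]
  \<comment> \<open>Column j consists of the coordinates of the derivative of \<open>e j\<close>,
    which makes the coordinate map carry \<open>dM\<close> to \<open>nabla r A\<close>.\<close>
  define A where "A i j = \<kappa> (dM (e j)) i" for i j
  have \<kappa>0: "\<kappa> 0 i = 0" for i using scale[of 0 0 i] by simp
  have \<kappa>_sum: "\<kappa> (\<Sum>j\<in>J. g j) i = (\<Sum>j\<in>J. \<kappa> (g j) i)" for J :: "nat set" and g i
    by (induction J rule: infinite_finite_induct) (simp_all add: add \<kappa>0)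
  have dM_sum: "dM (\<Sum>j\<in>J. g j) = (\<Sum>j\<in>J. dM (g j))" for J :: "nat set" and g
    by (induction J rule: infinite_finite_induct) (simp_all add: dm.dM_add dM0)
  have \<kappa>_dM: "\<kappa> (dM m) i = d (\<kappa> m i) + (\<Sum>j<r. A i j * \<kappa> m j)" if i: "i < r" for m i
  proof -
    have "dM m = dM (\<Sum>j<r. smul (\<kappa> m j) (e j))" using sum[of m] by (rule arg_cong)
    also have "\<dots> = (\<Sum>j<r. smul (d (\<kappa> m j)) (e j)) + (\<Sum>j<r. smul (\<kappa> m j) (dM (e j)))"
      by (simp add: dM_sum dm.dM_scale sum.distrib)
    finally have "\<kappa> (dM m) i = d (\<kappa> m i) + \<kappa> (\<Sum>j<r. smul (\<kappa> m j) (dM (e j))) i"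
      by (simp only: add unit[OF i])
    also have "\<kappa> (\<Sum>j<r. smul (\<kappa> m j) (dM (e j))) i = (\<Sum>j<r. A i j * \<kappa> m j)"
      by (simp add: \<kappa>_sum scale A_def mult.commute)
    finally show ?thesis .
  qed
  obtain N :: nat where N: "\<forall>w. (\<forall>l\<le>N. \<forall>v\<in>places emb. locally_solvable r A (w l) v) \<longrightarrow>
    (\<exists>c x. (\<exists>l\<le>N. c l \<noteq> 0) \<and> (\<forall>i<r. (\<Sum>l\<le>N. const_emb emb (c l) * w l i) = nabla r A x i))"
    using local_global_dependence[of r A] by blast
  show ?thesis
    unfolding lgl_module_def
  proof (rule finite_dimensional_local_global_kernel[where n = N, OF vs U _ _ _ _ _ V])
    fix v assume v: "v \<in> places emb"
    note p = place_locale[OF v]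
    show "abelian_group (?N v)" by (rule place.abelian_group_tensor[OF p dm])
    show "additive_subgroup (?W v) (?N v)" by (rule place.additive_subgroup_tensor_deriv[OF p dm])
    show "tensor_unit (completion emb v) smul m \<in> carrier (?N v)" for m
      by (rule place.tensor_unit_carrier[OF p dm])
    show "tensor_unit (completion emb v) smul (m + n) =
        tensor_unit (completion emb v) smul m \<oplus>\<^bsub>?N v\<^esub> tensor_unit (completion emb v) smul n" for m n
      by (rule place.tensor_unit_add[OF p dm])
    show "tensor_unit (completion emb v) smul u \<in> ?W v" if "u \<in> range dM" for u
      using that place.tensor_unit_mem(2)[OF p dm] by auto
  next
    fix w :: "nat \<Rightarrow> 'm" assume w: "\<And>l. l \<le> N \<Longrightarrow> w l \<in> ?V"
    have "\<forall>l\<le>N. \<forall>v\<in>places emb. locally_solvable r A (\<kappa> (w l)) v"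
    proof (intro allI impI ballI)
      fix l v assume l: "l \<le> N" and v: "v \<in> places emb"
      show "locally_solvable r A (\<kappa> (w l)) v"
        by (rule place.locally_solvable_module[where \<kappa> = \<kappa> and r = r and A = A,
            OF place_locale[OF v] dm add scale \<kappa>_dM])
          (use w[OF l] v in auto)
    qed
    with N[rule_format, of "\<lambda>l. \<kappa> (w l)"] obtain c x where c: "\<exists>l\<le>N. c l \<noteq> 0"
      and x: "\<forall>i<r. (\<Sum>l\<le>N. const_emb emb (c l) * \<kappa> (w l) i) = nabla r A x i" by blast
    define X where "X = (\<Sum>i<r. smul (x i) (e i))"
    have "\<kappa> (\<Sum>l\<le>N. ?sc (c l) (w l)) i = \<kappa> (dM X) i" if i: "i < r" for i
    proof -
      have "\<kappa> (dM X) i = nabla r A x i"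
        unfolding \<kappa>_dM[OF i] nabla_def X_def using i by (simp add: unit)
      then show ?thesis using x i by (simp add: \<kappa>_sum scale)
    qed
    then have "(\<Sum>i<r. smul (\<kappa> (\<Sum>l\<le>N. ?sc (c l) (w l)) i) (e i)) = (\<Sum>i<r. smul (\<kappa> (dM X) i) (e i))"
      by (intro sum.cong) auto
    then have "(\<Sum>l\<le>N. ?sc (c l) (w l)) = dM X" by (simp only: sum[symmetric])
    then show "\<exists>c. (\<exists>l\<le>N. c l \<noteq> 0) \<and> (\<Sum>l\<le>N. ?sc (c l) (w l)) \<in> range dM" using c by auto
  qed
qed

end

theorem theorem6p1:
  fixes emb :: "complex poly fract \<Rightarrow> 'k::field"
    and d :: "'k \<Rightarrow> 'k"
  assumes "differential_function_field emb d"
  shows "(\<forall>L :: 'k poly. L \<noteq> 0 \<longrightarrow> finite_dimensional_complex (lgl_operator emb d L))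
    \<and> (\<forall>(smul :: 'k \<Rightarrow> 'm::ab_group_add \<Rightarrow> 'm) (dM :: 'm \<Rightarrow> 'm).
         differential_module d smul dM \<longrightarrow>
           finite_dimensional_complex (lgl_module emb d smul dM))"
proof -
  interpret differential_function_field emb d by fact
  show ?thesis using lgl_operator_finite_dimensional lgl_module_finite_dimensional by blast
qed

end
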